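(* For every compact locally polyhedral $C^{\infty}$-manifold $M$, there exists a $\sigma$-compact finite-dimensional $C^{\infty}$-manifold $\widetilde{M}$ without boundary such that $M$ is a locally polyhedral full submanifold of $\widetilde{M}$ and the inclusion map $\mathrm{id}_M\colon M\hookrightarrow \widetilde{M}$ is a $C^{\infty}$-diffeomorphism onto its image.
   Context: Let $n\in\mathbb{N}_0$ and $E$ be an $n$-dimensional real vector space. A convex polytope in $E$ is the convex hull of a non-empty finite subset of $E$. Calculus: for a subset $U\subseteq E$ which is locally convex (each point has a convex neighbourhood in $U$) with dense interior $U^\circ$, a map $f\colon U\to F$ to a locally convex space is $C^1$ if it is continuous, the directional derivatives $df(x,y)$ exist for $(x,y)\in U^\circ\times E$, and $df$ extends continuously to $U\times E$; it is $C^k$ if it is $C^1$ and $df$ is $C^{k-1}$, and $C^\infty$ if it is $C^k$ for all $k\in\mathbb{N}$. A locally polyhedral $C^\infty$-manifold of dimension $n$ is a Hausdorff topological space $M$ with a set $\mathcal{A}$ of homeomorphisms (charts) $\varphi\colon U_\varphi\to V_\varphi$ from open subsets $U_\varphi\subseteq M$ onto open subsets $V_\varphi$ of convex polytopes $P_\varphi\subseteq E$ with non-empty interior, such that the $U_\varphi$ cover $M$, all $\varphi\circ\psi^{-1}$ (on $\psi(U_\varphi\cap U_\psi)$) are $C^\infty$, and $\mathcal{A}$ is maximal among such atlases. Let $\widetilde M$ be a finite-dimensional $C^\infty$-manifold (without boundary) modeled on $E$. A subset $M\subseteq\widetilde M$ is a locally polyhedral full submanifold if for each $x\in M$ there is a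 chart $\varphi\colon U_\varphi\to V_\varphi\subseteq E$ of $\widetilde M$ around $x$ such that $\varphi(U_\varphi\cap M)\subseteq P_\varphi$ is an open subset of a polytope $P_\varphi\subseteq E$ with non-empty interior. Such a subset is a locally polyhedral $C^\infty$-manifold with the maximal polyhedral smooth atlas containing all the charts $\varphi|_{U_\varphi\cap M}$; the image of the inclusion map carries this structure. *)

theory Defs
  imports "HOL-Analysis.Analysis"
begin

text \<open>
  A finite-dimensional vector space \<open>E\<close> is rendered as a type of class \<^class>\<open>real_normed_vector\<close>
  together with a finite basis; the norm only serves to provide the canonical vector space
  topology.  Unlike \<^class>\<open>euclidean_space\<close>, this also admits dimension \<open>0\<close>.
\<close>

definition has_dimension :: "'e::real_normed_vector itself \<Rightarrow> nat \<Rightarrow> bool" where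
  "has_dimension E n \<longleftrightarrow>
     (\<exists>B::'e set. finite B \<and> card B = n \<and> independent B \<and> span B = UNIV)"


subsection \<open>Differential calculus on subsets with dense interior\<close>

text \<open>
  The recursion ``\<open>f\<close> is \<open>C\<^sup>k\<^sup>+\<^sup>1\<close> on \<open>U \<subseteq> E\<close> iff \<open>f\<close> is \<open>C\<^sup>1\<close> and \<open>df\<close> is \<open>C\<^sup>k\<close> on \<open>U \<times> E \<subseteq> E \<times> E\<close>''
  doubles the number of factors of the domain at every step, so it is not a recursion at one fixed
  type of pairs.  We therefore realise \<open>E\<^sup>m\<close> inside \<open>nat \<Rightarrow> E\<close>, whose topology is the product
  topology, as the set of all functions vanishing from \<open>m\<close> on.  The function \<open>join m\<close> is the
  identification of \<open>E\<^sup>m \<times> E\<^sup>m\<close> with \<open>E\<^sup>2\<^sup>m\<close>.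
\<close>

definition tuples :: "nat \<Rightarrow> (nat \<Rightarrow> 'e::real_normed_vector) set" where
  "tuples m = {v. \<forall>i\<ge>m. v i = 0}"

definition join :: "nat \<Rightarrow> (nat \<Rightarrow> 'e) \<Rightarrow> (nat \<Rightarrow> 'e) \<Rightarrow> (nat \<Rightarrow> 'e)" where
  "join m x y = (\<lambda>i. if i < m then x i else y (i - m))"

definition times_tuples :: "nat \<Rightarrow> (nat \<Rightarrow> 'e::real_normed_vector) set \<Rightarrow> (nat \<Rightarrow> 'e) set" where
  "times_tuples m U = {join m x y | x y. x \<in> U \<and> y \<in> tuples m}"

text \<open>
  The directional derivative of \<open>f\<close> at \<open>x\<close> in direction \<open>y\<close> is \<open>d\<close>; sums and scalar multiples in
  \<open>nat \<Rightarrow> E\<close> are written out pointwise.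
\<close>

definition has_dir_derivative ::
    "((nat \<Rightarrow> 'e::real_normed_vector) \<Rightarrow> 'f::real_normed_vector) \<Rightarrow> 'f
      \<Rightarrow> (nat \<Rightarrow> 'e) \<Rightarrow> (nat \<Rightarrow> 'e) \<Rightarrow> bool" where
  "has_dir_derivative f d x y \<longleftrightarrow>
     ((\<lambda>t::real. (f (\<lambda>i. x i + t *\<^sub>R y i) - f x) /\<^sub>R t) \<longlongrightarrow> d) (at 0)"

text \<open>
  \<open>df\<close> is the continuous extension to \<open>U \<times> E\<^sup>m\<close> of the directional derivatives of \<open>f\<close>, which are
  taken at the points of the interior of \<open>U\<close> relative to \<open>E\<^sup>m\<close>.
  On \<open>U \<times> E\<^sup>m\<close> it is unique, as all domains considered below have dense interior.
\<close>

definition is_differential ::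
    "nat \<Rightarrow> (nat \<Rightarrow> 'e::real_normed_vector) set \<Rightarrow> ((nat \<Rightarrow> 'e) \<Rightarrow> 'f::real_normed_vector)
      \<Rightarrow> ((nat \<Rightarrow> 'e) \<Rightarrow> 'f) \<Rightarrow> bool" where
  "is_differential m U f df \<longleftrightarrow>
     (\<forall>x \<in> top_of_set (tuples m) interior_of U. \<forall>y \<in> tuples m.
        has_dir_derivative f (df (join m x y)) x y) \<and>
     continuous_on (times_tuples m U) df"

primrec Ck_tuples ::
    "nat \<Rightarrow> nat \<Rightarrow> (nat \<Rightarrow> 'e::real_normed_vector) set
      \<Rightarrow> ((nat \<Rightarrow> 'e) \<Rightarrow> 'f::real_normed_vector) \<Rightarrow> bool" where
  "Ck_tuples 0 m U f \<longleftrightarrow> continuous_on U f"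
| "Ck_tuples (Suc k) m U f \<longleftrightarrow> continuous_on U f \<and>
     (\<exists>df. is_differential m U f df \<and> Ck_tuples k (2 * m) (times_tuples m U) df)"

definition Ck_on ::
    "nat \<Rightarrow> 'e::real_normed_vector set \<Rightarrow> ('e \<Rightarrow> 'f::real_normed_vector) \<Rightarrow> bool" where
  "Ck_on k U f \<longleftrightarrow> Ck_tuples k 1 {v \<in> tuples 1. v 0 \<in> U} (\<lambda>v. f (v 0))"

definition smooth_on ::
    "'e::real_normed_vector set \<Rightarrow> ('e \<Rightarrow> 'f::real_normed_vector) \<Rightarrow> bool" where
  "smooth_on U f \<longleftrightarrow> (\<forall>k. Ck_on k U f)"


subsection \<open>Manifolds\<close>

text \<open>
  A chart \<open>\<phi>: U \<rightarrow> \<phi>(U)\<close> is a pair \<open>(U, \<phi>)\<close> with a total function \<open>\<phi>\<close> whose values outside \<open>U\<close> are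
  irrelevant: two pairs which agree on \<open>U\<close> are compatible with the same charts, so a maximal
  atlas contains either both or none of them.
\<close>

type_synonym ('m, 'e) chart = "'m set \<times> ('m \<Rightarrow> 'e)"

definition polytope_with_interior :: "'e::real_normed_vector set \<Rightarrow> bool" where
  "polytope_with_interior P \<longleftrightarrow> polytope P \<and> interior P \<noteq> {}"

definition open_in_polytope :: "'e::real_normed_vector set \<Rightarrow> bool" where
  "open_in_polytope V \<longleftrightarrow> (\<exists>P. polytope_with_interior P \<and> openin (top_of_set P) V)"

text \<open>
  \<open>is_chart Q X\<close>: charts of \<open>X\<close> whose image satisfies \<open>Q\<close>.  The choice \<open>Q = open\<close> gives
  manifolds without boundary, \<open>Q = open_in_polytope\<close> gives locally polyhedral manifolds.
\<close>

definition is_chart ::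
    "('e::real_normed_vector set \<Rightarrow> bool) \<Rightarrow> 'm topology \<Rightarrow> ('m, 'e) chart \<Rightarrow> bool" where
  "is_chart Q X = (\<lambda>(U, \<phi>). openin X U \<and> Q (\<phi> ` U) \<and>
     homeomorphic_map (subtopology X U) (top_of_set (\<phi> ` U)) \<phi>)"

definition smooth_transition ::
    "('m, 'e::real_normed_vector) chart \<Rightarrow> ('m, 'e) chart \<Rightarrow> bool" where
  "smooth_transition = (\<lambda>(U, \<phi>) (V, \<psi>). smooth_on (\<psi> ` (U \<inter> V)) (\<phi> \<circ> inv_into V \<psi>))"

definition is_atlas ::
    "('e::real_normed_vector set \<Rightarrow> bool) \<Rightarrow> 'm topology \<Rightarrow> ('m, 'e) chart set \<Rightarrow> bool" where
  "is_atlas Q X A \<longleftrightarrow> (\<forall>c\<in>A. is_chart Q X c) \<and> \<Union> (fst ` A) = topspace X \<and>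
     (\<forall>c\<in>A. \<forall>d\<in>A. smooth_transition c d)"

definition is_maximal_atlas ::
    "('e::real_normed_vector set \<Rightarrow> bool) \<Rightarrow> 'm topology \<Rightarrow> ('m, 'e) chart set \<Rightarrow> bool" where
  "is_maximal_atlas Q X A \<longleftrightarrow> is_atlas Q X A \<and> (\<forall>B. is_atlas Q X B \<and> A \<subseteq> B \<longrightarrow> B = A)"

definition smooth_manifold ::
    "'m topology \<Rightarrow> ('m, 'e::real_normed_vector) chart set \<Rightarrow> bool" where
  "smooth_manifold X A \<longleftrightarrow> Hausdorff_space X \<and> is_maximal_atlas open X A"

definition locally_polyhedral_manifold ::
    "'m topology \<Rightarrow> ('m, 'e::real_normed_vector) chart set \<Rightarrow> bool" where
  "locally_polyhedral_manifold X A \<longleftrightarrow>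
     Hausdorff_space X \<and> is_maximal_atlas open_in_polytope X A"

definition smooth_map ::
    "'m topology \<Rightarrow> ('m, 'e::real_normed_vector) chart set \<Rightarrow>
     'n topology \<Rightarrow> ('n, 'e) chart set \<Rightarrow> ('m \<Rightarrow> 'n) \<Rightarrow> bool" where
  "smooth_map X A Y B f \<longleftrightarrow> continuous_map X Y f \<and>
     (\<forall>(U, \<phi>)\<in>A. \<forall>(V, \<psi>)\<in>B. smooth_on (\<phi> ` {x \<in> U. f x \<in> V}) (\<psi> \<circ> f \<circ> inv_into U \<phi>))"

definition smooth_diffeomorphism ::
    "'m topology \<Rightarrow> ('m, 'e::real_normed_vector) chart set \<Rightarrow>
     'n topology \<Rightarrow> ('n, 'e) chart set \<Rightarrow> ('m \<Rightarrow> 'n) \<Rightarrow> bool" where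
  "smooth_diffeomorphism X A Y B f \<longleftrightarrow> bij_betw f (topspace X) (topspace Y) \<and>
     smooth_map X A Y B f \<and> smooth_map Y B X A (inv_into (topspace X) f)"

definition sigma_compact_space :: "'m topology \<Rightarrow> bool" where
  "sigma_compact_space X \<longleftrightarrow>
     (\<exists>K::nat \<Rightarrow> 'm set. (\<forall>i. compactin X (K i)) \<and> topspace X = (\<Union>i. K i))"


subsection \<open>Full submanifolds\<close>

definition adapted_charts ::
    "('m, 'e::real_normed_vector) chart set \<Rightarrow> 'm set \<Rightarrow> ('m, 'e) chart set" where
  "adapted_charts A N = {(U, \<phi>) \<in> A. open_in_polytope (\<phi> ` (U \<inter> N))}"

definition full_submanifold ::
    "'m topology \<Rightarrow> ('m, 'e::real_normed_vector) chart set \<Rightarrow> 'm set \<Rightarrow> bool" where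
  "full_submanifold X A N \<longleftrightarrow>
     N \<subseteq> topspace X \<and> (\<forall>x\<in>N. \<exists>(U, \<phi>)\<in>adapted_charts A N. x \<in> U)"

text \<open>
  \<open>B\<close> is the maximal polyhedral smooth atlas on \<open>N\<close>, with the subspace topology, which contains
  the restrictions of all adapted charts; for a full submanifold there is exactly one such \<open>B\<close>.
\<close>

definition induced_atlas ::
    "'m topology \<Rightarrow> ('m, 'e::real_normed_vector) chart set \<Rightarrow> 'm set
      \<Rightarrow> ('m, 'e) chart set \<Rightarrow> bool" where
  "induced_atlas X A N B \<longleftrightarrow> is_maximal_atlas open_in_polytope (subtopology X N) B \<and>
     (\<forall>(U, \<phi>)\<in>adapted_charts A N. (U \<inter> N, \<phi>) \<in> B)"

end

theory Submission
  imports Defs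
begin

text \<open>
  The idea is to find the manifold without boundary inside \<open>M\<close> itself.  There is a smooth injective
  immersion \<open>\<Phi>\<close> of \<open>M\<close> into its own interior, more precisely into a union \<open>I\<close> of the interiors of
  finitely many charts which cover \<open>M\<close>.  The charts of \<open>M\<close> restrict to an atlas of open charts on \<open>I\<close>,
  so \<open>I\<close> is a manifold without boundary, and nothing has to be glued.  It only remains to rename the
  points of \<open>I\<close> such that \<open>\<Phi> x\<close> becomes \<open>Inl x\<close>; the points outside the image of \<open>\<Phi>\<close> find names in \<open>E\<close>
  (\<open>complement_embeds\<close>).

  The map \<open>\<Phi>\<close> is a finite composition of pushes, each supported in a single chart with image open in a
  polytope \<open>P\<close>.  Near a point \<open>p\<close> of \<open>P\<close> all points are moved into the interior by a short step in the
  direction from \<open>p\<close> to a fixed interior point of \<open>P\<close>, and a bump function cuts this motion off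
  (\<open>local_push\<close>).  By compactness, finitely many such pushes move every point into \<open>I\<close>
  (\<open>push_into_interior\<close>).

  To see that the image of \<open>\<Phi>\<close> is a full submanifold, charts of \<open>I\<close> are needed which identify this image
  locally with an open subset of a polytope (\<open>adapted_chart\<close>).  In charts, \<open>\<Phi>\<close> is a smooth map with
  injective derivative on an open subset of a polytope.  It extends smoothly to a neighbourhood in \<open>E\<close>
  (\<open>Cinf_on_extend\<close>), the inverse function theorem makes the extension invertible, and its inverse is
  the required chart.  Only single maps are extended, so no cocycle condition arises.

  The extension is Seeley's.  Near \<open>p\<close>, a polytope is a finite intersection of half-spaces
  (\<open>polytope_local_cone\<close>), obtained by Fourier-Motzkin elimination, and one vector \<open>v\<close> points strictly into
  all of them.  A function on the intersection extends across one of the bounding hyperplanes as the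
  series \<open>\<Sum>i. a i * f (x + 2 ^ i * l x * v)\<close>, where \<open>l\<close> is positive beyond the hyperplane and the weights
  satisfy \<open>\<Sum>i. a i * 2 ^ (r * i) = 0\<close> for all \<open>r \<ge> 1\<close> and \<open>\<Sum>i. a i = 1\<close>.  As the points of evaluation remain
  in the other half-spaces, this can be repeated for each of them.

  The calculus of iterated directional derivatives on powers of \<open>E\<close> is replaced throughout by Frechet
  derivatives within the domain, including boundary points.  Both notions agree on locally convex
  sets with dense interior (\<open>smooth_on_iff_Cinf_on\<close>).
\<close>

section \<open>Finite-dimensional normed spaces\<close>

locale finite_basis =
  fixes B :: "'e::real_normed_vector set"
  assumes finite_B: "finite B" and independent_B: "independent B" and span_B: "span B = UNIV"
begin

definition coord :: "'e \<Rightarrow> 'e \<Rightarrow> real" where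
  "coord b x = representation B x b"

lemma coord_sum: "(\<Sum>b\<in>B. coord b x *\<^sub>R b) = x"
  unfolding coord_def
  by (rule real_vector.sum_representation_eq[OF independent_B])
    (use span_B finite_B in auto)

lemma coord_add: "coord b (x + y) = coord b x + coord b y"
  unfolding coord_def using real_vector.representation_add[OF independent_B, of y x] span_B by simp

lemma coord_scaleR: "coord b (c *\<^sub>R x) = c * coord b x"
  unfolding coord_def using real_vector.representation_scale[OF independent_B, of x c] span_B by simp

lemma coord_0: "coord b 0 = 0"
  using coord_scaleR[of b 0 0] by simp

text \<open>
  On the compact set of coefficient vectors of \<open>l\<^sup>1\<close>-norm one, the norm of the linear combination is
  continuous and, by independence, positive.  Hence it is bounded away from zero there.
\<close>

lemma coord_bound: "\<exists>K>0. \<forall>x. (\<Sum>b\<in>B. \<bar>coord b x\<bar>) \<le> K * norm x"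
proof -
  define C :: "('e \<Rightarrow> real) set" where "C = PiE UNIV (\<lambda>b. if b \<in> B then {-1..1} else {0})"
  define T where "T = C \<inter> {a. (\<Sum>b\<in>B. \<bar>a b\<bar>) = 1}"
  define N where "N = (\<lambda>a::'e \<Rightarrow> real. norm (\<Sum>b\<in>B. a b *\<^sub>R b))"
  have cont: "continuous_on X (\<lambda>a. a b)" for X :: "('e \<Rightarrow> real) set" and b
    by (rule continuous_on_subset[OF continuous_on_product_coordinates]) simp
  have "compactin (product_topology (\<lambda>_. euclideanreal) UNIV) C"
    unfolding C_def compactin_PiE by auto
  then have "compact C" by (simp add: euclidean_product_topology)
  moreover have "closed {a::'e \<Rightarrow> real. (\<Sum>b\<in>B. \<bar>a b\<bar>) = 1}"
    by (intro closed_Collect_eq continuous_intros cont)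
  ultimately have compT: "compact T" unfolding T_def by (rule compact_Int_closed)
  have contN: "continuous_on T N" unfolding N_def by (intro continuous_intros cont)
  have Npos: "N a > 0" if "a \<in> T" for a
  proof -
    have "(\<Sum>b\<in>B. a b *\<^sub>R b) \<noteq> 0"
    proof
      assume "(\<Sum>b\<in>B. a b *\<^sub>R b) = 0"
      then have "\<forall>b\<in>B. a b = 0" using independentD[OF independent_B finite_B order.refl] by blast
      with that show False by (simp add: T_def)
    qed
    then show ?thesis by (simp add: N_def)
  qed
  obtain c where c: "c > 0" "\<And>a. a \<in> T \<Longrightarrow> c \<le> N a"
  proof (cases "T = {}")
    case False
    then obtain a where "a \<in> T" "\<forall>y\<in>T. N a \<le> N y"
      using continuous_attains_inf[OF compT False contN] by blast
    then show ?thesis using that[of "N a"] Npos by auto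
  qed (use that[of 1] in auto)
  have "(\<Sum>b\<in>B. \<bar>coord b x\<bar>) \<le> (1/c) * norm x" for x
  proof -
    define s where "s = (\<Sum>b\<in>B. \<bar>coord b x\<bar>)"
    show ?thesis
    proof (cases "s = 0")
      case True with c(1) show ?thesis unfolding s_def[symmetric] by simp
    next
      case False
      moreover have "s \<ge> 0" unfolding s_def by (intro sum_nonneg) simp
      ultimately have s: "s > 0" by simp
      define a where "a = (\<lambda>b. if b \<in> B then coord b x / s else 0)"
      have le: "\<bar>coord b x\<bar> \<le> s" if "b \<in> B" for b
        unfolding s_def using that finite_B by (intro member_le_sum) auto
      have le': "- s \<le> coord b x" "coord b x \<le> s" if "b \<in> B" for b
        using le[OF that] by (simp_all add: abs_le_iff)
      have sa: "(\<Sum>b\<in>B. \<bar>a b\<bar>) = 1"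
        using s by (simp add: a_def abs_divide sum_divide_distrib[symmetric] s_def[symmetric])
      have "a \<in> T" unfolding T_def C_def
        using sa le' s by (auto simp: a_def divide_simps)
      then have "c \<le> N a" by (rule c(2))
      also have "N a = norm x / s"
      proof -
        have "(\<Sum>b\<in>B. a b *\<^sub>R b) = (\<Sum>b\<in>B. (1/s) *\<^sub>R (coord b x *\<^sub>R b))"
          by (rule sum.cong) (auto simp: a_def)
        also have "\<dots> = (1/s) *\<^sub>R x" by (simp only: scaleR_right.sum[symmetric] coord_sum)
        finally show ?thesis unfolding N_def using s by simp
      qed
      finally show ?thesis using s c(1) unfolding s_def[symmetric] by (simp add: field_simps)
    qed
  qed
  with c(1) show ?thesis by (intro exI[of _ "1/c"]) auto
qed

lemma coord_abs_bound: "\<exists>K>0. \<forall>x. \<forall>b\<in>B. \<bar>coord b x\<bar> \<le> K * norm x"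
proof -
  obtain K where K: "K > 0" "\<And>x. (\<Sum>b\<in>B. \<bar>coord b x\<bar>) \<le> K * norm x"
    using coord_bound by blast
  have "\<bar>coord b x\<bar> \<le> K * norm x" if "b \<in> B" for x b
    using K(2)[of x] member_le_sum[of b B "\<lambda>b. \<bar>coord b x\<bar>"] that finite_B by auto
  with K(1) show ?thesis by blast
qed

lemma bounded_linear_coord: "bounded_linear (coord b)"
proof (cases "b \<in> B")
  case True
  obtain K where K: "K > 0" "\<And>x. \<forall>b\<in>B. \<bar>coord b x\<bar> \<le> K * norm x" using coord_abs_bound by blast
  show ?thesis
    by (rule bounded_linear_intro[where K=K])
      (use K True in \<open>auto simp: coord_add coord_scaleR mult.commute\<close>)
next
  case False
  then have "coord b = (\<lambda>_. 0)"
    unfolding coord_def using real_vector.representation_ne_zero by fastforce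
  then show ?thesis by simp
qed

lemma linear_expand: "linear f \<Longrightarrow> f x = (\<Sum>b\<in>B. coord b x *\<^sub>R f b)"
  by (subst coord_sum[of x, symmetric]) (simp add: linear_sum linear_cmul)

lemma linear_bounded_linear:
  assumes "linear (f :: 'e \<Rightarrow> 'f::real_normed_vector)" shows "bounded_linear f"
proof -
  have "bounded_linear (\<lambda>x. coord b x *\<^sub>R f b)" for b
    using bounded_linear_compose[OF bounded_linear_scaleR_left[of "f b"] bounded_linear_coord[of b]] .
  then have "bounded_linear (\<lambda>x. \<Sum>b\<in>B. coord b x *\<^sub>R f b)" by (rule bounded_linear_sum)
  moreover have "(\<lambda>x. \<Sum>b\<in>B. coord b x *\<^sub>R f b) = f"
    by (rule ext) (rule linear_expand[OF assms, symmetric])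
  ultimately show ?thesis by (simp only:)
qed

text \<open>
  Bounded coordinates put the set inside a continuous image of a product of compact intervals.
\<close>

lemma compact_bounded_closed:
  assumes "bounded (S :: 'e set)" "closed S" shows "compact S"
proof -
  obtain R where R: "\<And>x. x \<in> S \<Longrightarrow> norm x \<le> R" using assms(1) unfolding bounded_iff by blast
  obtain K where K: "K > 0" "\<And>x. \<forall>b\<in>B. \<bar>coord b x\<bar> \<le> K * norm x" using coord_abs_bound by blast
  define C :: "('e \<Rightarrow> real) set" where "C = PiE UNIV (\<lambda>b. {-(K*R)..K*R} \<union> {0})"
  have "compactin (product_topology (\<lambda>_. euclideanreal) UNIV) C"
    unfolding C_def compactin_PiE by auto
  then have "compact C" by (simp add: euclidean_product_topology)
  then have cpt: "compact ((\<lambda>a. \<Sum>b\<in>B. a b *\<^sub>R b) ` C)"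
    by (intro compact_continuous_image continuous_intros
        continuous_on_subset[OF continuous_on_product_coordinates] subset_UNIV)
  have sub: "S \<subseteq> (\<lambda>a. \<Sum>b\<in>B. a b *\<^sub>R b) ` C"
  proof
    fix x assume x: "x \<in> S"
    have "\<bar>coord b x\<bar> \<le> K * R" if "b \<in> B" for b
      using K(2)[of x] R[OF x] that K(1) by (meson mult_left_mono order.trans less_imp_le)
    then have "(\<lambda>b. if b \<in> B then coord b x else 0) \<in> C" by (force simp: C_def abs_le_iff)
    moreover have "(\<Sum>b\<in>B. (if b \<in> B then coord b x else 0) *\<^sub>R b) = x"
      using coord_sum[of x] by (simp cong: sum.cong)
    ultimately show "x \<in> (\<lambda>a. \<Sum>b\<in>B. a b *\<^sub>R b) ` C" by force
  qed
  have "S \<inter> (\<lambda>a. \<Sum>b\<in>B. a b *\<^sub>R b) ` C = S" using sub by auto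
  with closed_Int_compact[OF assms(2) cpt] show ?thesis by simp
qed

lemma compact_cball_fd: "compact (cball (x::'e) r)"
  by (rule compact_bounded_closed) auto

lemma inj_linear_inverse:
  assumes "linear (f :: 'e \<Rightarrow> 'e)" "inj f"
  obtains g where "bounded_linear g" "g \<circ> f = id" "f \<circ> g = id"
proof -
  have "surj f"
  proof -
    have ind: "independent (f ` B)"
      using assms independent_B by (simp add: linear_independent_injective_image span_B inj_on_subset)
    have card: "card (f ` B) = card B" using assms(2) by (simp add: card_image inj_on_subset)
    have "B \<subseteq> span (f ` B)"
    proof (rule ccontr)
      assume "\<not> B \<subseteq> span (f ` B)"
      then obtain b where b: "b \<in> B" "b \<notin> span (f ` B)" by blast
      then have "independent (insert b (f ` B))" using ind by (simp add: independent_insertI)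
      moreover have "insert b (f ` B) \<subseteq> span B" using span_B by simp
      ultimately have "card (insert b (f ` B)) \<le> card B"
        using independent_span_bound[OF finite_B] by blast
      moreover have "b \<notin> f ` B" using b(2) span_base[of b "f ` B"] by (rule contrapos_nn)
      then have "card (insert b (f ` B)) = Suc (card (f ` B))"
        by (rule card_insert_disjoint[OF finite_imageI[OF finite_B]])
      ultimately show False using card by linarith
    qed
    then have "span (f ` B) = UNIV" using span_B span_minimal[of B "span (f ` B)"] subspace_span by blast
    then show ?thesis using linear_span_image[OF assms(1), of B] span_B by simp
  qed
  then have "bij f" using assms(2) by (simp add: bij_def)
  define g where "g = inv f"
  have gf: "g (f x) = x" and fg: "f (g x) = x" for x
    using assms(2) \<open>surj f\<close> by (simp_all add: g_def surj_f_inv_f)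
  have "linear g"
  proof (rule linearI)
    show "g (x + y) = g x + g y" for x y
      using gf[of "g x + g y"] by (simp add: linear_add[OF assms(1)] fg)
    show "g (c *\<^sub>R x) = c *\<^sub>R g x" for c x
      using gf[of "c *\<^sub>R g x"] by (simp add: linear_cmul[OF assms(1)] fg)
  qed
  moreover have "g \<circ> f = id" "f \<circ> g = id" using gf fg by auto
  ultimately show ?thesis using that linear_bounded_linear by blast
qed

end

lemma has_dimension_finite_basis:
  fixes n :: nat
  assumes "has_dimension TYPE('e::real_normed_vector) n"
  obtains B :: "'e::real_normed_vector set" where "finite_basis B"
  using assms unfolding has_dimension_def finite_basis_def by blast

lemma finite_basis_real: "finite_basis {1::real}"
proof (rule finite_basis.intro)
  show "independent {1::real}"
    by (rule independent_insertI) (auto simp: independent_empty)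
  show "span {1::real} = UNIV"
  proof (intro set_eqI iffI)
    fix x :: real
    have "x *\<^sub>R 1 \<in> span {1::real}" by (intro span_scale span_base) (rule singletonI)
    then show "x \<in> span {1::real}" by (simp only: real_scaleR_def mult_1_right)
  qed (rule UNIV_I)
qed (rule finite.insertI[OF finite.emptyI])

text \<open>
  Compositions with functions of one real variable are instances of the chain rule with the real
  line as the intermediate space.
\<close>

interpretation real_line: finite_basis "{1::real}"
  by (rule finite_basis_real)

section \<open>Differentiability up to the boundary\<close>

text \<open>
  Derivatives are Frechet derivatives within \<open>S\<close>, also at boundary points.  In this form restriction
  to smaller sets is immediate, and the chain rule also covers maps which take interior points of
  their domain to boundary points of the next one.  Quantifying over directions \<open>h\<close> keeps all
  derivatives in the same function type.
\<close>

primrec Cn_on ::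
    "nat \<Rightarrow> 'a::real_normed_vector set \<Rightarrow> ('a \<Rightarrow> 'b::real_normed_vector) \<Rightarrow> bool" where
  "Cn_on 0 S f \<longleftrightarrow> continuous_on S f"
| "Cn_on (Suc k) S f \<longleftrightarrow> (\<exists>D. (\<forall>x\<in>S. (f has_derivative D x) (at x within S)) \<and>
     (\<forall>h. Cn_on k S (\<lambda>x. D x h)))"

lemma Cn_on_SucI:
  "(\<And>x. x \<in> S \<Longrightarrow> (f has_derivative D x) (at x within S)) \<Longrightarrow> (\<And>h. Cn_on k S (\<lambda>x. D x h))
    \<Longrightarrow> Cn_on (Suc k) S f"
  by auto

lemma Cn_on_imp_continuous_on: "Cn_on k S f \<Longrightarrow> continuous_on S f"
proof (cases k)
  case (Suc j)
  assume "Cn_on k S f"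
  then show ?thesis unfolding Suc
    by (auto simp: continuous_on_eq_continuous_within intro: has_derivative_continuous)
qed simp

lemma Cn_on_Suc_imp: "Cn_on (Suc k) S f \<Longrightarrow> Cn_on k S f"
proof (induction k arbitrary: f)
  case 0
  then show ?case using Cn_on_imp_continuous_on[OF 0] by simp
next
  case (Suc k)
  from Suc.prems obtain D where D: "\<And>x. x \<in> S \<Longrightarrow> (f has_derivative D x) (at x within S)"
    "\<And>h. Cn_on (Suc k) S (\<lambda>x. D x h)" unfolding Cn_on.simps by blast
  show ?case by (rule Cn_on_SucI[OF D(1) Suc.IH[OF D(2)]])
qed

lemma Cn_on_subset: "Cn_on k S f \<Longrightarrow> T \<subseteq> S \<Longrightarrow> Cn_on k T f"
proof (induction k arbitrary: f)
  case 0
  then show ?case by (auto intro: continuous_on_subset)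
next
  case (Suc k)
  from Suc.prems(1) obtain D where D: "\<And>x. x \<in> S \<Longrightarrow> (f has_derivative D x) (at x within S)"
    "\<And>h. Cn_on k S (\<lambda>x. D x h)" unfolding Cn_on.simps by blast
  show ?case
    by (rule Cn_on_SucI[OF has_derivative_subset[OF D(1) Suc.prems(2)] Suc.IH[OF D(2) Suc.prems(2)]])
      (use Suc.prems(2) in blast)
qed

lemma Cn_on_cong: "Cn_on k S f \<Longrightarrow> (\<And>x. x \<in> S \<Longrightarrow> f x = g x) \<Longrightarrow> Cn_on k S g"
proof (cases k)
  case (Suc j)
  assume "Cn_on k S f" and eq: "\<And>x. x \<in> S \<Longrightarrow> f x = g x"
  then obtain D where D: "\<And>x. x \<in> S \<Longrightarrow> (f has_derivative D x) (at x within S)"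
    "\<And>h. Cn_on j S (\<lambda>x. D x h)" unfolding Suc Cn_on.simps by blast
  have "(g has_derivative D x) (at x within S)" if "x \<in> S" for x
    using has_derivative_transform[OF that _ D(1)[OF that], of g] eq by simp
  then show ?thesis unfolding Suc by (rule Cn_on_SucI[OF _ D(2)])
qed (auto cong: continuous_on_cong)

lemma Cn_on_const: "Cn_on k S (\<lambda>_. c)"
proof (induction k arbitrary: c)
  case (Suc k)
  show ?case by (rule Cn_on_SucI[OF has_derivative_const Suc.IH])
qed simp

lemma Cn_on_bounded_linear: "bounded_linear f \<Longrightarrow> Cn_on k S f"
  by (cases k) (auto intro!: Cn_on_SucI[of _ _ "\<lambda>_. f"] Cn_on_const
      intro: bounded_linear.continuous_on continuous_on_id bounded_linear_imp_has_derivative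
      simp: linear_continuous_on simp del: Cn_on.simps(2))

lemma Cn_on_id: "Cn_on k S (\<lambda>x. x)"
  by (rule Cn_on_bounded_linear[OF bounded_linear_ident])

lemma Cn_on_add: "Cn_on k S f \<Longrightarrow> Cn_on k S g \<Longrightarrow> Cn_on k S (\<lambda>x. f x + g x)"
proof (induction k arbitrary: f g)
  case (Suc k)
  from Suc.prems(1) obtain D where D: "\<And>x. x \<in> S \<Longrightarrow> (f has_derivative D x) (at x within S)"
    "\<And>h. Cn_on k S (\<lambda>x. D x h)" unfolding Cn_on.simps by blast
  from Suc.prems(2) obtain E where E: "\<And>x. x \<in> S \<Longrightarrow> (g has_derivative E x) (at x within S)"
    "\<And>h. Cn_on k S (\<lambda>x. E x h)" unfolding Cn_on.simps by blast
  show ?case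
    by (rule Cn_on_SucI[OF has_derivative_add[OF D(1) E(1)] Suc.IH[OF D(2) E(2)]])
qed (auto intro: continuous_on_add)

lemma Cn_on_bounded_linear_comp: "bounded_linear L \<Longrightarrow> Cn_on k S f \<Longrightarrow> Cn_on k S (\<lambda>x. L (f x))"
proof (induction k arbitrary: f)
  case (Suc k)
  from Suc.prems(2) obtain D where D: "\<And>x. x \<in> S \<Longrightarrow> (f has_derivative D x) (at x within S)"
    "\<And>h. Cn_on k S (\<lambda>x. D x h)" unfolding Cn_on.simps by blast
  show ?case
    by (rule Cn_on_SucI[OF bounded_linear.has_derivative[OF Suc.prems(1) D(1)]
          Suc.IH[OF Suc.prems(1) D(2)]])
qed (auto intro: bounded_linear.continuous_on)

lemma Cn_on_sum: "(\<And>i. i \<in> I \<Longrightarrow> Cn_on k S (f i)) \<Longrightarrow> Cn_on k S (\<lambda>x. \<Sum>i\<in>I. f i x)"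
  by (induction I rule: infinite_finite_induct) (auto intro: Cn_on_const Cn_on_add)

lemma Cn_on_scaleR: "Cn_on k S p \<Longrightarrow> Cn_on k S f \<Longrightarrow> Cn_on k S (\<lambda>x. p x *\<^sub>R f x)"
proof (induction k arbitrary: p f)
  case (Suc k)
  note smooth = Cn_on_Suc_imp[OF Suc.prems(1)] Cn_on_Suc_imp[OF Suc.prems(2)]
  from Suc.prems(1) obtain D where D: "\<And>x. x \<in> S \<Longrightarrow> (p has_derivative D x) (at x within S)"
    "\<And>h. Cn_on k S (\<lambda>x. D x h)" unfolding Cn_on.simps by blast
  from Suc.prems(2) obtain E where E: "\<And>x. x \<in> S \<Longrightarrow> (f has_derivative E x) (at x within S)"
    "\<And>h. Cn_on k S (\<lambda>x. E x h)" unfolding Cn_on.simps by blast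
  show ?case
    by (rule Cn_on_SucI[OF has_derivative_scaleR[OF D(1) E(1)]
          Cn_on_add[OF Suc.IH[OF smooth(1) E(2)] Suc.IH[OF D(2) smooth(2)]]])
qed (auto intro: continuous_on_scaleR)

lemma Cn_on_mult: "Cn_on k S p \<Longrightarrow> Cn_on k S q \<Longrightarrow> Cn_on k S (\<lambda>x. p x * q x :: real)"
  using Cn_on_scaleR[of k S p q] by simp

lemma Cn_on_minus: "Cn_on k S f \<Longrightarrow> Cn_on k S (\<lambda>x. - f x)"
  by (rule Cn_on_bounded_linear_comp[OF bounded_linear_minus[OF bounded_linear_ident]])

text \<open>
  In coordinates of the intermediate space, the derivative of a composition is a sum of products of
  a derivative of \<open>f\<close> and a composition of a derivative of \<open>g\<close> with \<open>f\<close>; all of these have order one less.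
\<close>

lemma (in finite_basis) Cn_on_compose:
  fixes f :: "'a::real_normed_vector \<Rightarrow> 'e" and g :: "'e \<Rightarrow> 'b::real_normed_vector"
  shows "Cn_on k T g \<Longrightarrow> Cn_on k S f \<Longrightarrow> f ` S \<subseteq> T \<Longrightarrow> Cn_on k S (\<lambda>x. g (f x))"
proof (induction k arbitrary: g)
  case 0
  then show ?case by (auto intro: continuous_on_compose2)
next
  case (Suc k)
  note f = Cn_on_Suc_imp[OF Suc.prems(2)]
  from Suc.prems(1) obtain E where E: "\<And>x. x \<in> T \<Longrightarrow> (g has_derivative E x) (at x within T)"
    "\<And>h. Cn_on k T (\<lambda>x. E x h)" unfolding Cn_on.simps by blast
  from Suc.prems(2) obtain D where D: "\<And>x. x \<in> S \<Longrightarrow> (f has_derivative D x) (at x within S)"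
    "\<And>h. Cn_on k S (\<lambda>x. D x h)" unfolding Cn_on.simps by blast
  have der: "((\<lambda>x. g (f x)) has_derivative (\<lambda>h. E (f x) (D x h))) (at x within S)" if "x \<in> S" for x
    using has_derivative_in_compose[OF D(1)[OF that], of g "E (f x)"]
      has_derivative_subset[OF E(1) Suc.prems(3), of "f x"] that Suc.prems(3) by auto
  have ck: "Cn_on k S (\<lambda>x. E (f x) (D x h))" for h
  proof (rule Cn_on_cong)
    show "Cn_on k S (\<lambda>x. \<Sum>b\<in>B. coord b (D x h) *\<^sub>R E (f x) b)"
      by (intro Cn_on_sum Cn_on_scaleR Cn_on_bounded_linear_comp[OF bounded_linear_coord D(2)]
          Suc.IH[OF E(2) f Suc.prems(3)])
    show "(\<Sum>b\<in>B. coord b (D x h) *\<^sub>R E (f x) b) = E (f x) (D x h)" if "x \<in> S" for x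
      using E(1)[of "f x"] that Suc.prems(3)
      by (intro linear_expand[symmetric] bounded_linear.linear has_derivative_bounded_linear) auto
  qed
  show ?case by (rule Cn_on_SucI[OF der ck])
qed

definition Cinf_on :: "'a::real_normed_vector set \<Rightarrow> ('a \<Rightarrow> 'b::real_normed_vector) \<Rightarrow> bool" where
  "Cinf_on S f \<longleftrightarrow> (\<forall>k. Cn_on k S f)"

lemma Cinf_on_subset: "Cinf_on S f \<Longrightarrow> T \<subseteq> S \<Longrightarrow> Cinf_on T f"
  by (auto simp: Cinf_on_def intro: Cn_on_subset)

lemma Cinf_on_cong: "Cinf_on S f \<Longrightarrow> (\<And>x. x \<in> S \<Longrightarrow> f x = g x) \<Longrightarrow> Cinf_on S g"
  by (auto simp: Cinf_on_def intro: Cn_on_cong)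

lemma (in finite_basis) Cinf_on_compose:
  "Cinf_on T g \<Longrightarrow> Cinf_on S f \<Longrightarrow> f ` S \<subseteq> T \<Longrightarrow> Cinf_on S (\<lambda>x. g ((f x)::'e))"
  by (auto simp: Cinf_on_def intro: Cn_on_compose)

lemma Cinf_on_continuous: "Cinf_on S f \<Longrightarrow> continuous_on S f"
  unfolding Cinf_on_def using Cn_on_imp_continuous_on by blast

section \<open>Locally convex sets with dense interior\<close>

text \<open>
  These are the domains on which the calculus works: dense interior makes the continuous extension
  of a derivative unique, and local convexity allows the mean value theorem near boundary points.
  Open sets and relatively open subsets of polytopes with interior are of this kind.
\<close>

definition calculus_domain :: "'a::real_normed_vector set \<Rightarrow> bool" where
  "calculus_domain S \<longleftrightarrow> (\<forall>x\<in>S. \<exists>r>0. convex (S \<inter> ball x r)) \<and> S \<subseteq> closure (interior S)"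

lemma convex_Int_ball_mono:
  fixes x :: "'a::real_normed_vector"
  assumes "convex (S \<inter> ball x r)" "s \<le> r" shows "convex (S \<inter> ball x s)"
proof -
  have "S \<inter> ball x s = (S \<inter> ball x r) \<inter> ball x s" using assms(2) by auto
  then show ?thesis using assms(1) by (simp add: convex_Int)
qed

lemma calculus_domain_openin:
  assumes S: "calculus_domain S" and T: "openin (top_of_set S) T" shows "calculus_domain T"
proof -
  obtain G where G: "open G" "T = S \<inter> G" using T unfolding openin_open by blast
  show ?thesis unfolding calculus_domain_def
  proof (intro conjI ballI subsetI)
    fix x assume x: "x \<in> T"
    obtain r where r: "r > 0" "convex (S \<inter> ball x r)" using S x G by (auto simp: calculus_domain_def)
    obtain d where d: "d > 0" "ball x d \<subseteq> G" using G x openE by blast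
    have "T \<inter> ball x (min r d) = S \<inter> ball x (min r d)" using d G by auto
    then show "\<exists>r>0. convex (T \<inter> ball x r)"
      using convex_Int_ball_mono[OF r(2), of "min r d"] r d by (intro exI[of _ "min r d"]) auto
  next
    fix x assume x: "x \<in> T"
    have "x \<in> closure (interior S)" using S x G by (auto simp: calculus_domain_def)
    then have "x \<in> closure (interior S \<inter> G)"
      using open_Int_closure_subset[OF G(1), of "interior S"] x G(2) by (auto simp: Int_commute)
    then show "x \<in> closure (interior T)" using G by (simp add: interior_open)
  qed
qed

lemma open_imp_calculus_domain: "open S \<Longrightarrow> calculus_domain S"
  unfolding calculus_domain_def
  by (metis convex_ball closure_subset inf.absorb_iff2 interior_open open_contains_ball)

text \<open>
  A homothety with centre \<open>x\<close> maps a ball around \<open>c\<close> inside \<open>S\<close> to a ball around the new point.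
\<close>

lemma convex_shrink_interior:
  fixes S :: "'a::real_normed_vector set"
  assumes S: "convex S" and c: "c \<in> interior S" and x: "x \<in> S" and t: "0 < t" "t \<le> 1"
  shows "x + t *\<^sub>R (c - x) \<in> interior S"
proof -
  obtain d where d: "d > 0" "ball c d \<subseteq> S" using c by (auto simp: mem_interior)
  have "ball (x + t *\<^sub>R (c - x)) (t * d) \<subseteq> S"
  proof
    fix y assume y: "y \<in> ball (x + t *\<^sub>R (c - x)) (t * d)"
    define z where "z = c + (1/t) *\<^sub>R (y - (x + t *\<^sub>R (c - x)))"
    have "dist c z = (1/t) * dist (x + t *\<^sub>R (c - x)) y"
      using t by (simp add: z_def dist_norm norm_minus_commute)
    also have "\<dots> < d" using y t by (simp add: pos_divide_less_eq mult.commute)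
    finally have "z \<in> S" using d by auto
    moreover have "y = (1 - t) *\<^sub>R x + t *\<^sub>R z"
      using t by (simp add: z_def algebra_simps)
    ultimately show "y \<in> S" using S x t by (auto simp: convex_alt)
  qed
  then show ?thesis using d t by (auto simp: mem_interior intro!: exI[of _ "t * d"])
qed

lemma convex_calculus_domain:
  fixes S :: "'a::real_normed_vector set"
  assumes "convex S" "interior S \<noteq> {}" shows "calculus_domain S"
  unfolding calculus_domain_def
proof (intro conjI ballI subsetI)
  fix x assume x: "x \<in> S"
  show "\<exists>r>0. convex (S \<inter> ball x r)" using assms(1) by (auto intro!: exI[of _ 1] convex_Int)
  obtain c where c: "c \<in> interior S" using assms(2) by auto
  show "x \<in> closure (interior S)" unfolding closure_approachable
  proof (intro allI impI)
    fix e :: real assume e: "e > 0"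
    define t where "t = min 1 (e / (2 * (norm (c - x) + 1)))"
    have t: "0 < t" "t \<le> 1" using e by (auto simp: t_def add_nonneg_pos)
    have "t * norm (c - x) \<le> (e / (2 * (norm (c - x) + 1))) * norm (c - x)"
      by (intro mult_right_mono) (auto simp: t_def)
    also have "\<dots> < e" using e by (simp add: divide_simps add_nonneg_pos)
    finally have "dist (x + t *\<^sub>R (c - x)) x < e" using t by (simp add: dist_norm)
    with convex_shrink_interior[OF assms(1) c x t] show "\<exists>y\<in>interior S. dist y x < e" by blast
  qed
qed

lemma open_in_polytope_calculus_domain: "open_in_polytope S \<Longrightarrow> calculus_domain S"
  unfolding open_in_polytope_def polytope_with_interior_def
  by (meson calculus_domain_openin convex_calculus_domain polytope_imp_convex)

text \<open>
  The set contains segments starting at \<open>x\<close> in an open set of directions, and a linear map is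
  determined by its values on an open set.
\<close>

lemma calculus_domain_has_derivative_unique:
  fixes f :: "'a::real_normed_vector \<Rightarrow> 'b::real_normed_vector"
  assumes S: "calculus_domain S" and x: "x \<in> S"
    and D: "(f has_derivative D) (at x within S)" and E: "(f has_derivative E) (at x within S)"
  shows "D = E"
proof -
  define L where "L = (\<lambda>h. D h - E h)"
  have L: "bounded_linear L" unfolding L_def
    using D E by (intro bounded_linear_sub) (auto dest: has_derivative_bounded_linear)
  have L0: "((\<lambda>_. 0) has_derivative L) (at x within S)"
    using has_derivative_diff[OF D E] by (simp add: L_def)
  obtain r where r: "r > 0" "convex (S \<inter> ball x r)" using S x by (auto simp: calculus_domain_def)
  have "x \<in> closure (interior S)" using S x by (auto simp: calculus_domain_def)
  then obtain c where c: "c \<in> interior S" "dist c x < r"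
    using r(1) by (auto simp: closure_approachable)
  have zero: "L (y - x) = 0" if "y \<in> S \<inter> ball x r" for y
  proof -
    have seg: "x + t *\<^sub>R (y - x) \<in> S" if "0 \<le> t" "t \<le> 1" for t
    proof -
      have "(1 - t) *\<^sub>R x + t *\<^sub>R y \<in> S \<inter> ball x r"
        using r \<open>y \<in> S \<inter> ball x r\<close> x that by (auto simp: convex_alt)
      then show ?thesis by (simp add: algebra_simps)
    qed
    have "((\<lambda>t::real. x + t *\<^sub>R (y - x)) has_derivative (\<lambda>t. t *\<^sub>R (y - x))) (at 0 within {0..1})"
      by (auto intro!: derivative_eq_intros)
    moreover have "(\<lambda>t. x + t *\<^sub>R (y - x)) ` {0..1} \<subseteq> S" using seg by auto
    then have "((\<lambda>_. 0) has_derivative L) (at (x + 0 *\<^sub>R (y - x)) within (\<lambda>t. x + t *\<^sub>R (y - x)) ` {0..1})"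
      using has_derivative_subset[OF L0] by simp
    ultimately have "((\<lambda>t::real. 0) has_derivative (\<lambda>t. L (t *\<^sub>R (y - x)))) (at 0 within {0..1})"
      by (rule has_derivative_in_compose)
    then have "((\<lambda>t::real. 0) has_vector_derivative L (y - x)) (at 0 within {0..1})"
      by (simp add: has_vector_derivative_def linear_cmul[OF bounded_linear.linear[OF L]])
    moreover have "((\<lambda>t::real. 0) has_vector_derivative 0) (at 0 within {0..1})" by simp
    ultimately show ?thesis
      using vector_derivative_unique_within_closed_interval[of 0 1 0 "\<lambda>_. 0" "L (y - x)" 0]
      by (auto simp: cbox_interval)
  qed
  obtain d where d: "d > 0" "ball c d \<subseteq> S \<inter> ball x r"
    using c by (metis (no_types, lifting) IntI dist_commute interior_ball interior_Int mem_ball mem_interior)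
  have "L h = 0" for h
  proof -
    define a where "a = norm h + 1"
    define t where "t = d / a"
    have a: "a > 0" "norm h < a" using norm_ge_zero[of h] unfolding a_def by linarith+
    have t: "t > 0" using d a by (simp add: t_def)
    have "t * norm h < t * a" using t a by simp
    then have "norm (t *\<^sub>R h) < d" using t a d(1) by (simp add: t_def)
    then have "c + t *\<^sub>R h \<in> ball c d" "c \<in> ball c d"
      using d by (auto simp: dist_norm)
    then have "c + t *\<^sub>R h \<in> S \<inter> ball x r" "c \<in> S \<inter> ball x r"
      using d by blast+
    from zero[OF this(1)] zero[OF this(2)] have "L (t *\<^sub>R h) = 0"
      using linear_add[OF bounded_linear.linear[OF L], of "c - x" "t *\<^sub>R h"] by (simp add: algebra_simps)
    then show ?thesis using t by (simp add: linear_cmul[OF bounded_linear.linear[OF L]])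
  qed
  then show ?thesis by (auto simp: L_def)
qed

lemma has_derivative_within_open_Int:
  "open G \<Longrightarrow> x \<in> G \<Longrightarrow> (f has_derivative D) (at x within S \<inter> G) \<longleftrightarrow> (f has_derivative D) (at x within S)"
  by (simp add: at_within_nhd[of x G "S \<inter> G" S])

text \<open>
  The derivatives provided by the local hypotheses may a priori differ from patch to patch; their
  uniqueness allows to use one global choice.
\<close>

lemma Cn_on_local:
  assumes S: "calculus_domain S" and loc: "\<And>x. x \<in> S \<Longrightarrow> \<exists>G. open G \<and> x \<in> G \<and> Cn_on k (S \<inter> G) f"
  shows "Cn_on k S f"
  using loc
proof (induction k arbitrary: f)
  case 0
  show ?case unfolding Cn_on.simps continuous_on_eq_continuous_within
  proof
    fix x assume x: "x \<in> S"
    then obtain G where G: "open G" "x \<in> G" "Cn_on 0 (S \<inter> G) f" using 0 by blast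
    then have "continuous (at x within S \<inter> G) f" using x by (simp add: continuous_on_eq_continuous_within)
    then show "continuous (at x within S) f"
      using G at_within_nhd[of x G "S \<inter> G" S] by simp
  qed
next
  case (Suc k)
  have "\<exists>D. (f has_derivative D) (at x within S)" if "x \<in> S" for x
  proof -
    obtain G where G: "open G" "x \<in> G" "Cn_on (Suc k) (S \<inter> G) f" using Suc.prems \<open>x \<in> S\<close> by blast
    obtain E where "\<And>y. y \<in> S \<inter> G \<Longrightarrow> (f has_derivative E y) (at y within S \<inter> G)"
      using G(3) unfolding Cn_on.simps by blast
    then show ?thesis using that G(1,2) has_derivative_within_open_Int by blast
  qed
  then obtain D where D: "\<And>x. x \<in> S \<Longrightarrow> (f has_derivative D x) (at x within S)" by metis
  show ?case
  proof (rule Cn_on_SucI[OF D Suc.IH])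
    fix h x assume x: "x \<in> S"
    obtain G where G: "open G" "x \<in> G" "Cn_on (Suc k) (S \<inter> G) f" using Suc.prems x by blast
    obtain E where E: "\<And>y. y \<in> S \<inter> G \<Longrightarrow> (f has_derivative E y) (at y within S \<inter> G)"
      "\<And>h. Cn_on k (S \<inter> G) (\<lambda>x. E x h)" using G(3) unfolding Cn_on.simps by blast
    have "E y = D y" if "y \<in> S \<inter> G" for y
      using that E(1)[OF that] D[of y] G(1)
      by (intro calculus_domain_has_derivative_unique[OF S]) (auto simp: has_derivative_within_open_Int)
    then have "Cn_on k (S \<inter> G) (\<lambda>x. D x h)" using Cn_on_cong[OF E(2)[of h]] by auto
    then show "\<exists>G. open G \<and> x \<in> G \<and> Cn_on k (S \<inter> G) (\<lambda>x. D x h)" using G by blast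
  qed
qed

section \<open>From Frechet derivatives to iterated differentials\<close>

definition Tup :: "nat \<Rightarrow> 'e::real_normed_vector set \<Rightarrow> (nat \<Rightarrow> 'e) set" where
  "Tup m U = {v \<in> tuples m. v 0 \<in> U}"

lemma times_tuples_Tup:
  assumes "m \<ge> 1" shows "times_tuples m (Tup m U) = Tup (2 * m) U"
proof (intro set_eqI iffI)
  fix v assume "v \<in> times_tuples m (Tup m U)"
  then show "v \<in> Tup (2 * m) U"
    using assms by (auto simp: times_tuples_def Tup_def tuples_def join_def)
next
  fix v assume v: "v \<in> Tup (2 * m) U"
  have "v = join m (\<lambda>i. if i < m then v i else 0) (\<lambda>i. v (i + m))"
    by (auto simp: join_def fun_eq_iff)
  moreover have "(\<lambda>i. if i < m then v i else 0) \<in> Tup m U" "(\<lambda>i. v (i + m)) \<in> tuples m"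
    using v assms by (auto simp: Tup_def tuples_def)
  ultimately show "v \<in> times_tuples m (Tup m U)" unfolding times_tuples_def by blast
qed

lemma continuous_on_tuple_component: "continuous_on S (\<lambda>v. v i)"
  by (rule continuous_on_subset[OF continuous_on_product_coordinates subset_UNIV])

text \<open>
  Replacing the first component of a tuple is continuous, so a neighbourhood of a tuple contains all
  tuples with a slightly different first component.
\<close>

lemma interior_Tup:
  assumes "m \<ge> 1"
  shows "top_of_set (tuples m) interior_of Tup m U = Tup m (interior U)"
proof (intro set_eqI iffI)
  fix v assume "v \<in> top_of_set (tuples m) interior_of Tup m U"
  then obtain T where T: "openin (top_of_set (tuples m)) T" "v \<in> T" "T \<subseteq> Tup m U"
    unfolding interior_of_def by blast
  then obtain G where G: "open G" "T = tuples m \<inter> G" unfolding openin_open by blast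
  have "continuous_on UNIV (\<lambda>e. (v(0 := e)) i)" for i by (cases "i = 0") auto
  then have "continuous_on UNIV (\<lambda>e. v(0 := e))" by (rule continuous_on_coordinatewise_then_product)
  then have o: "open ((\<lambda>e. v(0 := e)) -` G)" using G(1) by (simp add: open_vimage)
  have vt: "v \<in> tuples m" using T G by auto
  have "(\<lambda>e. v(0 := e)) -` G \<subseteq> U"
  proof
    fix e assume "e \<in> (\<lambda>e. v(0 := e)) -` G"
    moreover have "v(0 := e) \<in> tuples m" using vt assms by (auto simp: tuples_def)
    ultimately have "v(0 := e) \<in> Tup m U" using T G by auto
    then show "e \<in> U" by (simp add: Tup_def)
  qed
  moreover have "v 0 \<in> (\<lambda>e. v(0 := e)) -` G" using T G by auto
  ultimately have "v 0 \<in> interior U" using o by (meson interiorI)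
  then show "v \<in> Tup m (interior U)" using vt by (simp add: Tup_def)
next
  fix v assume v: "v \<in> Tup m (interior U)"
  have "open ((\<lambda>v::nat \<Rightarrow> 'a. v 0) -` interior U)"
    by (rule open_vimage) (auto intro: continuous_on_tuple_component)
  then have "openin (top_of_set (tuples m)) (tuples m \<inter> (\<lambda>v. v 0) -` interior U)" by (simp add: openin_open_Int)
  moreover have "tuples m \<inter> (\<lambda>v. v 0) -` interior U \<subseteq> Tup m U"
    using interior_subset by (auto simp: Tup_def)
  ultimately show "v \<in> top_of_set (tuples m) interior_of Tup m U"
    using v unfolding interior_of_def Tup_def by blast
qed

lemma has_dir_derivative_iff:
  "has_dir_derivative f d x y \<longleftrightarrow> ((\<lambda>t. f (\<lambda>i. x i + t *\<^sub>R y i)) has_vector_derivative d) (at 0)"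
proof -
  define F where "F = (\<lambda>t::real. f (\<lambda>i. x i + t *\<^sub>R y i))"
  have F0: "F 0 = f x" by (simp add: F_def)
  have "has_dir_derivative f d x y \<longleftrightarrow> ((\<lambda>t. norm ((F t - F 0) /\<^sub>R t - d)) \<longlongrightarrow> 0) (at 0)"
    unfolding has_dir_derivative_def F0 F_def[symmetric]
    by (simp add: tendsto_norm_zero_iff LIM_zero_iff F_def)
  also have "\<dots> \<longleftrightarrow> ((\<lambda>t. norm (F t - F 0 - t *\<^sub>R d) / norm t) \<longlongrightarrow> 0) (at 0)"
  proof (rule tendsto_cong)
    have "norm ((F t - F 0) /\<^sub>R t - d) = norm (F t - F 0 - t *\<^sub>R d) / norm t" if "t \<noteq> 0" for t
    proof -
      have "(F t - F 0) /\<^sub>R t - d = (1/t) *\<^sub>R (F t - F 0 - t *\<^sub>R d)"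
        using that by (simp add: scaleR_diff_right divide_inverse)
      then show ?thesis by (simp add: divide_inverse mult.commute)
    qed
    then show "\<forall>\<^sub>F t in at 0. norm ((F t - F 0) /\<^sub>R t - d) = norm (F t - F 0 - t *\<^sub>R d) / norm t"
      by (auto simp: eventually_at intro!: exI[of _ 1])
  qed
  also have "\<dots> \<longleftrightarrow> (F has_vector_derivative d) (at 0)"
    unfolding has_vector_derivative_def has_derivative_at
    by (simp add: bounded_linear_scaleR_left)
  finally show ?thesis unfolding F_def .
qed

context finite_basis begin

text \<open>
  The iterated differentials of \<open>v \<mapsto> g (v 0)\<close> are sums of products of linear functionals of single
  components of the tuple with partial derivatives of \<open>g\<close> at \<open>v 0\<close>.  The class of such sums is closed
  under taking the differential, at the cost of one order of differentiability, which gives all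
  orders by induction.
\<close>

inductive tuple_poly :: "nat \<Rightarrow> 'e set \<Rightarrow> nat \<Rightarrow> ((nat \<Rightarrow> 'e) \<Rightarrow> 'f::real_normed_vector) \<Rightarrow> bool"
  for k U m where
  base: "Cn_on k U g \<Longrightarrow> tuple_poly k U m (\<lambda>v. g (v 0))"
| mult: "tuple_poly k U m F \<Longrightarrow> i < m \<Longrightarrow> bounded_linear l \<Longrightarrow> tuple_poly k U m (\<lambda>v. l (v i) *\<^sub>R F v)"
| add: "tuple_poly k U m F \<Longrightarrow> tuple_poly k U m G \<Longrightarrow> tuple_poly k U m (\<lambda>v. F v + G v)"

lemma tuple_poly_mono: "tuple_poly k U m F \<Longrightarrow> m \<le> m' \<Longrightarrow> tuple_poly k U m' F"
  by (induction rule: tuple_poly.induct) (auto intro: tuple_poly.intros)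

lemma tuple_poly_Suc: "tuple_poly (Suc k) U m F \<Longrightarrow> tuple_poly k U m F"
  by (induction rule: tuple_poly.induct) (blast intro: tuple_poly.intros Cn_on_Suc_imp)+

lemma tuple_poly_local:
  "tuple_poly k U m F \<Longrightarrow> m \<ge> 1 \<Longrightarrow> (\<And>i. i < m \<Longrightarrow> v i = w i) \<Longrightarrow> F v = F w"
  by (induction rule: tuple_poly.induct) auto

lemma tuple_poly_continuous: "tuple_poly k U m F \<Longrightarrow> continuous_on (Tup m U) F"
proof (induction rule: tuple_poly.induct)
  case (base g)
  show ?case
    by (rule continuous_on_compose2[OF Cn_on_imp_continuous_on[OF base] continuous_on_tuple_component])
      (auto simp: Tup_def)
next
  case (mult F i l)
  then show ?case
    by (intro continuous_on_scaleR bounded_linear.continuous_on[OF mult(3)] continuous_on_tuple_component)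
qed (rule continuous_on_add)

lemma tuple_poly_sum:
  "finite I \<Longrightarrow> (\<And>j. j \<in> I \<Longrightarrow> tuple_poly k U m (F j)) \<Longrightarrow> tuple_poly k U m (\<lambda>v. \<Sum>j\<in>I. F j v)"
proof (induction I rule: finite_induct)
  case empty
  show ?case using tuple_poly.base[OF Cn_on_const[of k U 0]] by simp
qed (simp add: tuple_poly.add)

lemma tuple_poly_differential:
  assumes "tuple_poly (Suc k) U m F" "m \<ge> 1"
  shows "\<exists>dF. (\<forall>x\<in>Tup m (interior U). \<forall>y\<in>tuples m. has_dir_derivative F (dF (join m x y)) x y)
    \<and> tuple_poly k U (2 * m) dF"
  using assms(1)
proof (induction rule: tuple_poly.induct)
  case (base g)
  then obtain D where D: "\<And>x. x \<in> U \<Longrightarrow> (g has_derivative D x) (at x within U)"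
    "\<And>h. Cn_on k U (\<lambda>x. D x h)" unfolding Cn_on.simps by blast
  define dF where "dF = (\<lambda>v. \<Sum>b\<in>B. coord b (v m) *\<^sub>R D (v 0) b)"
  have "tuple_poly k U (2 * m) dF" unfolding dF_def
    by (intro tuple_poly_sum finite_B tuple_poly.mult tuple_poly.base[OF D(2)] bounded_linear_coord)
      (use assms(2) in auto)
  moreover have "has_dir_derivative (\<lambda>v. g (v 0)) (dF (join m x y)) x y"
    if x: "x \<in> Tup m (interior U)" for x y
  proof -
    have x0: "x 0 \<in> interior U" using x by (simp add: Tup_def)
    then have "(g has_derivative D (x 0)) (at (x 0))"
      using D(1)[of "x 0"] interior_subset at_within_interior by (metis subsetD)
    then have "(g has_derivative D (x 0)) (at (x 0 + 0 *\<^sub>R y 0))" by simp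
    moreover have "((\<lambda>t::real. x 0 + t *\<^sub>R y 0) has_derivative (\<lambda>t. t *\<^sub>R y 0)) (at 0)"
      by (auto intro!: derivative_eq_intros)
    ultimately have "((\<lambda>t. g (x 0 + t *\<^sub>R y 0)) has_derivative (\<lambda>t. D (x 0) (t *\<^sub>R y 0))) (at 0)"
      by (rule has_derivative_compose[rotated])
    moreover have lin: "linear (D (x 0))"
      using D(1)[of "x 0"] x0 interior_subset by (meson has_derivative_linear subsetD)
    ultimately have "((\<lambda>t. g (x 0 + t *\<^sub>R y 0)) has_vector_derivative D (x 0) (y 0)) (at 0)"
      by (simp add: has_vector_derivative_def linear_cmul)
    moreover have "dF (join m x y) = D (x 0) (y 0)"
      using linear_expand[OF lin, of "y 0"] assms(2) by (simp add: dF_def join_def)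
    ultimately show ?thesis unfolding has_dir_derivative_iff by simp
  qed
  ultimately show ?case by blast
next
  case (mult F i l)
  then obtain dF where dF: "\<And>x y. x \<in> Tup m (interior U) \<Longrightarrow> y \<in> tuples m \<Longrightarrow>
      has_dir_derivative F (dF (join m x y)) x y" "tuple_poly k U (2 * m) dF" by blast
  define dG where "dG = (\<lambda>v. l (v i) *\<^sub>R dF v + l (v (m + i)) *\<^sub>R F v)"
  have "tuple_poly k U (2 * m) dG" unfolding dG_def
    using mult.hyps dF(2) tuple_poly_mono[OF tuple_poly_Suc[OF mult.hyps(1)], of "2 * m"]
    by (intro tuple_poly.add tuple_poly.mult) auto
  moreover have "has_dir_derivative (\<lambda>v. l (v i) *\<^sub>R F v) (dG (join m x y)) x y"
    if x: "x \<in> Tup m (interior U)" and y: "y \<in> tuples m" for x y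
  proof -
    interpret l: bounded_linear l by fact
    have "((\<lambda>t. l (x i + t *\<^sub>R y i)) has_vector_derivative l (y i)) (at 0)"
      unfolding l.add l.scaleR has_vector_derivative_def
      by (auto intro!: derivative_eq_intros)
    then have "((\<lambda>t. l (x i + t *\<^sub>R y i)) has_field_derivative l (y i)) (at 0)"
      by (simp add: has_real_derivative_iff_has_vector_derivative)
    from has_vector_derivative_scaleR[OF this dF(1)[OF x y, unfolded has_dir_derivative_iff]]
    have "((\<lambda>t. l (x i + t *\<^sub>R y i) *\<^sub>R F (\<lambda>i. x i + t *\<^sub>R y i)) has_vector_derivative
       l (x i) *\<^sub>R dF (join m x y) + l (y i) *\<^sub>R F x) (at 0)" by simp
    moreover have "F (join m x y) = F x"
      by (rule tuple_poly_local[OF mult.hyps(1) assms(2)]) (simp add: join_def)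
    ultimately show ?thesis
      unfolding has_dir_derivative_iff dG_def using mult.hyps(2) by (simp add: join_def)
  qed
  ultimately show ?case by blast
next
  case (add F G)
  then obtain dF dG where dF: "\<And>x y. x \<in> Tup m (interior U) \<Longrightarrow> y \<in> tuples m \<Longrightarrow>
      has_dir_derivative F (dF (join m x y)) x y" "tuple_poly k U (2 * m) dF"
    and dG: "\<And>x y. x \<in> Tup m (interior U) \<Longrightarrow> y \<in> tuples m \<Longrightarrow>
      has_dir_derivative G (dG (join m x y)) x y" "tuple_poly k U (2 * m) dG" by blast
  show ?case
    using has_vector_derivative_add[OF dF(1)[unfolded has_dir_derivative_iff] dG(1)[unfolded has_dir_derivative_iff]]
      tuple_poly.add[OF dF(2) dG(2)]
    unfolding has_dir_derivative_iff by (intro exI[of _ "\<lambda>v. dF v + dG v"]) blast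
qed

lemma tuple_poly_Ck_tuples:
  "tuple_poly k U m F \<Longrightarrow> m \<ge> 1 \<Longrightarrow> Ck_tuples k m (Tup m U) F"
proof (induction k arbitrary: m F)
  case 0
  then show ?case by (simp add: tuple_poly_continuous)
next
  case (Suc k)
  obtain dF where dF: "\<forall>x\<in>Tup m (interior U). \<forall>y\<in>tuples m. has_dir_derivative F (dF (join m x y)) x y"
    "tuple_poly k U (2 * m) dF" using tuple_poly_differential[OF Suc.prems] by blast
  have "is_differential m (Tup m U) F dF"
    unfolding is_differential_def interior_Tup[OF Suc.prems(2)] times_tuples_Tup[OF Suc.prems(2)]
    using dF tuple_poly_continuous by blast
  moreover have "Ck_tuples k (2 * m) (Tup (2 * m) U) dF"
    using Suc.IH[OF dF(2)] Suc.prems(2) by simp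
  ultimately show ?case
    using tuple_poly_continuous[OF Suc.prems(1)]
    unfolding Ck_tuples.simps times_tuples_Tup[OF Suc.prems(2)] by blast
qed

lemma Cinf_on_imp_smooth_on: "Cinf_on U f \<Longrightarrow> smooth_on (U :: 'e set) f"
  unfolding smooth_on_def Ck_on_def Tup_def[symmetric] Cinf_on_def
  using tuple_poly_Ck_tuples[OF tuple_poly.base, of _ U f 1] by blast

end

section \<open>From iterated differentials to Frechet derivatives\<close>

text \<open>
  The partial substitution of constants for components, which is used to fix the direction in a
  differential.  The tangent map of a substitution is again a substitution, for twice the number of
  components.
\<close>

definition select :: "nat set \<Rightarrow> (nat \<Rightarrow> nat) \<Rightarrow> (nat \<Rightarrow> 'e) \<Rightarrow> (nat \<Rightarrow> 'e) \<Rightarrow> (nat \<Rightarrow> 'e)" where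
  "select I s c v = (\<lambda>i. if i \<in> I then v (s i) else c i)"

text \<open>
  The differential of \<open>h \<circ> L\<close> is \<open>dh \<circ> (L \<times> L')\<close> with the linear part \<open>L'\<close> of \<open>L\<close>, so the induction must run
  over all substitutions and all numbers of components at once.
\<close>

lemma Ck_tuples_select:
  assumes "Ck_tuples k m' (Tup m' U) h" "m \<ge> 1" "m' \<ge> 1"
    and "0 \<in> I" "s 0 = 0" "I \<subseteq> {..<m'}" "\<And>i. i \<in> I \<Longrightarrow> s i < m" "c \<in> tuples m'"
  shows "Ck_tuples k m (Tup m U) (\<lambda>v. h (select I s c v))"
  using assms
proof (induction k arbitrary: m m' h I s c)
  note sel = select_def
  {
    fix m m' :: nat and h :: "(nat \<Rightarrow> 'a) \<Rightarrow> 'b" and I s and c :: "nat \<Rightarrow> 'a"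
    assume h: "continuous_on (Tup m' U) h" and *: "m \<ge> 1" "m' \<ge> 1"
     "0 \<in> I" "s 0 = 0" "I \<subseteq> {..<m'}" "\<And>i. i \<in> I \<Longrightarrow> s i < m" "c \<in> tuples m'"
    have "continuous_on (Tup m U) (\<lambda>v. select I s c v i)" for i
      by (cases "i \<in> I") (simp_all add: sel continuous_on_tuple_component)
    then have "continuous_on (Tup m U) (select I s c)" by (rule continuous_on_coordinatewise_then_product)
    moreover have "select I s c ` Tup m U \<subseteq> Tup m' U"
      using * by (auto simp: Tup_def tuples_def sel)
    ultimately have "continuous_on (Tup m U) (\<lambda>v. h (select I s c v))"
      by (rule continuous_on_compose2[OF h])
  }
  note cont = this
  {
    case 0
    then show ?case using cont[of m' h m I s c] by simp
  next
    case (Suc k)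
    from Suc.prems(1) obtain dh where dh: "continuous_on (Tup m' U) h"
      "is_differential m' (Tup m' U) h dh" "Ck_tuples k (2 * m') (Tup (2 * m') U) dh"
      unfolding Ck_tuples.simps times_tuples_Tup[OF Suc.prems(3)] by blast
    define I' s' c' where "I' = I \<union> (+) m' ` I" and "s' = (\<lambda>i. if i < m' then s i else m + s (i - m'))"
      and "c' = (\<lambda>i. if i < m' then c i else 0)"
    have I: "i < m'" if "i \<in> I" for i using that Suc.prems(6) by auto
    define dg where "dg = (\<lambda>v. dh (select I' s' c' v))"
    have IH: "Ck_tuples k (2 * m) (Tup (2 * m) U) dg"
      unfolding dg_def
    proof (rule Suc.IH[OF dh(3)])
      show "s' i < 2 * m" if "i \<in> I'" for i
        using that Suc.prems(7) I by (fastforce simp: I'_def s'_def)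
      show "I' \<subseteq> {..<2 * m'}" using I by (fastforce simp: I'_def)
    qed (use Suc.prems I in \<open>auto simp: I'_def s'_def c'_def tuples_def\<close>)
    have "has_dir_derivative (\<lambda>v. h (select I s c v)) (dg (join m x y)) x y"
      if x: "x \<in> Tup m (interior U)" and y: "y \<in> tuples m" for x y
    proof -
      have Lx: "select I s c x \<in> Tup m' (interior U)"
        using x Suc.prems by (auto simp: Tup_def tuples_def sel)
      have Ly: "select I s (\<lambda>_. 0) y \<in> tuples m'"
        using Suc.prems I by (auto simp: tuples_def sel)
      have "has_dir_derivative h (dh (join m' (select I s c x) (select I s (\<lambda>_. 0) y)))
          (select I s c x) (select I s (\<lambda>_. 0) y)"
        using dh(2) Lx Ly unfolding is_differential_def interior_Tup[OF Suc.prems(3)] by blast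
      moreover have "(\<lambda>i. select I s c x i + t *\<^sub>R select I s (\<lambda>_. 0) y i) =
          select I s c (\<lambda>i. x i + t *\<^sub>R y i)" for t
        by (auto simp: sel)
      moreover have "select I' s' c' (join m x y) = join m' (select I s c x) (select I s (\<lambda>_. 0) y)"
      proof
        fix i show "select I' s' c' (join m x y) i = join m' (select I s c x) (select I s (\<lambda>_. 0) y) i"
        proof (cases "i < m'")
          case True
          then have "i \<in> I' \<longleftrightarrow> i \<in> I" by (auto simp: I'_def)
          then show ?thesis using True Suc.prems(7) by (auto simp: sel join_def s'_def c'_def)
        next
          case False
          then have "i \<in> I' \<longleftrightarrow> i - m' \<in> I" using I by (force simp: I'_def image_iff)
          then show ?thesis using False by (auto simp: sel join_def s'_def c'_def)
        qed
      qed
      ultimately show ?thesis unfolding has_dir_derivative_iff dg_def by simp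
    qed
    then have "is_differential m (Tup m U) (\<lambda>v. h (select I s c v)) dg"
      unfolding is_differential_def interior_Tup[OF Suc.prems(2)] times_tuples_Tup[OF Suc.prems(2)]
      using IH by (cases k) auto
    then show ?case
      using IH cont[of m' h m I s c, OF dh(1) Suc.prems(2-8)]
      unfolding Ck_tuples.simps times_tuples_Tup[OF Suc.prems(2)] by blast
  }
qed

lemma continuous_le_0_dense:
  fixes g :: "'a::topological_space \<Rightarrow> real"
  assumes "continuous_on S g" "T \<subseteq> S" "S \<subseteq> closure T" "\<And>t. t \<in> T \<Longrightarrow> g t \<le> 0" "s \<in> S"
  shows "g s \<le> 0"
proof -
  have "closedin (top_of_set S) (S \<inter> g -` {..0})"
    by (rule continuous_closedin_preimage[OF assms(1)]) simp
  then obtain C where C: "closed C" "S \<inter> g -` {..0} = S \<inter> C" unfolding closedin_closed by blast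
  have "T \<subseteq> C" using C(2) assms(2,4) by blast
  then have "closure T \<subseteq> C" by (simp add: closure_minimal C(1))
  then show ?thesis using C(2) assms(3,5) by blast
qed

lemma continuous_eq_dense:
  fixes g1 g2 :: "'a::topological_space \<Rightarrow> 'b::real_normed_vector"
  assumes "continuous_on S g1" "continuous_on S g2" "T \<subseteq> S" "S \<subseteq> closure T"
    "\<And>t. t \<in> T \<Longrightarrow> g1 t = g2 t" "s \<in> S"
  shows "g1 s = g2 s"
  using continuous_le_0_dense[OF continuous_on_norm[OF continuous_on_diff[OF assms(1,2)]]
      assms(3,4) _ assms(6)] assms(5) by simp

text \<open>
  By homogeneity and compactness of the unit sphere, \<open>D y h\<close> is close to \<open>D x h\<close> uniformly in \<open>h\<close> relative
  to its norm, for \<open>y\<close> near \<open>x\<close>.  The mean value theorem on segments inside the interior gives the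
  estimate of a strong derivative there, and both sides of that estimate are continuous, so that it
  persists on the closure within \<open>U\<close>.  Additivity of \<open>D x\<close> at interior points is a consequence of the
  same estimate and passes to the boundary by density.
\<close>

lemma (in finite_basis) has_derivative_from_directional:
  fixes f :: "'e \<Rightarrow> 'f::real_normed_vector"
  assumes U: "calculus_domain U" and f: "continuous_on U f"
    and D: "continuous_on (U \<times> UNIV) (\<lambda>(x, h). D x h)"
    and dir: "\<And>x h. x \<in> interior U \<Longrightarrow> ((\<lambda>t. f (x + t *\<^sub>R h)) has_vector_derivative D x h) (at 0)"
    and x: "x \<in> U"
  shows "(f has_derivative D x) (at x within U)"
proof -
  have dense: "U \<subseteq> closure (interior U)" using U by (simp add: calculus_domain_def)
  have contD: "continuous_on U (\<lambda>x. D x h)" for h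
    by (rule continuous_on_compose2[OF D, of U "\<lambda>x. (x, h)", simplified]) (auto intro!: continuous_intros)
  have scale: "D x (c *\<^sub>R h) = c *\<^sub>R D x h" if "x \<in> U" for x c h
  proof (rule continuous_eq_dense[OF _ _ interior_subset dense _ that])
    show "D y (c *\<^sub>R h) = c *\<^sub>R D y h" if y: "y \<in> interior U" for y
    proof -
      have "((\<lambda>t. f (y + t *\<^sub>R h)) has_vector_derivative D y h) (at (c * 0))" using dir[OF y] by simp
      moreover have "((\<lambda>t. c * t) has_vector_derivative c) (at 0)"
        by (auto intro!: derivative_eq_intros simp: has_real_derivative_iff_has_vector_derivative[symmetric])
      ultimately have "((\<lambda>t. f (y + t *\<^sub>R (c *\<^sub>R h))) has_vector_derivative c *\<^sub>R D y h) (at 0)"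
        using vector_diff_chain_at[of "\<lambda>t. c * t" c 0 "\<lambda>t. f (y + t *\<^sub>R h)"]
        by (simp add: o_def mult.commute)
      with dir[OF y] show ?thesis by (rule vector_derivative_unique_at)
    qed
  qed (intro contD continuous_intros)+
  have unif: "\<exists>d>0. \<forall>y\<in>U \<inter> ball x d. \<forall>h. norm (D y h - D x h) \<le> e * norm h"
    if x: "x \<in> U" and e: "e > 0" for x e
  proof -
    have "compact (sphere (0::'e) 1)"
      by (rule compact_bounded_closed) (auto simp: bounded_iff sphere_def intro!: closed_Collect_eq continuous_intros)
    moreover have "continuous_on (U \<times> sphere 0 1) (\<lambda>(x, h). D x h)"
      by (rule continuous_on_subset[OF D]) auto
    ultimately obtain X0 where X0: "x \<in> X0" "open X0"
      "\<forall>y\<in>X0 \<inter> U. \<forall>t\<in>sphere 0 1. dist (D y t) (D x t) \<le> e"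
      using continuous_on_prod_compactE[of U "sphere 0 1" "\<lambda>(x, h). D x h" x e] x e by auto
    then obtain d where d: "d > 0" "ball x d \<subseteq> X0" using openE by blast
    have "norm (D y h - D x h) \<le> e * norm h" if y: "y \<in> U \<inter> ball x d" for y h
    proof (cases "h = 0")
      case True
      then show ?thesis using scale[of y 0 0] scale[of x 0 0] x y by simp
    next
      case False
      define u where "u = (1 / norm h) *\<^sub>R h"
      have u: "h = norm h *\<^sub>R u" "u \<in> sphere 0 1" using False by (auto simp: u_def)
      have "norm (D y u - D x u) \<le> e" using X0(3) d y u(2) by (auto simp: dist_norm)
      moreover have "D y h - D x h = norm h *\<^sub>R (D y u - D x u)"
        using scale[of y "norm h" u] scale[of x "norm h" u] x y u(1) by (simp add: scaleR_diff_right)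
      ultimately show ?thesis
        using mult_left_mono[of "norm (D y u - D x u)" e "norm h"] by (simp add: mult.commute[of e])
    qed
    then show ?thesis using d(1) by blast
  qed
  have estimate: "\<exists>d>0. \<forall>y\<in>U \<inter> ball x d. \<forall>z\<in>U \<inter> ball x d.
      norm (f z - f y - D x (z - y)) \<le> e * norm (z - y)"
    if x: "x \<in> U" and e: "e > 0" for x e
  proof -
    obtain r where r: "r > 0" "convex (U \<inter> ball x r)" using U x by (auto simp: calculus_domain_def)
    obtain d0 where d0: "d0 > 0" "\<forall>y\<in>U \<inter> ball x d0. \<forall>h. norm (D y h - D x h) \<le> e * norm h"
      using unif[OF x e] by blast
    define d where "d = min r d0"
    define S where "S = U \<inter> ball x d"
    have d: "d > 0" using r d0 by (simp add: d_def)
    have S: "convex S" unfolding S_def d_def by (rule convex_Int_ball_mono[OF r(2)]) simp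
    have Sint: "convex (interior S)" using S by (rule convex_interior)
    have SU: "S \<subseteq> U" "interior S \<subseteq> interior U" by (auto simp: S_def interior_Int)
    have denseS: "S \<subseteq> closure (interior S)"
      using calculus_domain_openin[OF U, of S] by (auto simp: S_def calculus_domain_def openin_open_Int)
    have DxE: "continuous_on W (\<lambda>h. D x h)" for W
      by (rule continuous_on_compose2[OF D, of W "\<lambda>h. (x, h)", simplified])
        (use x in \<open>auto intro!: continuous_intros\<close>)
    have fS: "continuous_on S f" using f SU continuous_on_subset by blast
    have in1: "norm (f z - f y - D x (z - y)) \<le> e * norm (z - y)"
      if y: "y \<in> interior S" and z: "z \<in> interior S" for y z
    proof -
      define p where "p = (\<lambda>u::real. f (y + u *\<^sub>R (z - y)) - u *\<^sub>R D x (z - y))"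
      have seg: "y + u *\<^sub>R (z - y) \<in> interior S" if "u \<in> {0..1}" for u
      proof -
        have "(1 - u) *\<^sub>R y + u *\<^sub>R z \<in> interior S"
          using Sint y z that by (auto simp: convex_alt)
        then show ?thesis by (simp add: algebra_simps)
      qed
      have der: "(p has_derivative (\<lambda>t. t *\<^sub>R (D (y + u *\<^sub>R (z - y)) (z - y) - D x (z - y)))) (at u within {0..1})"
        if u: "u \<in> {0..1}" for u
      proof -
        have w: "y + u *\<^sub>R (z - y) \<in> interior U" using seg[OF u] SU by blast
        have "((\<lambda>t. f ((y + u *\<^sub>R (z - y)) + t *\<^sub>R (z - y))) has_vector_derivative D (y + u *\<^sub>R (z - y)) (z - y)) (at (u - u))"
          using dir[OF w] by simp
        moreover have "((\<lambda>t. t - u) has_vector_derivative 1) (at u)"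
          by (auto intro!: derivative_eq_intros simp: has_real_derivative_iff_has_vector_derivative[symmetric])
        ultimately have "((\<lambda>t. f (y + t *\<^sub>R (z - y))) has_vector_derivative D (y + u *\<^sub>R (z - y)) (z - y)) (at u)"
          using vector_diff_chain_at[of "\<lambda>t. t - u" 1 u]
          by (fastforce simp: o_def algebra_simps)
        then have "(p has_vector_derivative D (y + u *\<^sub>R (z - y)) (z - y) - D x (z - y)) (at u)"
          unfolding p_def
          by (intro has_vector_derivative_diff)
            (auto intro!: derivative_eq_intros simp: has_vector_derivative_def)
        then show ?thesis unfolding has_vector_derivative_def by (rule has_derivative_at_withinI)
      qed
      have "norm (p 1 - p 0) \<le> (e * norm (z - y)) * norm (1 - 0::real)"
      proof (rule differentiable_bound[OF convex_real_interval(5) der])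
        fix u :: real assume u: "u \<in> {0..1}"
        have "norm (D (y + u *\<^sub>R (z - y)) (z - y) - D x (z - y)) \<le> e * norm (z - y)"
          using d0(2) seg[OF u] interior_subset[of S] by (auto simp: S_def d_def)
        then show "onorm (\<lambda>t::real. t *\<^sub>R (D (y + u *\<^sub>R (z - y)) (z - y) - D x (z - y))) \<le> e * norm (z - y)"
          by (intro onorm_le) (simp add: mult.commute mult_left_mono)
      qed auto
      then show ?thesis by (simp add: p_def algebra_simps)
    qed
    have in2: "norm (f z - f y - D x (z - y)) - e * norm (z - y) \<le> 0"
      if y: "y \<in> interior S" and z: "z \<in> S" for y z
    proof (rule continuous_le_0_dense[OF _ interior_subset denseS _ z])
      show "continuous_on S (\<lambda>z. norm (f z - f y - D x (z - y)) - e * norm (z - y))"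
        by (intro continuous_intros fS continuous_on_compose2[OF DxE[of UNIV]]) auto
      show "norm (f z - f y - D x (z - y)) - e * norm (z - y) \<le> 0" if "z \<in> interior S" for z
        using in1[OF y that] by simp
    qed
    have in3: "norm (f z - f y - D x (z - y)) - e * norm (z - y) \<le> 0"
      if z: "z \<in> S" and y: "y \<in> S" for y z
    proof (rule continuous_le_0_dense[OF _ interior_subset denseS _ y])
      show "continuous_on S (\<lambda>y. norm (f z - f y - D x (z - y)) - e * norm (z - y))"
        by (intro continuous_intros fS continuous_on_compose2[OF DxE[of UNIV]]) auto
    qed (use in2 z in auto)
    show ?thesis using in3 d unfolding S_def by (intro exI[of _ d]) auto
  qed
  have add_int: "D x (h + k) = D x h + D x k" if x: "x \<in> interior U" for x h k
  proof -
    have xU: "x \<in> U" using x interior_subset by blast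
    define N where "N = norm k + norm h + norm (h + k)"
    have le: "norm (D x (h + k) - D x h - D x k) \<le> e * N" if e: "e > 0" for e
    proof -
      obtain d where d: "d > 0" "\<And>y z. y \<in> U \<inter> ball x d \<Longrightarrow> z \<in> U \<inter> ball x d \<Longrightarrow>
          norm (f z - f y - D x (z - y)) \<le> e * norm (z - y)"
        using estimate[OF xU e] by blast
      obtain d' where d': "d' > 0" "ball x d' \<subseteq> U" using x by (auto simp: mem_interior)
      define a where "a = N + 1"
      have a: "a > 0" "N < a" by (auto simp: a_def N_def add_nonneg_pos)
      define t where "t = min d d' / a"
      have t: "t > 0" using d d' a by (simp add: t_def)
      have small: "x + t *\<^sub>R w \<in> U \<inter> ball x d" if "norm w \<le> N" for w
      proof -
        have "t * norm w < t * a" using that a t by simp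
        also have "t * a = min d d'" using a by (simp add: t_def)
        finally have "x + t *\<^sub>R w \<in> ball x d'" "x + t *\<^sub>R w \<in> ball x d" using t by (auto simp: dist_norm)
        then show ?thesis using d' by blast
      qed
      have pts: "x + t *\<^sub>R (h + k) \<in> U \<inter> ball x d" "x + t *\<^sub>R h \<in> U \<inter> ball x d" "x \<in> U \<inter> ball x d"
        using small[of "h + k"] small[of h] small[of 0] by (auto simp: N_def)
      have 1: "norm (f (x + t *\<^sub>R (h + k)) - f (x + t *\<^sub>R h) - t *\<^sub>R D x k) \<le> t * (e * norm k)"
        using d(2)[OF pts(2,1)] scale[OF xU, of t k] t by (simp add: algebra_simps)
      have 2: "norm (f (x + t *\<^sub>R h) - f x - t *\<^sub>R D x h) \<le> t * (e * norm h)"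
        using d(2)[OF pts(3,2)] scale[OF xU, of t h] t by (simp add: algebra_simps)
      have 3: "norm (f (x + t *\<^sub>R (h + k)) - f x - t *\<^sub>R D x (h + k)) \<le> t * (e * norm (h + k))"
        using d(2)[OF pts(3,1)] scale[OF xU, of t "h + k"] t by (simp add: mult.left_commute)
      have "t *\<^sub>R (D x (h + k) - D x h - D x k) =
          (f (x + t *\<^sub>R (h + k)) - f (x + t *\<^sub>R h) - t *\<^sub>R D x k) + (f (x + t *\<^sub>R h) - f x - t *\<^sub>R D x h)
          - (f (x + t *\<^sub>R (h + k)) - f x - t *\<^sub>R D x (h + k))" by (simp add: scaleR_diff_right)
      also have "norm \<dots> \<le> t * (e * norm k) + t * (e * norm h) + t * (e * norm (h + k))"
        by (rule order.trans[OF norm_triangle_ineq4 add_mono[OF order.trans[OF norm_triangle_ineq add_mono[OF 1 2]] 3]])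
      finally have "t * norm (D x (h + k) - D x h - D x k) \<le> t * (e * N)"
        using t by (simp add: N_def distrib_left)
      then show ?thesis using t by simp
    qed
    have "norm (D x (h + k) - D x h - D x k) \<le> 0"
    proof (rule field_le_epsilon)
      fix e :: real assume e: "e > 0"
      have N: "N + 1 > 0" by (auto simp: N_def add_nonneg_pos)
      have "norm (D x (h + k) - D x h - D x k) \<le> e / (N + 1) * N" using le[of "e / (N + 1)"] e N by simp
      also have "\<dots> \<le> e" using N e by (simp add: field_simps)
      finally show "norm (D x (h + k) - D x h - D x k) \<le> 0 + e" by simp
    qed
    then show ?thesis by (simp add: algebra_simps)
  qed
  have add: "D x (h + k) = D x h + D x k" if "x \<in> U" for x h k
    by (rule continuous_eq_dense[OF _ _ interior_subset dense add_int that])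
      (intro contD continuous_intros)+
  have "linear (D x)" using add[OF x] scale[OF x] by (intro linearI) auto
  then have "bounded_linear (D x)" by (rule linear_bounded_linear)
  moreover have "\<exists>d>0. \<forall>y\<in>U. norm (y - x) < d \<longrightarrow> norm (f y - f x - D x (y - x)) \<le> e * norm (y - x)"
    if e: "e > 0" for e
  proof -
    obtain d where d: "d > 0" "\<And>y z. y \<in> U \<inter> ball x d \<Longrightarrow> z \<in> U \<inter> ball x d \<Longrightarrow>
          norm (f z - f y - D x (z - y)) \<le> e * norm (z - y)"
        using estimate[OF x e] by blast
    have "norm (f y - f x - D x (y - x)) \<le> e * norm (y - x)" if "y \<in> U" "norm (y - x) < d" for y
      using d(2)[of x y] that x d(1) by (simp add: dist_norm norm_minus_commute[of x])
    then show ?thesis using d(1) by blast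
  qed
  ultimately show ?thesis unfolding has_derivative_within_alt by blast
qed

lemma (in finite_basis) Ck_tuples_imp_Cn_on:
  fixes f :: "'e \<Rightarrow> 'f::real_normed_vector"
  assumes U: "calculus_domain U"
  shows "Ck_tuples k 1 (Tup 1 U) (\<lambda>v. f (v 0)) \<Longrightarrow> Cn_on k U f"
proof (induction k arbitrary: f)
  let ?s = "\<lambda>(x::'e) i::nat. if i = 0 then x else 0"
  have conts: "continuous_on X (\<lambda>x. ?s x)" for X
  proof (rule continuous_on_coordinatewise_then_product)
    show "continuous_on X (\<lambda>x. ?s x i)" for i by (cases "i = 0") auto
  qed
  {
    fix f :: "'e \<Rightarrow> 'f" assume *: "continuous_on (Tup 1 U) (\<lambda>v. f (v 0))"
    have "continuous_on U (\<lambda>x. (\<lambda>v. f (v 0)) (?s x))"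
      by (rule continuous_on_compose2[OF * conts]) (auto simp: Tup_def tuples_def)
    then have "continuous_on U f" by simp
  }
  note cont = this
  {
    case 0
    then show ?case using cont by simp
  next
    case (Suc k)
    then obtain df where df: "continuous_on (Tup 1 U) (\<lambda>v. f (v 0))"
      "is_differential 1 (Tup 1 U) (\<lambda>v. f (v 0)) df" "Ck_tuples k 2 (Tup 2 U) df"
      using times_tuples_Tup[of 1 U] by auto
    define D where "D = (\<lambda>x h. df (join 1 (?s x) (?s h)))"
    have s: "?s x \<in> tuples 1" for x by (simp add: tuples_def)
    have dir: "((\<lambda>t. f (x + t *\<^sub>R h)) has_vector_derivative D x h) (at 0)" if "x \<in> interior U" for x h
    proof -
      have "?s x \<in> Tup 1 (interior U)" using that by (simp add: Tup_def tuples_def)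
      then have "has_dir_derivative (\<lambda>v. f (v 0)) (D x h) (?s x) (?s h)"
        using df(2) s unfolding is_differential_def interior_Tup[OF order.refl] D_def by blast
      then show ?thesis unfolding has_dir_derivative_iff by simp
    qed
    have "continuous_on (U \<times> UNIV) (\<lambda>p. df (join 1 (?s (fst p)) (?s (snd p))))"
    proof (rule continuous_on_compose2[of "Tup 2 U" df])
      show "continuous_on (Tup 2 U) df"
        using df(2) times_tuples_Tup[of 1 U] by (simp add: is_differential_def)
      show "continuous_on (U \<times> UNIV) (\<lambda>p. join 1 (?s (fst p)) (?s (snd p)))"
      proof (rule continuous_on_coordinatewise_then_product)
        fix i
        show "continuous_on (U \<times> UNIV) (\<lambda>p. join 1 (?s (fst p)) (?s (snd p)) i)"
          by (cases "i = 0"; cases "i = 1") (auto simp: join_def intro!: continuous_intros)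
      qed
      show "(\<lambda>p. join 1 (?s (fst p)) (?s (snd p))) ` (U \<times> UNIV) \<subseteq> Tup 2 U"
        by (auto simp: Tup_def tuples_def join_def)
    qed
    then have contD: "continuous_on (U \<times> UNIV) (\<lambda>(x, h). D x h)"
      by (simp add: D_def case_prod_beta)
    have "Cn_on k U (\<lambda>x. D x h)" for h
    proof (rule Suc.IH)
      have "Ck_tuples k 1 (Tup 1 U) (\<lambda>v. df (select {0} (\<lambda>_. 0) (\<lambda>i. if i = 1 then h else 0) v))"
        by (rule Ck_tuples_select[OF df(3)]) (auto simp: tuples_def)
      moreover have "select {0} (\<lambda>_. 0) (\<lambda>i. if i = 1 then h else 0) v = join 1 (?s (v 0)) (?s h)" for v
        by (auto simp: select_def join_def fun_eq_iff)
      ultimately show "Ck_tuples k 1 (Tup 1 U) (\<lambda>v. D (v 0) h)" by (simp add: D_def)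
    qed
    with has_derivative_from_directional[OF U cont[OF df(1)] contD dir] show ?case
      by (intro Cn_on_SucI) auto
  }
qed

lemma (in finite_basis) smooth_on_iff_Cinf_on:
  "calculus_domain (U::'e set) \<Longrightarrow> smooth_on U f \<longleftrightarrow> Cinf_on U f"
  using Cinf_on_imp_smooth_on[of U f] Ck_tuples_imp_Cn_on[of U _ f]
  unfolding smooth_on_def Ck_on_def Tup_def[symmetric] Cinf_on_def by blast

section \<open>Polytopes as intersections of half-spaces\<close>

text \<open>
  One step of Fourier-Motzkin elimination: the parameter \<open>t\<close> of the ray occurs in lower bounds, given
  by \<open>l p > 0\<close> and by \<open>t \<ge> 0\<close>, and in upper bounds, given by \<open>l p < 0\<close>; a solution \<open>t\<close> exists iff each
  lower bound is at most each upper bound.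
\<close>

lemma halfspaces_plus_ray:
  fixes L :: "('v::real_vector \<Rightarrow> real) set"
  assumes fin: "finite L" and lin: "\<And>l. l \<in> L \<Longrightarrow> linear l"
  shows "\<exists>L'. finite L' \<and> (\<forall>l\<in>L'. linear l) \<and>
    {x. \<exists>t\<ge>0. \<forall>l\<in>L. l (x - t *\<^sub>R p) \<le> 0} = {x. \<forall>l\<in>L'. l x \<le> (0::real)}"
proof -
  define Lp Ln L0 where "Lp = {l \<in> L. l p > 0}" and "Ln = {l \<in> L. l p < 0}" and "L0 = {l \<in> L. l p = 0}"
  define mix where "mix = (\<lambda>(l, k) x::'v. l x / l p - k x / k p :: real)"
  define L' where "L' = L0 \<union> Ln \<union> mix ` (Lp \<times> Ln)"
  have fins: "finite Lp" "finite Ln" "finite L0" using fin by (auto simp: Lp_def Ln_def L0_def)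
  have "linear (mix (l, k))" if "l \<in> L" "k \<in> L" for l k
    unfolding mix_def using lin[OF that(1)] lin[OF that(2)]
    by (intro linearI) (simp_all add: linear_add linear_cmul add_divide_distrib right_diff_distrib)
  then have linL': "\<forall>l\<in>L'. linear l"
    using lin by (auto simp: L'_def L0_def Lp_def Ln_def)
  have move: "l (x - t *\<^sub>R p) = l x - t * l p" if "l \<in> L" for l x t
    using lin[OF that] by (simp add: linear_diff linear_cmul)
  have "(\<exists>t\<ge>0. \<forall>l\<in>L. l (x - t *\<^sub>R p) \<le> 0) \<longleftrightarrow> (\<forall>l\<in>L'. l x \<le> 0)" for x
  proof
    assume "\<exists>t\<ge>0. \<forall>l\<in>L. l (x - t *\<^sub>R p) \<le> 0"
    then obtain t where t: "t \<ge> 0" "\<And>l. l \<in> L \<Longrightarrow> l x \<le> t * l p" using move by fastforce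
    show "\<forall>l\<in>L'. l x \<le> 0"
    proof
      fix l assume "l \<in> L'"
      then consider "l \<in> L0" | "l \<in> Ln" | m k where "l = mix (m, k)" "m \<in> Lp" "k \<in> Ln"
        by (auto simp: L'_def)
      then show "l x \<le> 0"
      proof cases
        case 1 then show ?thesis using t(2)[of l] by (simp add: L0_def)
      next
        case 2 then show ?thesis using t(2)[of l] mult_nonneg_nonpos[OF t(1), of "l p"] by (simp add: Ln_def)
      next
        case 3
        have "m x / m p \<le> t" using 3 t(2)[of m] by (simp add: Lp_def pos_divide_le_eq)
        moreover have "t \<le> k x / k p" using 3 t(2)[of k] by (simp add: Ln_def neg_le_divide_eq)
        ultimately show ?thesis using 3 by (simp add: mix_def)
      qed
    qed
  next
    assume *: "\<forall>l\<in>L'. l x \<le> 0"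
    \<comment> \<open>the largest of the lower bounds\<close>
    define t where "t = Max (insert 0 ((\<lambda>l. l x / l p) ` Lp))"
    have t0: "t \<ge> 0" and tp: "\<And>l. l \<in> Lp \<Longrightarrow> l x / l p \<le> t" unfolding t_def using fins by auto
    have tn: "t \<le> k x / k p" if k: "k \<in> Ln" for k
    proof -
      have "k x \<le> 0" "k p < 0" using * k by (auto simp: L'_def Ln_def)
      then have "0 \<le> k x / k p" by (simp add: zero_le_divide_iff)
      moreover have "l x / l p \<le> k x / k p" if l: "l \<in> Lp" for l
      proof -
        have "mix (l, k) \<in> L'" using l k by (auto simp: L'_def)
        then have "mix (l, k) x \<le> 0" using * by blast
        then show ?thesis by (simp add: mix_def)
      qed
      ultimately show ?thesis unfolding t_def using fins by auto
    qed
    have "l (x - t *\<^sub>R p) \<le> 0" if l: "l \<in> L" for l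
    proof -
      consider "l p = 0" | "l p < 0" | "l p > 0" by linarith
      then consider "l \<in> L0" | "l \<in> Ln" | "l \<in> Lp" using l unfolding L0_def Ln_def Lp_def by blast
      then have "l x \<le> t * l p"
      proof cases
        case 1
        then have "l \<in> L'" by (simp add: L'_def)
        then show ?thesis using * 1 by (simp add: L0_def)
      next
        case 2 then show ?thesis using tn[of l] by (simp add: Ln_def neg_le_divide_eq)
      next
        case 3 then show ?thesis using tp[of l] by (simp add: Lp_def pos_divide_le_eq)
      qed
      then show ?thesis by (simp add: move[OF l])
    qed
    then show "\<exists>t\<ge>0. \<forall>l\<in>L. l (x - t *\<^sub>R p) \<le> 0" using t0 by blast
  qed
  then have "{x. \<exists>t\<ge>0. \<forall>l\<in>L. l (x - t *\<^sub>R p) \<le> 0} = {x. \<forall>l\<in>L'. l x \<le> 0}" by (rule Collect_cong)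
  moreover have "finite L'" using fins by (simp add: L'_def)
  ultimately show ?thesis using linL' by (intro exI[of _ L'] conjI)
qed

lemma finite_cone_halfspaces:
  fixes S :: "'v::real_vector set" and L0 :: "('v \<Rightarrow> real) set"
  assumes "finite S" and "finite L0" "\<And>l. l \<in> L0 \<Longrightarrow> linear l" "{x. \<forall>l\<in>L0. l x \<le> (0::real)} = {0}"
  shows "\<exists>L. finite L \<and> (\<forall>l\<in>L. linear l) \<and>
    {\<Sum>p\<in>S. u p *\<^sub>R p | u. \<forall>p\<in>S. u p \<ge> 0} = {x. \<forall>l\<in>L. l x \<le> (0::real)}"
  using assms(1)
proof (induction S rule: finite_induct)
  case empty
  then show ?case using assms(2-4) by (intro exI[of _ L0]) auto
next
  case (insert p S)
  then obtain L where L: "finite L" "\<forall>l\<in>L. linear l"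
    "{\<Sum>p\<in>S. u p *\<^sub>R p | u. \<forall>p\<in>S. u p \<ge> 0} = {x. \<forall>l\<in>L. l x \<le> (0::real)}" by blast
  have "x \<in> {\<Sum>p\<in>insert p S. u p *\<^sub>R p | u. \<forall>p\<in>insert p S. u p \<ge> 0} \<longleftrightarrow>
      (\<exists>t\<ge>0. \<forall>l\<in>L. l (x - t *\<^sub>R p) \<le> 0)" for x
  proof
    assume "x \<in> {\<Sum>p\<in>insert p S. u p *\<^sub>R p | u. \<forall>p\<in>insert p S. u p \<ge> 0}"
    then obtain u where u: "x = (\<Sum>p\<in>insert p S. u p *\<^sub>R p)" "\<forall>p\<in>insert p S. u p \<ge> 0" by blast
    then have "x - u p *\<^sub>R p \<in> {\<Sum>p\<in>S. u p *\<^sub>R p | u. \<forall>p\<in>S. u p \<ge> 0}"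
      using insert.hyps by auto
    then show "\<exists>t\<ge>0. \<forall>l\<in>L. l (x - t *\<^sub>R p) \<le> 0" using L(3) u(2) by auto
  next
    assume "\<exists>t\<ge>0. \<forall>l\<in>L. l (x - t *\<^sub>R p) \<le> 0"
    then obtain t where t: "t \<ge> 0" "x - t *\<^sub>R p \<in> {x. \<forall>l\<in>L. l x \<le> 0}" by blast
    then obtain u where u: "x - t *\<^sub>R p = (\<Sum>p\<in>S. u p *\<^sub>R p)" "\<forall>p\<in>S. u p \<ge> 0"
      unfolding L(3)[symmetric] by blast
    have "(\<Sum>q\<in>S. (u(p := t)) q *\<^sub>R q) = (\<Sum>q\<in>S. u q *\<^sub>R q)"
      using insert.hyps by (intro sum.cong) auto
    then have "x = (\<Sum>q\<in>insert p S. (u(p := t)) q *\<^sub>R q)"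
      using insert.hyps u(1) by (simp add: algebra_simps)
    then show "x \<in> {\<Sum>p\<in>insert p S. u p *\<^sub>R p | u. \<forall>p\<in>insert p S. u p \<ge> 0}"
      using u(2) t(1) by (intro CollectI exI[of _ "u(p := t)"]) auto
  qed
  then show ?case
    using halfspaces_plus_ray[OF L(1), of p] L(2) by (simp only: set_eq_iff mem_Collect_eq)
qed

text \<open>
  Homogenisation: \<open>x\<close> is a convex combination of \<open>S\<close> iff \<open>(x, 1)\<close> lies in the cone spanned by
  \<open>S \<times> {1}\<close>, and a cone is built up from the origin one ray at a time.
\<close>

lemma (in finite_basis) convex_hull_halfspaces:
  assumes "finite (S :: 'e set)"
  shows "\<exists>L. finite L \<and> (\<forall>(l, d)\<in>L. bounded_linear l) \<and>
    convex hull S = {x. \<forall>(l, d)\<in>L. l x \<le> (d::real)}"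
proof -
  define L0 :: "('e \<times> real \<Rightarrow> real) set" where "L0 = (\<lambda>b (x, t). coord b x) ` B \<union> (\<lambda>b (x, t). - coord b x) ` B \<union>
    {\<lambda>(x, t). t, \<lambda>(x, t). - t}"
  have lin0: "linear l" if "l \<in> L0" for l
    using that unfolding L0_def
    by (auto intro!: linearI simp: coord_add coord_scaleR)
  have "x = 0" if "\<forall>l\<in>L0. l x \<le> 0" for x :: "'e \<times> real"
  proof -
    have "coord b (fst x) = 0" if "b \<in> B" for b
    proof -
      have "(\<lambda>(x, t). coord b x) \<in> L0" "(\<lambda>(x, t). - coord b x) \<in> L0"
        using that unfolding L0_def by blast+
      from bspec[OF \<open>\<forall>l\<in>L0. l x \<le> 0\<close> this(1)] bspec[OF \<open>\<forall>l\<in>L0. l x \<le> 0\<close> this(2)]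
      have "coord b (fst x) \<le> 0" "- coord b (fst x) \<le> 0" by (simp_all add: case_prod_beta)
      then show ?thesis by simp
    qed
    then have "fst x = 0" using coord_sum[of "fst x"] by simp
    moreover have "snd x = 0" using that by (auto simp: L0_def case_prod_beta)
    ultimately show ?thesis by (simp add: prod_eq_iff)
  qed
  moreover have "\<forall>l\<in>L0. l 0 \<le> 0" by (auto simp: L0_def coord_0 zero_prod_def)
  ultimately have zero: "{x. \<forall>l\<in>L0. l x \<le> 0} = {0}" by blast
  have "finite L0" using finite_B by (simp add: L0_def)
  note cone = finite_cone_halfspaces[OF finite_imageI[OF assms, of "\<lambda>p. (p, 1::real)"] this lin0 zero]
  obtain L where L: "finite L" "\<And>l. l \<in> L \<Longrightarrow> linear l"
    "{\<Sum>q\<in>(\<lambda>p. (p, 1::real)) ` S. u q *\<^sub>R q | u. \<forall>q\<in>(\<lambda>p. (p, 1)) ` S. u q \<ge> 0} = {x. \<forall>l\<in>L. l x \<le> (0::real)}"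
    using cone by blast
  have inj: "inj_on (\<lambda>p. (p, 1::real)) S" by (auto simp: inj_on_def)
  have eq: "x \<in> convex hull S \<longleftrightarrow> (\<forall>l\<in>L. l (x, 1) \<le> 0)" for x
  proof -
    have "(\<forall>l\<in>L. l (x, 1) \<le> 0) \<longleftrightarrow> (x, 1) \<in> {\<Sum>q\<in>(\<lambda>p. (p, 1::real)) ` S. u q *\<^sub>R q | u. \<forall>q\<in>(\<lambda>p. (p, 1)) ` S. u q \<ge> 0}"
      using L(3) by blast
    also have "\<dots> \<longleftrightarrow> (\<exists>u. (\<forall>p\<in>S. u (p, 1::real) \<ge> 0) \<and> (x, 1) = (\<Sum>p\<in>S. u (p, 1) *\<^sub>R (p, 1::real)))"
      by (simp only: sum.reindex[OF inj] o_def ball_simps mem_Collect_eq) blast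
    also have "\<dots> \<longleftrightarrow> (\<exists>u. (\<forall>p\<in>S. u p \<ge> 0) \<and> (x, 1) = (\<Sum>p\<in>S. u p *\<^sub>R (p, 1::real)))"
    proof (intro iffI; elim exE)
      fix u :: "'e \<times> real \<Rightarrow> real"
      assume "(\<forall>p\<in>S. u (p, 1) \<ge> 0) \<and> (x, 1) = (\<Sum>p\<in>S. u (p, 1) *\<^sub>R (p, 1::real))"
      then show "\<exists>u. (\<forall>p\<in>S. u p \<ge> 0) \<and> (x, 1) = (\<Sum>p\<in>S. u p *\<^sub>R (p, 1::real))"
        by (rule exI[of _ "\<lambda>p. u (p, 1)"])
    next
      fix u :: "'e \<Rightarrow> real"
      assume "(\<forall>p\<in>S. u p \<ge> 0) \<and> (x, 1) = (\<Sum>p\<in>S. u p *\<^sub>R (p, 1::real))"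
      then show "\<exists>u. (\<forall>p\<in>S. u (p, 1) \<ge> 0) \<and> (x, 1) = (\<Sum>p\<in>S. u (p, 1::real) *\<^sub>R (p, 1::real))"
        by (intro exI[of _ "\<lambda>q. u (fst q)"]) simp
    qed
    also have "\<dots> \<longleftrightarrow> (\<exists>u. (\<forall>p\<in>S. u p \<ge> 0) \<and> sum u S = 1 \<and> (\<Sum>p\<in>S. u p *\<^sub>R p) = x)"
      by (auto simp: prod_eq_iff fst_sum snd_sum)
    also have "\<dots> \<longleftrightarrow> x \<in> convex hull S" by (auto simp: convex_hull_finite[OF assms])
    finally show ?thesis by simp
  qed
  define L' where "L' = (\<lambda>l. (\<lambda>x::'e. l (x, 0::real), - l (0, 1))) ` L"
  have split: "l (x, 1) = l (x, 0) + l (0, 1)" if "l \<in> L" for l x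
    using linear_add[OF L(2)[OF that], of "(x, 0)" "(0, 1)"] by simp
  have "linear (\<lambda>x. l (x, 0))" if "l \<in> L" for l
    using linear_add[OF L(2)[OF that]] linear_cmul[OF L(2)[OF that]]
    by (intro linearI) (metis add_Pair add_0 , metis scaleR_Pair scaleR_zero_right real_scaleR_def)
  then have "\<forall>(l, d)\<in>L'. bounded_linear l" using linear_bounded_linear by (auto simp: L'_def)
  moreover have "finite L'" using L(1) by (simp add: L'_def)
  moreover have "convex hull S = {x. \<forall>(l, d)\<in>L'. l x \<le> d}"
  proof -
    have "l (x, 1) \<le> 0 \<longleftrightarrow> l (x, 0) \<le> - l (0, 1)" if "l \<in> L" for l x
      using split[OF that, of x] by linarith
    then show ?thesis using eq by (auto simp: L'_def)
  qed
  ultimately show ?thesis by blast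
qed

text \<open>
  Only the half-spaces with \<open>p\<close> on their boundary matter near \<open>p\<close>.  A vector \<open>v\<close> from \<open>p\<close> to an interior
  point of \<open>P\<close> points strictly into all of them; this common transversal direction is what later
  allows a reflection across each face to respect the remaining ones.
\<close>

lemma (in finite_basis) polytope_local_cone:
  assumes P: "polytope_with_interior (P :: 'e set)" and p: "p \<in> P"
  obtains J v r where "finite J" "r > 0" "\<And>l. l \<in> J \<Longrightarrow> bounded_linear l \<and> l v < (0::real)"
    "P \<inter> ball p r = {x. \<forall>l\<in>J. l (x - p) \<le> 0} \<inter> ball p r"
proof -
  obtain S c where S: "finite S" "P = convex hull S" and c: "c \<in> interior P"
    using P unfolding polytope_with_interior_def polytope_def by blast
  from convex_hull_halfspaces[OF S(1)] obtain L where L: "finite L"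
    "\<And>l d. (l, d) \<in> L \<Longrightarrow> bounded_linear l" "P = {x. \<forall>(l, d)\<in>L. l x \<le> (d::real)}"
    unfolding S(2) by blast
  define J where "J = {l. (l, l p) \<in> L \<and> l \<noteq> (\<lambda>_. 0)}"
  define N where "N = {(l, d) \<in> L. l p < d}"
  have Jsub: "J \<subseteq> fst ` L" by (force simp: J_def)
  have finJ: "finite J" using finite_subset[OF Jsub] L(1) by simp
  have neg: "l (c - p) < 0" if l: "l \<in> J" for l
  proof (rule ccontr)
    interpret l: bounded_linear l using l L(2) by (auto simp: J_def)
    assume "\<not> l (c - p) < 0"
    moreover have "l c \<le> l p" using l c interior_subset[of P] L(3) by (auto simp: J_def)
    ultimately have eq: "l c = l p" by (simp add: l.diff)
    obtain h0 where "l h0 \<noteq> 0" using l by (auto simp: J_def)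
    define h where "h = (if l h0 > 0 then h0 else - h0)"
    have h: "l h > 0" using \<open>l h0 \<noteq> 0\<close> by (auto simp: h_def l.neg)
    obtain e where e: "e > 0" "ball c e \<subseteq> P" using c by (auto simp: mem_interior)
    define d where "d = e / norm h"
    have hn: "norm h > 0" using h l.zero by force
    then have d: "d > 0" using e by (simp add: d_def)
    have "norm ((d/2) *\<^sub>R h) < e" using hn e by (simp add: d_def)
    then have "c + (d/2) *\<^sub>R h \<in> P" using e(2) by (auto simp: dist_norm)
    then have "l (c + (d/2) *\<^sub>R h) \<le> l p" using l L(3) by (auto simp: J_def)
    then have "d / 2 * l h \<le> 0" by (simp add: l.add l.scaleR eq)
    then show False using d h by (simp add: mult_le_0_iff)
  qed
  define G where "G = (\<Inter>(l, d)\<in>N. {x. l x < d})"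
  have "open G" unfolding G_def
  proof (intro open_INT ballI)
    show "finite N" by (rule finite_subset[OF _ L(1)]) (auto simp: N_def)
    fix q assume "q \<in> N"
    then obtain l d where "q = (l, d)" "bounded_linear l" using L(2) by (auto simp: N_def)
    then show "open (case q of (l, d) \<Rightarrow> {x. l x < d})"
      by (auto intro!: open_Collect_less continuous_intros simp: linear_continuous_on)
  qed
  moreover have "p \<in> G" by (auto simp: G_def N_def)
  ultimately obtain r where r: "r > 0" "ball p r \<subseteq> G" using openE by blast
  have "x \<in> P \<longleftrightarrow> (\<forall>l\<in>J. l (x - p) \<le> 0)" if x: "x \<in> ball p r" for x
  proof
    assume "x \<in> P"
    then show "\<forall>l\<in>J. l (x - p) \<le> 0"
      using L by (auto simp: J_def bounded_linear.linear linear_diff)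
  next
    assume *: "\<forall>l\<in>J. l (x - p) \<le> 0"
    have "l x \<le> d" if ld: "(l, d) \<in> L" for l d
    proof (cases "l p < d")
      case True
      then have "(l, d) \<in> N" using ld by (simp add: N_def)
      then show ?thesis using r(2) x by (fastforce simp: G_def)
    next
      case False
      moreover have "l p \<le> d" using p L(3) ld by auto
      ultimately have d: "d = l p" by simp
      show ?thesis
      proof (cases "l = (\<lambda>_. 0)")
        case False
        then have "l (x - p) \<le> 0" using * ld d by (auto simp: J_def)
        then show ?thesis using L(2)[OF ld] d by (simp add: bounded_linear.linear linear_diff)
      qed (use d in simp)
    qed
    then show "x \<in> P" using L(3) by auto
  qed
  then have "P \<inter> ball p r = {x. \<forall>l\<in>J. l (x - p) \<le> 0} \<inter> ball p r" by auto
  moreover have "bounded_linear l \<and> l (c - p) < 0" if "l \<in> J" for l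
    using that neg L(2) by (auto simp: J_def)
  ultimately show ?thesis using that finJ r(1) by blast
qed

section \<open>Bump functions\<close>

lemma Cn_on_inverse: "Cn_on k {0<..} (inverse :: real \<Rightarrow> real)"
proof (induction k)
  case 0
  show ?case by (auto intro!: continuous_intros)
next
  case (Suc k)
  have "((inverse::real \<Rightarrow> real) has_derivative (\<lambda>h. - (inverse x * h * inverse x))) (at x within {0<..})"
    if "x \<in> {0<..}" for x
    by (rule has_derivative_inverse') (use that in auto)
  moreover have "Cn_on k {0<..} (\<lambda>x::real. - (inverse x * h * inverse x))" for h
    by (intro Cn_on_minus Cn_on_mult Suc Cn_on_const)
  ultimately show ?case by (rule Cn_on_SucI)
qed

text \<open>
  The family for all \<open>n\<close> spans a space which is closed under differentiation.
\<close>

definition flat_exp :: "nat \<Rightarrow> real \<Rightarrow> real" where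
  "flat_exp n t = (if t > 0 then inverse t ^ n * exp (- inverse t) else 0)"

lemma flat_exp_tendsto_0: "(flat_exp n \<longlongrightarrow> 0) (at 0)"
proof (rule filterlim_split_at)
  show "(flat_exp n \<longlongrightarrow> 0) (at_left 0)"
  proof (rule Lim_transform_eventually[OF tendsto_const])
    show "\<forall>\<^sub>F t in at_left 0. 0 = flat_exp n t"
      by (auto simp: eventually_at_left_field flat_exp_def intro!: exI[of _ "-1"])
  qed
  have "((\<lambda>t::real. inverse t ^ n / exp (inverse t)) \<longlongrightarrow> 0) (at_right 0)"
    by (rule filterlim_compose[OF tendsto_power_div_exp_0 filterlim_inverse_at_top_right])
  then show "(flat_exp n \<longlongrightarrow> 0) (at_right 0)"
    by (rule Lim_transform_eventually)
      (auto simp: eventually_at_right_field flat_exp_def exp_minus divide_inverse intro!: exI[of _ 1])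
qed

lemma flat_exp_derivative:
  "(flat_exp n has_real_derivative (flat_exp (n + 2) t - real n * flat_exp (n + 1) t)) (at t)"
proof -
  consider "t > 0" | "t < 0" | "t = 0" by linarith
  then show ?thesis
  proof cases
    case 1
    have "((\<lambda>t. inverse t ^ n * exp (- inverse t)) has_real_derivative
        (inverse t ^ n * (exp (- inverse t) * (inverse t * inverse t))
         - (real n * inverse t ^ (n - 1) * (inverse t * inverse t)) * exp (- inverse t))) (at t)"
      using 1 by (auto intro!: derivative_eq_intros simp: power2_eq_square)
    also have "inverse t ^ n * (exp (- inverse t) * (inverse t * inverse t))
         - (real n * inverse t ^ (n - 1) * (inverse t * inverse t)) * exp (- inverse t)
        = flat_exp (n + 2) t - real n * flat_exp (n + 1) t"
      using 1 by (cases n) (auto simp: flat_exp_def field_simps)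
    finally show ?thesis
      by (rule has_field_derivative_transform_within_open[of _ _ _ "{0<..}"])
        (use 1 in \<open>auto simp: flat_exp_def\<close>)
  next
    case 2
    have "((\<lambda>_. 0) has_real_derivative 0) (at t)" by simp
    then have "(flat_exp n has_real_derivative 0) (at t)"
      by (rule has_field_derivative_transform_within_open[of _ _ _ "{..<0}"])
        (use 2 in \<open>auto simp: flat_exp_def\<close>)
    then show ?thesis using 2 by (simp add: flat_exp_def)
  next
    case 3
    have "(flat_exp n (0 + h) - flat_exp n 0) / h = flat_exp (n + 1) h" for h
      by (simp add: flat_exp_def field_simps)
    then have "(flat_exp n has_real_derivative 0) (at 0)"
      unfolding DERIV_def using flat_exp_tendsto_0[of "n + 1"] by simp
    then show ?thesis using 3 by (simp add: flat_exp_def)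
  qed
qed

lemma Cn_on_flat_exp: "Cn_on k UNIV (flat_exp n)"
proof (induction k arbitrary: n)
  case 0
  show ?case using flat_exp_derivative by (auto intro!: DERIV_continuous_on)
next
  case (Suc k)
  have "(flat_exp n has_derivative (\<lambda>h. (flat_exp (n + 2) t - real n * flat_exp (n + 1) t) * h)) (at t)" for t
    using flat_exp_derivative[of n t] by (simp add: has_field_derivative_def)
  moreover have "Cn_on k UNIV (\<lambda>t. (flat_exp (n + 2) t - real n * flat_exp (n + 1) t) * h)" for h
    using Cn_on_mult[OF Cn_on_add[OF Suc[of "n + 2"] Cn_on_mult[OF Cn_on_const[of k UNIV "- real n"] Suc[of "n + 1"]]]
      Cn_on_const[of k UNIV h]] by simp
  ultimately show ?case by (intro Cn_on_SucI)
qed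

lemma (in finite_basis) bump_function:
  assumes "r > 0"
  obtains \<rho> :: "'e \<Rightarrow> real" where "Cinf_on UNIV \<rho>" "\<rho> p > 0" "\<And>x. \<rho> x \<ge> 0"
    "\<And>x. x \<notin> ball p r \<Longrightarrow> \<rho> x = 0"
proof -
  define N where "N = (\<Sum>b\<in>B. norm b) + 1"
  have N: "N > 0" by (simp add: N_def add_nonneg_pos sum_nonneg)
  define s where "s = r / N"
  have s: "s > 0" using assms N by (simp add: s_def)
  define q where "q = (\<lambda>x. \<Sum>b\<in>B. (coord b x - coord b p) * (coord b x - coord b p))"
  define \<rho> where "\<rho> = (\<lambda>x. flat_exp 0 (s\<^sup>2 - q x))"
  have q: "Cn_on k UNIV q" for k
    unfolding q_def diff_conv_add_uminus
    by (intro Cn_on_sum Cn_on_mult Cn_on_add Cn_on_bounded_linear[OF bounded_linear_coord] Cn_on_const)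
  have "Cn_on k UNIV (\<lambda>x. s\<^sup>2 + - q x)" for k
    by (intro Cn_on_add Cn_on_const Cn_on_minus q)
  then have "Cn_on k UNIV \<rho>" for k
    unfolding \<rho>_def by (intro real_line.Cn_on_compose[OF Cn_on_flat_exp]) auto
  then have "Cinf_on UNIV \<rho>" by (simp add: Cinf_on_def)
  moreover have "\<rho> p > 0" using s by (simp add: \<rho>_def q_def flat_exp_def)
  moreover have "\<rho> x \<ge> 0" for x by (simp add: \<rho>_def flat_exp_def)
  moreover have "\<rho> x = 0" if x: "x \<notin> ball p r" for x
  proof (rule ccontr)
    assume "\<rho> x \<noteq> 0"
    then have qs: "q x < s\<^sup>2" by (auto simp: \<rho>_def flat_exp_def split: if_splits)
    have le: "\<bar>coord b (x - p)\<bar> \<le> s" if b: "b \<in> B" for b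
    proof -
      have "(coord b x - coord b p) * (coord b x - coord b p) \<le> q x"
        unfolding q_def using b finite_B by (intro member_le_sum) auto
      then have "(coord b (x - p))\<^sup>2 \<le> s\<^sup>2"
        using qs coord_add[of b "x - p" p] by (simp add: power2_eq_square)
      then show ?thesis using s by (simp add: abs_le_square_iff[symmetric])
    qed
    have "norm (x - p) = norm (\<Sum>b\<in>B. coord b (x - p) *\<^sub>R b)" by (simp add: coord_sum)
    also have "\<dots> \<le> (\<Sum>b\<in>B. s * norm b)"
      by (rule order.trans[OF norm_sum sum_mono]) (use le in \<open>auto intro: mult_right_mono\<close>)
    also have "\<dots> = s * (N - 1)" by (simp add: N_def sum_distrib_left)
    also have "\<dots> < s * N" using s by simp
    also have "\<dots> = r" using N by (simp add: s_def)
    finally show False using x by (simp add: dist_norm norm_minus_commute)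
  qed
  ultimately show ?thesis using that by blast
qed

section \<open>Seeley's coefficients\<close>

text \<open>
  These are the coefficients of the entire function \<open>\<Prod>j\<ge>1. (1 - z / 2 ^ j)\<close>, which vanishes precisely
  at the points \<open>2 ^ r\<close> with \<open>r \<ge> 1\<close>.  Up to normalisation they are the weights of Seeley's extension.
\<close>

primrec euler_coeff :: "nat \<Rightarrow> real" where
  "euler_coeff 0 = 1"
| "euler_coeff (Suc k) = - euler_coeff k / (2 ^ Suc k - 1)"

lemma summable_euler_coeff: "summable (\<lambda>k. \<bar>euler_coeff k\<bar> * (2 ^ r) ^ k)"
proof (rule summable_ratio_test[of "1/2" "r + 1"])
  fix k assume k: "r + 1 \<le> k"
  have "(2::real) ^ Suc r \<le> 2 ^ k" using k by (intro power_increasing) auto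
  then have *: "2 * 2 ^ r \<le> 2 ^ Suc k - (1::real)"
    using one_le_power[of "2::real" k, OF one_le_numeral] unfolding power_Suc by linarith
  have pos: "(2::real) ^ Suc k - 1 > 0" using * by (smt (verit) zero_less_power)
  have "\<bar>euler_coeff (Suc k)\<bar> * (2 ^ r) ^ Suc k
      = (\<bar>euler_coeff k\<bar> * (2 ^ r) ^ k) * (2 ^ r / (2 ^ Suc k - 1))"
    using pos by (simp add: abs_divide del: power_Suc) (simp add: power_Suc[of "2 ^ r"])
  also have "\<dots> \<le> (\<bar>euler_coeff k\<bar> * (2 ^ r) ^ k) * (1/2)"
    using pos * by (intro mult_left_mono) (auto simp: divide_le_eq)
  finally show "norm (\<bar>euler_coeff (Suc k)\<bar> * (2 ^ r) ^ Suc k) \<le> 1/2 * norm (\<bar>euler_coeff k\<bar> * (2 ^ r) ^ k)"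
    by (simp add: abs_mult mult.commute)
qed simp

lemma summable_euler_powser: "summable (\<lambda>k. euler_coeff k * x ^ k)"
proof -
  obtain r :: nat where "\<bar>x\<bar> < 2 ^ r" using real_arch_pow[of 2 "\<bar>x\<bar>"] by auto
  then show ?thesis
    by (intro summable_comparison_test'[OF summable_euler_coeff[of r], of 0])
      (auto simp: abs_mult power_abs intro!: mult_left_mono power_mono)
qed

lemma euler_powser_double:
  "(\<Sum>k. euler_coeff k * (2 * x) ^ k) = (1 - x) * (\<Sum>k. euler_coeff k * x ^ k)"
proof -
  let ?g = "\<lambda>x. \<Sum>k. euler_coeff k * x ^ k"
  have "?g (2 * x) - ?g x = (\<Sum>k. euler_coeff k * (2 * x) ^ k - euler_coeff k * x ^ k)"
    by (rule suminf_diff[OF summable_euler_powser summable_euler_powser])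
  also have "\<dots> = (\<Sum>k. euler_coeff (Suc k) * (2 * x) ^ Suc k - euler_coeff (Suc k) * x ^ Suc k)"
    using suminf_split_head[OF summable_diff[OF summable_euler_powser[of "2 * x"] summable_euler_powser[of x]]] by simp
  also have "\<dots> = (\<Sum>k. - x * (euler_coeff k * x ^ k))"
  proof (rule suminf_cong)
    fix k
    have "(2::real) ^ Suc k - 1 > 0" by (simp add: one_less_power del: power_Suc)
    then have "euler_coeff (Suc k) * (2 ^ Suc k - 1) = - euler_coeff k" by simp
    then have "euler_coeff (Suc k) * (2 ^ Suc k - 1) * x ^ Suc k = - x * (euler_coeff k * x ^ k)" by simp
    then show "euler_coeff (Suc k) * (2 * x) ^ Suc k - euler_coeff (Suc k) * x ^ Suc k
        = - x * (euler_coeff k * x ^ k)"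
      by (simp only: power_mult_distrib) (simp only: algebra_simps)
  qed
  also have "\<dots> = - x * ?g x" by (rule suminf_mult[OF summable_euler_powser])
  finally show ?thesis by (simp add: algebra_simps)
qed

text \<open>
  The functional equation propagates the zero at \<open>2\<close> to all higher powers of two.  It also shows that
  a zero at \<open>1\<close> would propagate to the points \<open>2 powr (- n)\<close>, which contradicts the value \<open>1\<close> at \<open>0\<close>.
\<close>

lemma seeley_coefficients:
  obtains a :: "nat \<Rightarrow> real" where "\<And>r. summable (\<lambda>i. \<bar>a i\<bar> * (2 ^ r) ^ i)"
    "\<And>r. (\<Sum>i. a i * (2 ^ r) ^ i) = (if r = 0 then 1 else 0)"
proof -
  define g where "g = (\<lambda>x. \<Sum>k. euler_coeff k * x ^ k)"
  have dbl: "g (2 * x) = (1 - x) * g x" for x unfolding g_def by (rule euler_powser_double)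
  have zero: "g (2 ^ Suc r) = 0" for r
    by (induction r) (use dbl[of 1] dbl[of "2 ^ Suc r" for r] in auto)
  have "g 1 \<noteq> 0"
  proof
    assume g1: "g 1 = 0"
    have z: "g ((1/2) ^ n) = 0" for n
    proof (induction n)
      case (Suc n)
      have "(1 - (1/2) ^ Suc n) * g ((1/2) ^ Suc n) = 0" using dbl[of "(1/2) ^ Suc n"] Suc by simp
      moreover have "(1/2::real) ^ Suc n < 1" by (rule power_Suc_less_one) auto
      ultimately show ?case by auto
    qed (simp add: g1)
    have "isCont g 0" unfolding g_def by (rule isCont_powser[OF summable_euler_powser[of 1]]) simp
    then have "(\<lambda>n. g ((1/2) ^ n)) \<longlonglongrightarrow> g 0"
      by (rule isCont_tendsto_compose) (rule LIMSEQ_realpow_zero, auto)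
    then have "g 0 = 0" using z by (simp add: LIMSEQ_const_iff)
    then show False by (simp add: g_def)
  qed
  define a where "a = (\<lambda>i. euler_coeff i / g 1)"
  have "summable (\<lambda>i. \<bar>a i\<bar> * (2 ^ r) ^ i)" for r
    using summable_divide[OF summable_euler_coeff[of r], of "\<bar>g 1\<bar>"] by (simp add: a_def abs_divide)
  moreover have "(\<Sum>i. a i * (2 ^ r) ^ i) = (if r = 0 then 1 else 0)" for r
  proof -
    have "(\<Sum>i. a i * (2 ^ r) ^ i) = g (2 ^ r) / g 1"
      using suminf_divide[OF summable_euler_powser[of "2 ^ r"], of "g 1"] by (simp add: a_def g_def)
    then show ?thesis using zero[of "r - 1"] \<open>g 1 \<noteq> 0\<close> by (cases r) auto
  qed
  ultimately show ?thesis using that by blast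
qed

section \<open>Extending smooth functions across the faces of a polytope\<close>

text \<open>
  Seeley's reflection evaluates a function and its derivatives arbitrarily far away; boundedness
  makes the series converge uniformly.
\<close>

primrec bCn_on :: "nat \<Rightarrow> 'a::real_normed_vector set \<Rightarrow> ('a \<Rightarrow> real) \<Rightarrow> bool" where
  "bCn_on 0 S f \<longleftrightarrow> continuous_on S f \<and> bounded (f ` S)"
| "bCn_on (Suc k) S f \<longleftrightarrow> bounded (f ` S) \<and> (\<exists>D. (\<forall>x\<in>S. (f has_derivative D x) (at x within S)) \<and>
     (\<forall>h. bCn_on k S (\<lambda>x. D x h)))"

lemma bCn_on_SucI:
  "bounded (f ` S) \<Longrightarrow> (\<And>x. x \<in> S \<Longrightarrow> (f has_derivative D x) (at x within S)) \<Longrightarrow>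
    (\<And>h. bCn_on k S (\<lambda>x. D x h)) \<Longrightarrow> bCn_on (Suc k) S f"
  by auto

lemma bCn_on_imp_Cn_on: "bCn_on k S f \<Longrightarrow> Cn_on k S f"
  by (induction k arbitrary: f) auto

lemma bCn_on_bounded: "bCn_on k S f \<Longrightarrow> bounded (f ` S)"
  by (cases k) auto

lemma bounded_image_iff: "bounded (f ` S) \<longleftrightarrow> (\<exists>K. \<forall>x\<in>S. norm (f x) \<le> K)"
  by (auto simp: bounded_iff)

lemma bCn_on_add: "bCn_on k S f \<Longrightarrow> bCn_on k S g \<Longrightarrow> bCn_on k S (\<lambda>x. f x + g x)"
proof (induction k arbitrary: f g)
  case 0
  then show ?case using bounded_plus_comp[of f S g] by (auto intro: continuous_on_add)
next
  case (Suc k)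
  from Suc.prems(1) obtain D where D: "\<And>x. x \<in> S \<Longrightarrow> (f has_derivative D x) (at x within S)"
    "\<And>h. bCn_on k S (\<lambda>x. D x h)" unfolding bCn_on.simps by blast
  from Suc.prems(2) obtain E where E: "\<And>x. x \<in> S \<Longrightarrow> (g has_derivative E x) (at x within S)"
    "\<And>h. bCn_on k S (\<lambda>x. E x h)" unfolding bCn_on.simps by blast
  have "bounded ((\<lambda>x. f x + g x) ` S)"
    using Suc.prems bounded_plus_comp[of f S g] by simp
  then show ?case by (rule bCn_on_SucI[OF _ has_derivative_add[OF D(1) E(1)] Suc.IH[OF D(2) E(2)]])
qed

lemma bCn_on_cmult: "bCn_on k S f \<Longrightarrow> bCn_on k S (\<lambda>x. c * f x)"
proof (induction k arbitrary: f)
  case 0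
  then show ?case using bounded_scaleR_comp[of f S c] by (auto intro: continuous_on_mult_left)
next
  case (Suc k)
  from Suc.prems(1) obtain D where D: "\<And>x. x \<in> S \<Longrightarrow> (f has_derivative D x) (at x within S)"
    "\<And>h. bCn_on k S (\<lambda>x. D x h)" unfolding bCn_on.simps by blast
  have "bounded ((\<lambda>x. c * f x) ` S)"
    using Suc.prems bounded_scaleR_comp[of f S c] by simp
  then show ?case by (rule bCn_on_SucI[OF _ has_derivative_mult_right[OF D(1)] Suc.IH[OF D(2)]])
qed

lemma has_derivative_within_Un:
  assumes "(f has_derivative D) (at x within S)" "(f has_derivative D) (at x within T)"
  shows "(f has_derivative D) (at x within S \<union> T)"
  unfolding has_derivative_within_alt
proof (intro conjI allI impI)
  show "bounded_linear D" using assms(1) by (rule has_derivative_bounded_linear)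
  fix e :: real assume e: "e > 0"
  obtain d1 where d1: "d1 > 0" "\<forall>y\<in>S. norm (y - x) < d1 \<longrightarrow> norm (f y - f x - D (y - x)) \<le> e * norm (y - x)"
    using assms(1) e unfolding has_derivative_within_alt by blast
  obtain d2 where d2: "d2 > 0" "\<forall>y\<in>T. norm (y - x) < d2 \<longrightarrow> norm (f y - f x - D (y - x)) \<le> e * norm (y - x)"
    using assms(2) e unfolding has_derivative_within_alt by blast
  show "\<exists>d>0. \<forall>y\<in>S \<union> T. norm (y - x) < d \<longrightarrow> norm (f y - f x - D (y - x)) \<le> e * norm (y - x)"
    using d1 d2 by (intro exI[of _ "min d1 d2"]) auto
qed

text \<open>
  Away from \<open>S\<close> every bounded linear map is a derivative within \<open>S\<close>; together with the preceding lemma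
  this allows to treat closed pieces of a domain separately.
\<close>

lemma has_derivative_within_empty_nhd:
  assumes "bounded_linear D" "open G" "x \<in> G" "S \<inter> G = {}"
  shows "(f has_derivative D) (at x within S)"
  unfolding has_derivative_within_open_Int[OF assms(2,3), of f D S, symmetric]
  unfolding assms(4) has_derivative_within_alt using assms(1) by (auto intro!: exI[of _ 1])

lemma has_derivative_series_bounded:
  fixes f :: "nat \<Rightarrow> 'a::real_normed_vector \<Rightarrow> real"
  assumes S: "convex S" and der: "\<And>n x. x \<in> S \<Longrightarrow> (f n has_derivative f' n x) (at x within S)"
    and bnd: "\<And>n x h. x \<in> S \<Longrightarrow> \<bar>f' n x h\<bar> \<le> M n * norm h" and M: "summable M"
    and summ: "\<And>x. x \<in> S \<Longrightarrow> summable (\<lambda>n. f n x)" and x: "x \<in> S"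
  shows "((\<lambda>x. \<Sum>n. f n x) has_derivative (\<lambda>h. \<Sum>n. f' n x h)) (at x within S)"
proof -
  let ?A = "{(x, h). x \<in> S \<and> h \<noteq> 0}"
  have sum': "summable (\<lambda>n. f' n x h)" if "x \<in> S" for x h
    by (rule summable_comparison_test'[OF summable_mult2[OF M, of "norm h"], of 0])
      (use bnd that in auto)
  have "uniform_limit ?A (\<lambda>n p. \<Sum>i<n. f' i (fst p) (snd p) / norm (snd p))
      (\<lambda>p. \<Sum>i. f' i (fst p) (snd p) / norm (snd p)) sequentially"
    by (rule Weierstrass_m_test[OF _ M]) (use bnd in \<open>auto simp: divide_le_eq\<close>)
  then have unif: "\<forall>\<^sub>F n in sequentially. \<forall>p\<in>?A. dist (\<Sum>i<n. f' i (fst p) (snd p) / norm (snd p))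
      (\<Sum>i. f' i (fst p) (snd p) / norm (snd p)) < e" if "e > 0" for e
    using that by (auto simp: uniform_limit_iff)
  have ev: "\<forall>\<^sub>F n in sequentially. \<forall>x\<in>S. \<forall>h.
      norm (sum (\<lambda>i. f' i x h) {..<n} - (\<Sum>i. f' i x h)) \<le> e * norm h" if e: "e > 0" for e
    using unif[OF e]
  proof eventually_elim
    case (elim n)
    show ?case
    proof (intro ballI allI)
      fix x h assume x: "x \<in> S"
      show "norm (sum (\<lambda>i. f' i x h) {..<n} - (\<Sum>i. f' i x h)) \<le> e * norm h"
      proof (cases "h = 0")
        case True
        have "f' i x h = 0" for i using bnd[OF x, of i h] True by simp
        then show ?thesis using True by simp
      next
        case False
        then have "dist (\<Sum>i<n. f' i x h / norm h) (\<Sum>i. f' i x h / norm h) < e"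
          using elim x by auto
        moreover have "(\<Sum>i<n. f' i x h / norm h) - (\<Sum>i. f' i x h / norm h)
            = (sum (\<lambda>i. f' i x h) {..<n} - (\<Sum>i. f' i x h)) / norm h"
          using suminf_divide[OF sum'[OF x, of h], of "norm h"]
          by (simp add: sum_divide_distrib diff_divide_distrib)
        ultimately have "norm (sum (\<lambda>i. f' i x h) {..<n} - (\<Sum>i. f' i x h)) / norm h < e"
          by (simp add: dist_norm abs_divide)
        then show ?thesis using False by (simp add: divide_less_eq)
      qed
    qed
  qed
  obtain g where g: "\<And>x. x \<in> S \<Longrightarrow> (\<lambda>n. f n x) sums g x"
    "\<And>x. x \<in> S \<Longrightarrow> (g has_derivative (\<lambda>h. \<Sum>n. f' n x h)) (at x within S)"
    using has_derivative_series[OF S der ev x summable_sums[OF summ[OF x]]] by blast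
  show ?thesis
    by (rule has_derivative_transform[OF x _ g(2)[OF x]]) (use g(1) in \<open>simp add: sums_iff\<close>)
qed

lemma (in finite_basis) bounded_derivative_uniform:
  fixes D :: "'e \<Rightarrow> 'e \<Rightarrow> real"
  assumes linD: "\<And>y. y \<in> C \<Longrightarrow> linear (D y)" and bD: "\<And>h. bounded ((\<lambda>x. D x h) ` C)"
  shows "\<exists>K\<ge>0. \<forall>y\<in>C. \<forall>h. \<bar>D y h\<bar> \<le> K * norm h"
proof -
  obtain k where k: "\<And>b y. y \<in> C \<Longrightarrow> \<bar>D y b\<bar> \<le> k b"
    using bD unfolding bounded_image_iff real_norm_def by metis
  obtain c where c: "c > 0" "\<And>x. \<forall>b\<in>B. \<bar>coord b x\<bar> \<le> c * norm x" using coord_abs_bound by blast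
  have "\<bar>D y h\<bar> \<le> (\<Sum>b\<in>B. c * \<bar>k b\<bar>) * norm h" if y: "y \<in> C" for y h
  proof -
    have "\<bar>D y h\<bar> = \<bar>\<Sum>b\<in>B. coord b h *\<^sub>R D y b\<bar>" using linear_expand[OF linD[OF y], of h] by (simp only:)
    also have "\<dots> \<le> (\<Sum>b\<in>B. \<bar>coord b h *\<^sub>R D y b\<bar>)" by (rule sum_abs)
    also have "\<dots> \<le> (\<Sum>b\<in>B. (c * norm h) * \<bar>k b\<bar>)"
      using c k[OF y] by (intro sum_mono) (auto simp: abs_mult intro!: mult_mono intro: order.trans[OF _ abs_ge_self])
    finally show ?thesis by (simp add: sum_distrib_left sum_distrib_right mult_ac)
  qed
  moreover have "0 \<le> (\<Sum>b\<in>B. c * \<bar>k b\<bar>)" using c(1) by (intro sum_nonneg) simp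
  ultimately show ?thesis by blast
qed

text \<open>
  Seeley's reflection across the hyperplane through \<open>p\<close> on which \<open>l\<close> is constant, along the direction
  \<open>v\<close>.  On the side \<open>l (x - p) \<le> 0\<close> no point is moved and the sum is \<open>g x\<close> times the sum of the weights.
  The parameter \<open>r\<close> accounts for the powers of \<open>2 ^ i\<close> which differentiation produces; weighted with
  them, the moments vanish, and this makes the derivatives from both sides agree.
\<close>

definition reflect ::
    "(nat \<Rightarrow> real) \<Rightarrow> ('e::real_normed_vector \<Rightarrow> real) \<Rightarrow> 'e \<Rightarrow> 'e \<Rightarrow> nat \<Rightarrow> ('e \<Rightarrow> real) \<Rightarrow> 'e \<Rightarrow> real" where
  "reflect a l p v r g x =
     (\<Sum>i. a i * (2 ^ r) ^ i * g (x + (2 ^ i * max (l (x - p)) 0) *\<^sub>R v))"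

text \<open>
  As \<open>2 ^ i \<ge> 1\<close> and \<open>l v = -1\<close>, the points at which the reflection evaluates \<open>g\<close> satisfy \<open>l (x - p) \<le> 0\<close>;
  they stay in \<open>C'\<close>, since \<open>v\<close> points into \<open>C'\<close>.
\<close>

locale seeley = finite_basis B for B :: "'e::real_normed_vector set" +
  fixes a :: "nat \<Rightarrow> real" and l :: "'e \<Rightarrow> real" and p v :: 'e and C' C :: "'e set"
  assumes abs_summable: "\<And>r. summable (\<lambda>i. \<bar>a i\<bar> * (2 ^ r) ^ i)"
    and moments: "\<And>r. (\<Sum>i. a i * (2 ^ r) ^ i) = (if r = 0 then 1 else 0)"
    and l: "bounded_linear l" and lv: "l v = -1"
    and C': "convex C'" "\<And>x t. x \<in> C' \<Longrightarrow> t \<ge> 0 \<Longrightarrow> x + t *\<^sub>R v \<in> C'"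
    and C: "C = {x \<in> C'. l (x - p) \<le> 0}"
begin

abbreviation "E \<equiv> reflect a l p v"

lemma shift_in_C: "x \<in> C' \<Longrightarrow> x + (2 ^ i * max (l (x - p)) 0) *\<^sub>R v \<in> C"
proof -
  assume x: "x \<in> C'"
  interpret l: bounded_linear l by (rule l)
  have "max (l (x - p)) 0 * 1 \<le> max (l (x - p)) 0 * 2 ^ i"
    by (intro mult_left_mono) auto
  then have "l (x - p) \<le> 2 ^ i * max (l (x - p)) 0" by (simp add: mult.commute)
  then have "l (x + (2 ^ i * max (l (x - p)) 0) *\<^sub>R v - p) \<le> 0"
    by (simp add: l.add l.diff l.scaleR lv)
  then show ?thesis using C'(2)[OF x] by (simp add: C)
qed

lemma term_bound:
  assumes "\<And>y. y \<in> C \<Longrightarrow> \<bar>g y\<bar> \<le> K" "x \<in> C'"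
  shows "\<bar>a i * (2 ^ r) ^ i * g (x + (2 ^ i * max (l (x - p)) 0) *\<^sub>R v)\<bar> \<le> \<bar>a i\<bar> * (2 ^ r) ^ i * K"
  using assms(1)[OF shift_in_C[OF assms(2)]] by (simp add: abs_mult mult_left_mono)

lemma summable_terms:
  assumes "\<And>y. y \<in> C \<Longrightarrow> \<bar>g y\<bar> \<le> K" "x \<in> C'"
  shows "summable (\<lambda>i. a i * (2 ^ r) ^ i * g (x + (2 ^ i * max (l (x - p)) 0) *\<^sub>R v))"
  by (rule summable_comparison_test'[OF summable_mult2[OF abs_summable[of r], of K], of 0])
    (use term_bound[OF assms] in auto)

lemma E_on_C:
  assumes "x \<in> C" shows "E r g x = (if r = 0 then g x else 0)"
proof -
  have "summable (\<lambda>i. a i * (2 ^ r) ^ i)"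
    by (rule summable_comparison_test'[OF abs_summable[of r], of 0]) (simp add: abs_mult)
  then have "E r g x = (\<Sum>i. a i * (2 ^ r) ^ i) * g x"
    using assms unfolding reflect_def by (simp add: C max_def suminf_mult2)
  then show ?thesis by (simp add: moments)
qed

lemma E_bounded:
  assumes "bounded (g ` C)" shows "bounded (E r g ` C')"
proof -
  obtain K where K: "\<And>y. y \<in> C \<Longrightarrow> \<bar>g y\<bar> \<le> K" using assms by (auto simp: bounded_image_iff)
  have "\<bar>E r g x\<bar> \<le> (\<Sum>i. \<bar>a i\<bar> * (2 ^ r) ^ i * K)" if "x \<in> C'" for x
  proof -
    let ?f = "\<lambda>i. a i * (2 ^ r) ^ i * g (x + (2 ^ i * max (l (x - p)) 0) *\<^sub>R v)"
    note M = summable_mult2[OF abs_summable[of r], of K]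
    have s: "summable (\<lambda>i. \<bar>?f i\<bar>)"
      by (rule summable_comparison_test'[OF M, of 0]) (use term_bound[OF K that] in auto)
    show ?thesis unfolding reflect_def
    proof (rule order.trans[OF summable_rabs[OF s]])
      show "(\<Sum>i. \<bar>?f i\<bar>) \<le> (\<Sum>i. \<bar>a i\<bar> * (2 ^ r) ^ i * K)"
        by (rule suminf_le[OF _ s M]) (rule term_bound[OF K that])
    qed
  qed
  then show ?thesis by (auto simp: bounded_image_iff)
qed

lemma E_continuous:
  assumes "continuous_on C g" "bounded (g ` C)" shows "continuous_on C' (E r g)"
proof -
  interpret l: bounded_linear l by (rule l)
  obtain K where K: "\<And>y. y \<in> C \<Longrightarrow> \<bar>g y\<bar> \<le> K" using assms by (auto simp: bounded_image_iff)
  have lim: "uniform_limit C' (\<lambda>n x. \<Sum>i<n. a i * (2 ^ r) ^ i * g (x + (2 ^ i * max (l (x - p)) 0) *\<^sub>R v))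
      (E r g) sequentially"
    unfolding reflect_def
    by (rule Weierstrass_m_test[OF _ summable_mult2[OF abs_summable[of r], of K]])
      (use term_bound[OF K] in auto)
  have "continuous_on C' (\<lambda>x. \<Sum>i<n. a i * (2 ^ r) ^ i * g (x + (2 ^ i * max (l (x - p)) 0) *\<^sub>R v))" for n
  proof (intro continuous_on_sum continuous_on_mult continuous_on_const)
    show "continuous_on C' (\<lambda>x. g (x + (2 ^ i * max (l (x - p)) 0) *\<^sub>R v))" for i
      by (rule continuous_on_compose2[OF assms(1)])
        (use shift_in_C in \<open>auto intro!: continuous_intros l.continuous_on\<close>)
  qed
  then show ?thesis by (intro uniform_limit_theorem[OF _ lim]) auto
qed

text \<open>
  The differential of the extension is an expression of the same kind, in which a derivative in the
  direction \<open>v\<close> comes with weights multiplied by the additional factor \<open>2 ^ i\<close>.  It is computed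
  separately on both sides of the hyperplane, where the points of evaluation depend on \<open>x\<close> affinely;
  at the hyperplane both results agree.
\<close>

lemma E_derivative:
  assumes der: "\<And>x. x \<in> C \<Longrightarrow> (g has_derivative D x) (at x within C)"
    and bg: "bounded (g ` C)" and bD: "\<And>h. bounded ((\<lambda>x. D x h) ` C)" and x: "x \<in> C'"
  shows "(E r g has_derivative (\<lambda>h. E r (\<lambda>x. D x h) x + l h * E (Suc r) (\<lambda>x. D x v) x)) (at x within C')"
    (is "(_ has_derivative ?D x) _")
proof -
  interpret l: bounded_linear l by (rule l)
  obtain K where K: "\<And>y. y \<in> C \<Longrightarrow> \<bar>g y\<bar> \<le> K" using bg by (auto simp: bounded_image_iff)
  have linD: "linear (D y)" if "y \<in> C" for y using der[OF that] by (rule has_derivative_linear)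
  obtain KD where KD: "KD \<ge> 0" "\<And>y h. y \<in> C \<Longrightarrow> \<bar>D y h\<bar> \<le> KD * norm h"
    using bounded_derivative_uniform[OF linD bD] by blast
  obtain c where c: "\<And>h. \<bar>l h\<bar> \<le> c * norm h" "c \<ge> 0"
    using l.nonneg_bounded by (auto simp: mult.commute)
  have KDh: "\<And>y. y \<in> C \<Longrightarrow> \<bar>D y h\<bar> \<le> KD * norm h" for h using KD by blast
  define C2 where "C2 = {x \<in> C'. l (x - p) \<ge> 0}"
  have CC2: "C' = C \<union> C2" by (auto simp: C C2_def)
  have on_C: "(E r g has_derivative ?D x) (at x within C)" if x: "x \<in> C" for x
  proof (cases "r = 0")
    case True
    have "(E r g has_derivative D x) (at x within C)"
      by (rule has_derivative_transform[OF x _ der[OF x]]) (simp add: E_on_C True)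
    then show ?thesis using x True by (simp add: E_on_C)
  next
    case False
    have "(E r g has_derivative (\<lambda>_. 0)) (at x within C)"
      by (rule has_derivative_transform[OF x _ has_derivative_const[of 0]]) (simp add: E_on_C False)
    then show ?thesis using x False by (simp add: E_on_C)
  qed
  have on_C2: "(E r g has_derivative ?D x) (at x within C2)" if x: "x \<in> C2" for x
  proof -
    have convC2: "convex C2"
    proof -
      have "C2 = C' \<inter> (\<lambda>x. l x) -` {l p..}" by (auto simp: C2_def l.diff)
      moreover have "convex (l -` {l p..})"
        by (intro convex_linear_vimage l.linear_axioms) auto
      ultimately show ?thesis using C'(1) by (simp add: convex_Int)
    qed
    let ?s = "\<lambda>i x. x + (2 ^ i * l (x - p)) *\<^sub>R v"
    define f where "f = (\<lambda>i x. a i * (2 ^ r) ^ i * g (?s i x))"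
    define f' where "f' = (\<lambda>i x h. a i * (2 ^ r) ^ i * D (?s i x) (h + (2 ^ i * l h) *\<^sub>R v))"
    have mx: "max (l (x - p)) 0 = l (x - p)" if "x \<in> C2" for x
      using that by (simp add: C2_def)
    have s: "?s i x \<in> C" if "x \<in> C2" for i x
      using shift_in_C[of x i] that mx[OF that] by (simp add: C2_def)
    have Ef: "E r g x = (\<Sum>i. f i x)" if "x \<in> C2" for x
      unfolding f_def reflect_def mx[OF that] ..
    have der_f: "(f i has_derivative f' i x) (at x within C2)" if x: "x \<in> C2" for i x
    proof -
      have "(?s i has_derivative (\<lambda>h. h + (2 ^ i * l h) *\<^sub>R v)) (at x within C2)"
        by (auto intro!: derivative_eq_intros l.has_derivative simp: l.diff)
      moreover have "(g has_derivative D (?s i x)) (at (?s i x) within ?s i ` C2)"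
        by (rule has_derivative_subset[OF der[OF s[OF x]]]) (use s in blast)
      ultimately have "((\<lambda>x. g (?s i x)) has_derivative (\<lambda>h. D (?s i x) (h + (2 ^ i * l h) *\<^sub>R v))) (at x within C2)"
        by (rule has_derivative_in_compose)
      then show ?thesis unfolding f_def f'_def by (rule has_derivative_mult_right)
    qed
    define M where "M = (\<lambda>i. \<bar>a i\<bar> * (2 ^ r) ^ i * KD + \<bar>a i\<bar> * (2 ^ Suc r) ^ i * (KD * c * norm v))"
    have bnd: "\<bar>f' i x h\<bar> \<le> M i * norm h" if x: "x \<in> C2" for i x h
    proof -
      have "norm (h + (2 ^ i * l h) *\<^sub>R v) \<le> norm h + 2 ^ i * (c * norm h) * norm v"
        using mult_right_mono[OF mult_left_mono[OF c(1)[of h], of "2 ^ i"], of "norm v"]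
        by (intro order.trans[OF norm_triangle_ineq] add_left_mono) (simp add: abs_mult)
      then have "\<bar>D (?s i x) (h + (2 ^ i * l h) *\<^sub>R v)\<bar> \<le> KD * (norm h + 2 ^ i * (c * norm h) * norm v)"
        using KD s[OF x] by (meson mult_left_mono order.trans)
      then have "\<bar>f' i x h\<bar> \<le> \<bar>a i\<bar> * (2 ^ r) ^ i * (KD * (norm h + 2 ^ i * (c * norm h) * norm v))"
        unfolding f'_def by (simp add: abs_mult mult_left_mono)
      also have "\<dots> = M i * norm h" by (simp add: M_def algebra_simps power_mult_distrib)
      finally show ?thesis .
    qed
    have "((\<lambda>x. \<Sum>i. f i x) has_derivative (\<lambda>h. \<Sum>i. f' i x h)) (at x within C2)"
    proof (rule has_derivative_series_bounded[OF convC2 der_f bnd])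
      show "summable M" unfolding M_def
        by (intro summable_add summable_mult2 abs_summable)
      show "summable (\<lambda>n. f n x)" if "x \<in> C2" for x
        using summable_terms[of g K x r, OF K] mx[OF that] that unfolding f_def by (simp add: C2_def)
    qed (use x in auto)
    moreover have "(\<lambda>h. \<Sum>i. f' i x h) = ?D x"
    proof
      fix h
      have "f' i x h = a i * (2 ^ r) ^ i * D (?s i x) h + l h * (a i * (2 ^ Suc r) ^ i * D (?s i x) v)" for i
        using linD[OF s[OF x, of i]]
        by (simp add: f'_def linear_add linear_cmul algebra_simps power_mult_distrib)
      moreover have xC': "x \<in> C'" using x by (simp add: C2_def)
      note s1 = summable_terms[of "\<lambda>y. D y h" "KD * norm h" x r, OF KDh xC', unfolded mx[OF x]]
        and s2 = summable_terms[of "\<lambda>y. D y v" "KD * norm v" x "Suc r", OF KDh xC', unfolded mx[OF x]]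
      ultimately show "(\<Sum>i. f' i x h) = ?D x h" unfolding reflect_def mx[OF x]
        using suminf_add[OF s1 summable_mult[OF s2, of "l h"]] suminf_mult[OF s2, of "l h"] by simp
    qed
    ultimately have "((\<lambda>x. \<Sum>i. f i x) has_derivative ?D x) (at x within C2)" by (simp only:)
    then show ?thesis by (rule has_derivative_transform[OF x Ef, rotated])
  qed
  have blD: "bounded_linear (?D x)" if "x \<in> C'" for x
    using on_C on_C2 that CC2 has_derivative_bounded_linear by blast
  have cont: "continuous_on UNIV (\<lambda>y. l (y - p))" by (intro continuous_intros l.continuous_on)
  have openlt: "open {y. l (y - p) < 0}" "open {y. l (y - p) > 0}"
    by (intro open_Collect_less cont continuous_on_const)+
  have "(E r g has_derivative ?D x) (at x within C)"
  proof (cases "x \<in> C")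
    case False
    then show ?thesis using x C
      by (intro has_derivative_within_empty_nhd[OF blD openlt(2)]) auto
  qed (rule on_C)
  moreover have "(E r g has_derivative ?D x) (at x within C2)"
  proof (cases "x \<in> C2")
    case False
    then show ?thesis using x C2_def
      by (intro has_derivative_within_empty_nhd[OF blD openlt(1)]) auto
  qed (rule on_C2)
  ultimately show ?thesis unfolding CC2 by (rule has_derivative_within_Un)
qed

lemma E_bCn_on: "bCn_on k C g \<Longrightarrow> bCn_on k C' (E r g)"
proof (induction k arbitrary: r g)
  case 0
  then show ?case using E_continuous E_bounded by simp
next
  case (Suc k)
  from Suc.prems(1) obtain D where D: "\<And>x. x \<in> C \<Longrightarrow> (g has_derivative D x) (at x within C)"
    "\<And>h. bCn_on k C (\<lambda>x. D x h)" and bg: "bounded (g ` C)" unfolding bCn_on.simps by blast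
  have *: "bCn_on k C' (\<lambda>x. E r (\<lambda>x. D x h) x + l h * E (Suc r) (\<lambda>x. D x v) x)" for h
    by (intro bCn_on_add bCn_on_cmult Suc.IH D(2))
  show ?case
    by (rule bCn_on_SucI[OF E_bounded[OF bg] E_derivative[OF D(1) bg bCn_on_bounded[OF D(2)]] *])
qed

end

lemma convex_cone:
  fixes J :: "('v::real_normed_vector \<Rightarrow> real) set"
  assumes "\<And>l. l \<in> J \<Longrightarrow> bounded_linear l"
  shows "convex {x. \<forall>l\<in>J. l (x - p) \<le> 0}"
proof -
  have "{x. \<forall>l\<in>J. l (x - p) \<le> 0} = (\<Inter>l\<in>J. l -` {..l p})"
    using assms by (auto simp: bounded_linear.linear linear_diff)
  moreover have "convex (l -` {..l p})" if "l \<in> J" for l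
    using assms[OF that] by (intro convex_linear_vimage) (auto intro: bounded_linear.linear)
  ultimately show ?thesis by (simp add: convex_INT)
qed

context finite_basis begin

text \<open>
  The half-spaces are removed one at a time, by reflection along the common transversal \<open>v\<close>.
\<close>

lemma bCn_on_extend_cone:
  fixes J :: "('e \<Rightarrow> real) set"
  assumes "finite J" "\<And>l. l \<in> J \<Longrightarrow> bounded_linear l \<and> l v < 0"
    and "\<And>k. bCn_on k {x. \<forall>l\<in>J. l (x - p) \<le> 0} g"
  shows "\<exists>G. (\<forall>k. bCn_on k UNIV G) \<and> (\<forall>x. (\<forall>l\<in>J. l (x - p) \<le> 0) \<longrightarrow> G x = g x)"
  using assms
proof (induction J arbitrary: g rule: finite_induct)
  case empty
  then show ?case by auto
next
  case (insert l J)
  obtain a :: "nat \<Rightarrow> real" where a: "\<And>r. summable (\<lambda>i. \<bar>a i\<bar> * (2 ^ r) ^ i)"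
    "\<And>r. (\<Sum>i. a i * (2 ^ r) ^ i) = (if r = 0 then 1 else 0)" using seeley_coefficients by blast
  have l: "bounded_linear l" "l v < 0" using insert.prems(1) by auto
  define m where "m = (\<lambda>x. (1 / (- l v)) * l x)"
  define C' where "C' = {x. \<forall>l\<in>J. l (x - p) \<le> 0}"
  define C where "C = {x. \<forall>l\<in>insert l J. l (x - p) \<le> 0}"
  have msign: "m x \<le> 0 \<longleftrightarrow> l x \<le> 0" for x
    using l(2) by (auto simp: m_def zero_le_divide_iff divide_le_0_iff)
  have seel: "seeley B a m p v C' C"
  proof (intro seeley.intro seeley_axioms.intro finite_basis_axioms)
    show "bounded_linear m" unfolding m_def by (rule bounded_linear_const_mult[OF l(1)])
    show "m v = -1" using l(2) by (simp add: m_def)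
    show "convex C'"
      unfolding C'_def by (rule convex_cone) (use insert.prems(1) in blast)
    show "x + t *\<^sub>R v \<in> C'" if x: "x \<in> C'" and t: "t \<ge> 0" for x t
      unfolding C'_def
    proof (intro CollectI ballI)
      fix k assume k: "k \<in> J"
      then have "linear k" "k v < 0" using insert.prems(1) by (auto intro: bounded_linear.linear)
      then have "k (x + t *\<^sub>R v - p) = k (x - p) + t * k v"
        by (simp add: linear_add linear_diff linear_cmul)
      also have "\<dots> \<le> 0" using x k t \<open>k v < 0\<close> by (auto simp: C'_def intro!: add_nonpos_nonpos mult_nonneg_nonpos)
      finally show "k (x + t *\<^sub>R v - p) \<le> 0" .
    qed
    show "C = {x \<in> C'. m (x - p) \<le> 0}" by (auto simp: C_def C'_def msign)
  qed (use a in auto)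
  then interpret seeley B a m p v C' C .
  have "bCn_on k C' (E 0 g)" for k using E_bCn_on insert.prems(2) by (simp add: C_def)
  then obtain G where G: "\<And>k. bCn_on k UNIV G" "\<And>x. x \<in> C' \<Longrightarrow> G x = E 0 g x"
    using insert.IH[of "E 0 g"] insert.prems(1) by (auto simp: C'_def)
  have "G x = g x" if "x \<in> C" for x
    using G(2)[of x] E_on_C[OF that, of 0 g] that by (auto simp: C_def C'_def)
  then show ?case using G(1) by (auto simp: C_def)
qed

text \<open>
  The derivative has compact support, too, by uniqueness of derivatives.
\<close>

lemma Cn_on_compact_support_bounded:
  assumes C: "calculus_domain C" "closed C" and "\<And>x. x \<in> C \<Longrightarrow> x \<notin> cball p s \<Longrightarrow> h x = 0"
    and "Cn_on k (C::'e set) h"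
  shows "bCn_on k C h"
  using assms(3,4)
proof (induction k arbitrary: h)
  have bdd: "bounded (h ` C)" if "continuous_on C h" "\<And>x. x \<in> C \<Longrightarrow> x \<notin> cball p s \<Longrightarrow> h x = 0" for h :: "'e \<Rightarrow> real"
  proof -
    have "compact (C \<inter> cball p s)" by (rule closed_Int_compact[OF C(2) compact_cball_fd])
    then have "compact (h ` (C \<inter> cball p s))"
      by (rule compact_continuous_image[rotated]) (rule continuous_on_subset[OF that(1)], auto)
    then have "bounded (insert 0 (h ` (C \<inter> cball p s)))" by (simp add: compact_imp_bounded)
    moreover have "h ` C \<subseteq> insert 0 (h ` (C \<inter> cball p s))"
    proof (rule image_subsetI)
      fix x assume "x \<in> C"
      then show "h x \<in> insert 0 (h ` (C \<inter> cball p s))" using that(2)[of x] by blast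
    qed
    ultimately show ?thesis by (rule bounded_subset)
  qed
  {
    case 0
    then show ?case using bdd by simp
  next
    case (Suc k)
    from Suc.prems(2) obtain D where D: "\<And>x. x \<in> C \<Longrightarrow> (h has_derivative D x) (at x within C)"
      "\<And>h. Cn_on k C (\<lambda>x. D x h)" unfolding Cn_on.simps by blast
    have "D x u = 0" if x: "x \<in> C" "x \<notin> cball p s" for x u
    proof -
      have "((\<lambda>_. 0) has_derivative (\<lambda>_. 0)) (at x within C \<inter> - cball p s)" by simp
      then have "(h has_derivative (\<lambda>_. 0)) (at x within C \<inter> - cball p s)"
        by (rule has_derivative_transform[rotated 2]) (use x Suc.prems(1) in auto)
      then have "(h has_derivative (\<lambda>_. 0)) (at x within C)"
        using x has_derivative_within_open_Int[of "- cball p s" x h "\<lambda>_. 0" C] by (simp add: open_Compl)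
      then show ?thesis using calculus_domain_has_derivative_unique[OF C(1) x(1) D(1)[OF x(1)]] by metis
    qed
    then have "bCn_on k C (\<lambda>x. D x u)" for u by (intro Suc.IH D(2))
    then show ?case
      using D(1) bdd[OF Cn_on_imp_continuous_on[OF Suc.prems(2)] Suc.prems(1)]
      unfolding bCn_on.simps by blast
  }
qed

lemma continuous_on_linear_shift: "bounded_linear l \<Longrightarrow> continuous_on S (\<lambda>x. l (x - p))"
  by (rule bounded_linear.continuous_on) (auto intro: continuous_on_diff continuous_on_id continuous_on_const)

text \<open>
  Multiplication by a bump function turns \<open>f\<close> into a function on the whole cone with compact support.
  This product extends across all faces, and near \<open>p\<close> it may be divided by the bump function again.
\<close>

lemma Cinf_on_extend_real:
  fixes f :: "'e \<Rightarrow> real"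
  assumes V: "open_in_polytope V" and f: "Cinf_on V f" and p: "p \<in> V"
  shows "\<exists>O' F. open O' \<and> p \<in> O' \<and> Cinf_on O' F \<and> (\<forall>x\<in>O' \<inter> V. F x = f x)"
proof -
  obtain P where P: "polytope_with_interior P" "openin (top_of_set P) V"
    using V unfolding open_in_polytope_def by blast
  obtain W where W: "open W" "V = P \<inter> W" using P(2) unfolding openin_open by blast
  have pP: "p \<in> P" using p W(2) by blast
  obtain J v r0 where J: "finite J" "r0 > 0" "\<And>l. l \<in> J \<Longrightarrow> bounded_linear l \<and> l v < (0::real)"
    "P \<inter> ball p r0 = {x. \<forall>l\<in>J. l (x - p) \<le> 0} \<inter> ball p r0"
    by (rule polytope_local_cone[OF P(1) pP]) (rule that; assumption)
  define C where "C = {x. \<forall>l\<in>J. l (x - p) \<le> 0}"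
  obtain r1 where r1: "r1 > 0" "ball p r1 \<subseteq> W" using W p openE by blast
  define r where "r = min r0 r1"
  have r: "r > 0" using J(2) r1 by (simp add: r_def)
  have VC: "V \<inter> ball p r = C \<inter> ball p r"
  proof -
    have "ball p r \<subseteq> W" "ball p r \<subseteq> ball p r0" using r1(2) by (auto simp: r_def)
    then have "V \<inter> ball p r = (P \<inter> ball p r0) \<inter> ball p r" using W(2) by blast
    also have "\<dots> = C \<inter> ball p r" unfolding J(4) C_def[symmetric] using \<open>ball p r \<subseteq> ball p r0\<close> by blast
    finally show ?thesis .
  qed
  have closedC: "closed C"
  proof -
    have "C = (\<Inter>l\<in>J. {x. l (x - p) \<le> 0})" by (auto simp: C_def)
    moreover have "closed {x. l (x - p) \<le> 0}" if "l \<in> J" for l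
      by (rule closed_Collect_le[OF continuous_on_linear_shift continuous_on_const])
        (use J(3)[OF that] in blast)
    ultimately show ?thesis by (simp add: closed_INT)
  qed
  have "calculus_domain C"
  proof (rule convex_calculus_domain)
    show "convex C" unfolding C_def by (rule convex_cone) (use J(3) in blast)
    have "open (\<Inter>l\<in>J. {x. l (x - p) < 0})"
      by (rule open_INT[OF J(1)], rule ballI, rule open_Collect_less[OF continuous_on_linear_shift continuous_on_const])
        (use J(3) in blast)
    moreover have "(\<Inter>l\<in>J. {x. l (x - p) < 0}) \<subseteq> C" by (force simp: C_def)
    moreover have "p + v \<in> (\<Inter>l\<in>J. {x. l (x - p) < 0})" using J(3) by auto
    ultimately have "p + v \<in> interior C" using interior_maximal by blast
    then show "interior C \<noteq> {}" by blast
  qed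
  obtain \<rho> where \<rho>: "Cinf_on UNIV \<rho>" "\<rho> p > 0" "\<And>x. \<rho> x \<ge> (0::real)" "\<And>x. x \<notin> ball p (r/2) \<Longrightarrow> \<rho> x = 0"
    using bump_function[of "r/2" p] r by auto
  define g where "g = (\<lambda>x. if x \<in> ball p r then \<rho> x * f x else 0)"
  have "Cn_on k C g" for k
  proof (rule Cn_on_local[OF \<open>calculus_domain C\<close>])
    fix x assume x: "x \<in> C"
    show "\<exists>G. open G \<and> x \<in> G \<and> Cn_on k (C \<inter> G) g"
    proof (cases "x \<in> ball p r")
      case True
      have "Cn_on k (C \<inter> ball p r) (\<lambda>x. \<rho> x * f x)"
        using \<rho>(1) f VC unfolding Cinf_on_def
        by (intro Cn_on_mult) (auto intro: Cn_on_subset)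
      then have "Cn_on k (C \<inter> ball p r) g" by (rule Cn_on_cong) (auto simp: g_def)
      then show ?thesis using True open_ball by blast
    next
      case False
      have "Cn_on k (C \<inter> - cball p (r/2)) (\<lambda>_. 0::real)" by (rule Cn_on_const)
      then have "Cn_on k (C \<inter> - cball p (r/2)) g"
        by (rule Cn_on_cong) (use \<rho>(4) in \<open>auto simp: g_def\<close>)
      moreover have "x \<in> - cball p (r/2)" using False r by auto
      ultimately show ?thesis by (meson closed_cball open_Compl)
    qed
  qed
  then have "bCn_on k C g" for k
    by (rule Cn_on_compact_support_bounded[OF \<open>calculus_domain C\<close> closedC, of p "r/2", rotated])
      (use \<rho>(4) in \<open>auto simp: g_def\<close>)
  then have "\<exists>G. (\<forall>k. bCn_on k UNIV G) \<and> (\<forall>x. (\<forall>l\<in>J. l (x - p) \<le> 0) \<longrightarrow> G x = g x)"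
    unfolding C_def by (intro bCn_on_extend_cone[OF J(1,3)])
  then obtain G where G: "\<And>k. bCn_on k UNIV G" "\<And>x. x \<in> C \<Longrightarrow> G x = g x"
    unfolding C_def by blast
  define O' where "O' = {x. \<rho> x > 0} \<inter> ball p r"
  have "open O'" unfolding O'_def
    using Cinf_on_continuous[OF \<rho>(1)] by (intro open_Int open_Collect_less) (auto intro: continuous_intros)
  moreover have "p \<in> O'" using \<rho>(2) r by (simp add: O'_def)
  moreover have "Cinf_on O' (\<lambda>x. G x * inverse (\<rho> x))" unfolding Cinf_on_def
  proof
    fix k
    have "Cn_on k O' (\<lambda>x. inverse (\<rho> x))"
      by (rule real_line.Cn_on_compose[OF Cn_on_inverse])
        (use \<rho>(1) in \<open>auto simp: Cinf_on_def O'_def intro: Cn_on_subset\<close>)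
    moreover have "Cn_on k O' G" using bCn_on_imp_Cn_on[OF G(1)[of k]] by (rule Cn_on_subset) simp
    ultimately show "Cn_on k O' (\<lambda>x. G x * inverse (\<rho> x))" by (intro Cn_on_mult)
  qed
  moreover have "G x * inverse (\<rho> x) = f x" if "x \<in> O' \<inter> V" for x
  proof -
    have "x \<in> V \<inter> ball p r" "\<rho> x > 0" using that by (auto simp: O'_def)
    then have "x \<in> C" "x \<in> ball p r" unfolding VC by auto
    then show ?thesis using G(2)[of x] \<open>\<rho> x > 0\<close> by (simp add: g_def)
  qed
  ultimately show ?thesis by blast
qed

lemma Cinf_on_extend:
  fixes f :: "'e \<Rightarrow> 'e"
  assumes V: "open_in_polytope V" and f: "Cinf_on V f" and p: "p \<in> V"
  obtains O' F where "open O'" "p \<in> O'" "Cinf_on O' F" "\<And>x. x \<in> O' \<inter> V \<Longrightarrow> F x = f x"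
proof -
  have "\<exists>O' F. open O' \<and> p \<in> O' \<and> Cinf_on O' F \<and> (\<forall>x\<in>O' \<inter> V. F x = coord b (f x))" for b
    using f by (intro Cinf_on_extend_real[OF V _ p])
      (auto simp: Cinf_on_def intro: Cn_on_bounded_linear_comp[OF bounded_linear_coord])
  then obtain O' F where OF: "\<And>b. open (O' b)" "\<And>b. p \<in> O' b" "\<And>b. Cinf_on (O' b) (F b)"
    "\<And>b x. x \<in> O' b \<inter> V \<Longrightarrow> F b x = coord b (f x)" by metis
  define U where "U = (\<Inter>b\<in>B. O' b)"
  have "open U" unfolding U_def using OF(1) finite_B by (intro open_INT) auto
  moreover have "p \<in> U" using OF(2) by (simp add: U_def)
  moreover have "Cinf_on U (\<lambda>x. \<Sum>b\<in>B. F b x *\<^sub>R b)" unfolding Cinf_on_def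
  proof
    fix k show "Cn_on k U (\<lambda>x. \<Sum>b\<in>B. F b x *\<^sub>R b)"
    proof (intro Cn_on_sum Cn_on_scaleR Cn_on_const)
      fix b assume "b \<in> B"
      then show "Cn_on k U (F b)"
        using OF(3)[of b] by (auto simp: Cinf_on_def U_def intro: Cn_on_subset)
    qed
  qed
  moreover have "(\<Sum>b\<in>B. F b x *\<^sub>R b) = f x" if "x \<in> U \<inter> V" for x
  proof -
    have "(\<Sum>b\<in>B. F b x *\<^sub>R b) = (\<Sum>b\<in>B. coord b (f x) *\<^sub>R b)"
      by (rule sum.cong) (use OF(4) that in \<open>auto simp: U_def\<close>)
    then show ?thesis by (simp add: coord_sum)
  qed
  ultimately show ?thesis using that by blast
qed

end

section \<open>The inverse function theorem\<close>

context finite_basis begin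

text \<open>
  The resolvent identity \<open>K y - K x = - K y (A y - A x) K x\<close> for the inverses \<open>K x\<close> of \<open>A x\<close> gives their
  continuity, and then the derivative \<open>- K x (DA x) K x\<close>, which in coordinates is a sum of products of
  functions to which the induction hypothesis applies.
\<close>

lemma Cn_on_inverse_family:
  fixes A K :: "'e \<Rightarrow> 'e \<Rightarrow> 'e"
  assumes "open U" and A: "\<And>k h. Cn_on k U (\<lambda>x. A x h)" and lin: "\<And>x. x \<in> U \<Longrightarrow> linear (A x)"
    and AK: "\<And>x h. x \<in> U \<Longrightarrow> A x (K x h) = h" and KA: "\<And>x h. x \<in> U \<Longrightarrow> K x (A x h) = h"
    and bnd: "\<And>x h. x \<in> U \<Longrightarrow> norm (K x h) \<le> c * norm h" and c: "c \<ge> 0"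
  shows "Cn_on k U (\<lambda>x. K x h)"
proof -
  have linK: "linear (K x)" if x: "x \<in> U" for x
  proof (rule linearI)
    show "K x (u + v) = K x u + K x v" for u v
      using KA[OF x, of "K x u + K x v"] by (simp add: linear_add[OF lin[OF x]] AK[OF x])
    show "K x (r *\<^sub>R u) = r *\<^sub>R K x u" for r u
      using KA[OF x, of "r *\<^sub>R K x u"] by (simp add: linear_cmul[OF lin[OF x]] AK[OF x])
  qed
  have resolvent: "K y h - K x h = - K y (A y (K x h) - A x (K x h))" if "x \<in> U" "y \<in> U" for x y h
    using KA[OF that(2)] AK[OF that(1)] linear_diff[OF linK[OF that(2)]] by simp
  have cont: "continuous_on U (\<lambda>x. K x h)" for h
    unfolding continuous_on_def
  proof
    fix x assume x: "x \<in> U"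
    have "((\<lambda>y. A y (K x h) - A x (K x h)) \<longlongrightarrow> A x (K x h) - A x (K x h)) (at x within U)"
      using Cn_on_imp_continuous_on[OF A[of 0 "K x h"]] x
      by (intro tendsto_diff tendsto_const) (auto simp: continuous_on_def)
    then have "((\<lambda>y. c * norm (A y (K x h) - A x (K x h))) \<longlongrightarrow> 0) (at x within U)"
      by (auto intro!: tendsto_mult_right_zero tendsto_norm_zero)
    moreover have "\<forall>\<^sub>F y in at x within U. norm (K y h - K x h) \<le> c * norm (A y (K x h) - A x (K x h))"
      using resolvent[OF x] bnd by (auto simp: eventually_at intro!: exI[of _ 1])
    ultimately have "((\<lambda>y. K y h - K x h) \<longlongrightarrow> 0) (at x within U)"
      by (rule Lim_null_comparison[rotated])
    then show "((\<lambda>y. K y h) \<longlongrightarrow> K x h) (at x within U)" by (simp add: LIM_zero_iff)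
  qed
  obtain DA where DA: "\<And>h x. x \<in> U \<Longrightarrow> ((\<lambda>x. A x h) has_derivative DA h x) (at x within U)"
  proof -
    have "\<exists>D. \<forall>x\<in>U. ((\<lambda>x. A x h) has_derivative D x) (at x within U)" for h
      using A[of "Suc 0" h] by auto
    then show ?thesis using that by metis
  qed
  have DAk: "Cn_on k U (\<lambda>x. DA h x u)" for k h u
  proof -
    obtain D where D: "\<And>x. x \<in> U \<Longrightarrow> ((\<lambda>x. A x h) has_derivative D x) (at x within U)"
      "\<And>u. Cn_on k U (\<lambda>x. D x u)" using A[of "Suc k" h] unfolding Cn_on.simps by blast
    have "D x = DA h x" if "x \<in> U" for x
      by (rule calculus_domain_has_derivative_unique[OF open_imp_calculus_domain[OF \<open>open U\<close>] that D(1)[OF that] DA[OF that]])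
    then show ?thesis using Cn_on_cong[OF D(2)[of u]] by simp
  qed
  have der: "((\<lambda>x. K x h) has_derivative (\<lambda>u. - K x (DA (K x h) x u))) (at x within U)"
    if x: "x \<in> U" for x h
  proof -
    let ?w = "K x h"
    have lDA: "bounded_linear (DA ?w x)" using DA[OF x] by (rule has_derivative_bounded_linear)
    have lKx: "bounded_linear (K x)" by (rule linear_bounded_linear[OF linK[OF x]])
    show ?thesis unfolding has_derivative_iff_norm
    proof (intro conjI)
      show "bounded_linear (\<lambda>u. - K x (DA ?w x u))"
        by (intro bounded_linear_minus bounded_linear_compose[OF lKx lDA])
      let ?R = "\<lambda>y. A y ?w - A x ?w - DA ?w x (y - x)"
      have R: "((\<lambda>y. norm (?R y) / norm (y - x)) \<longlongrightarrow> 0) (at x within U)"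
        using DA[OF x, of ?w] unfolding has_derivative_iff_norm by blast
      obtain m where m: "\<And>u. norm (DA ?w x u) \<le> m * norm u" "m \<ge> 0"
        using bounded_linear.nonneg_bounded[OF lDA] by (auto simp: mult.commute)
      have Kdiff: "((\<lambda>y. \<Sum>b\<in>B. norm (K y b - K x b)) \<longlongrightarrow> (\<Sum>b\<in>B. norm (K x b - K x b))) (at x within U)"
        by (intro tendsto_sum tendsto_norm tendsto_diff tendsto_const)
          (use cont x in \<open>auto simp: continuous_on_def\<close>)
      obtain q where q: "q > 0" "\<And>x. \<forall>b\<in>B. \<bar>coord b x\<bar> \<le> q * norm x" using coord_abs_bound by blast
      have diffb: "norm (K y v - K x v) \<le> q * norm v * (\<Sum>b\<in>B. norm (K y b - K x b))" if y: "y \<in> U" for y v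
      proof -
        have "K y v - K x v = (\<Sum>b\<in>B. coord b v *\<^sub>R (K y b - K x b))"
          by (subst (1) linear_expand[OF linK[OF y]], subst (1) linear_expand[OF linK[OF x]])
            (simp add: scaleR_diff_right sum_subtractf)
        also have "norm \<dots> \<le> (\<Sum>b\<in>B. q * norm v * norm (K y b - K x b))"
          by (rule order.trans[OF norm_sum sum_mono]) (use q(2) in \<open>auto intro!: mult_right_mono\<close>)
        finally show ?thesis by (simp add: sum_distrib_left)
      qed
      have est: "norm (K y h - K x h - (- K x (DA ?w x (y - x)))) / norm (y - x) \<le>
          c * (norm (?R y) / norm (y - x)) + q * m * (\<Sum>b\<in>B. norm (K y b - K x b))"
        if y: "y \<in> U" "y \<noteq> x" for y
      proof -
        let ?v = "DA ?w x (y - x)"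
        have eq: "K y h - K x h - (- K x ?v) = - K y (?R y) - (K y ?v - K x ?v)"
          using resolvent[OF x y(1), of h] by (simp add: linear_diff[OF linK[OF y(1)]])
        have "norm (K y h - K x h - (- K x ?v)) \<le> c * norm (?R y) + q * norm ?v * (\<Sum>b\<in>B. norm (K y b - K x b))"
          unfolding eq using norm_triangle_ineq4[of "- K y (?R y)" "K y ?v - K x ?v"]
            bnd[OF y(1), of "?R y"] diffb[OF y(1), of ?v] unfolding norm_minus_cancel by linarith
        also have "\<dots> \<le> c * norm (?R y) + q * (m * norm (y - x)) * (\<Sum>b\<in>B. norm (K y b - K x b))"
          by (rule add_left_mono[OF mult_right_mono[OF mult_left_mono[OF m(1)]]])
            (use q(1) in \<open>auto intro: sum_nonneg\<close>)
        finally have "norm (K y h - K x h - (- K x ?v)) / norm (y - x) \<le>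
          (c * norm (?R y) + q * (m * norm (y - x)) * (\<Sum>b\<in>B. norm (K y b - K x b))) / norm (y - x)"
          by (rule divide_right_mono) simp
        also have "\<dots> = c * (norm (?R y) / norm (y - x)) + q * m * (\<Sum>b\<in>B. norm (K y b - K x b))"
          using y(2) by (simp add: add_divide_distrib)
        finally show ?thesis .
      qed
      have "((\<lambda>y. c * (norm (?R y) / norm (y - x)) + q * m * (\<Sum>b\<in>B. norm (K y b - K x b))) \<longlongrightarrow>
          c * 0 + q * m * (\<Sum>b\<in>B. norm (K x b - K x b))) (at x within U)"
        by (intro tendsto_add tendsto_mult tendsto_const R Kdiff)
      then have lim: "((\<lambda>y. c * (norm (?R y) / norm (y - x)) + q * m * (\<Sum>b\<in>B. norm (K y b - K x b))) \<longlongrightarrow> 0) (at x within U)"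
        by simp
      have ev: "\<forall>\<^sub>F y in at x within U. norm (norm (K y h - K x h - (- K x (DA ?w x (y - x)))) / norm (y - x)) \<le>
          c * (norm (?R y) / norm (y - x)) + q * m * (\<Sum>b\<in>B. norm (K y b - K x b))"
        unfolding eventually_at using est by (intro exI[of _ 1]) auto
      show "((\<lambda>y. norm (K y h - K x h - (- K x (DA ?w x (y - x)))) / norm (y - x)) \<longlongrightarrow> 0) (at x within U)"
        by (rule Lim_null_comparison[OF ev lim])
    qed
  qed
  have DAlin: "DA w x u = (\<Sum>b\<in>B. coord b w *\<^sub>R DA b x u)" if x: "x \<in> U" for w x u
  proof -
    have "((\<lambda>x. \<Sum>b\<in>B. coord b w *\<^sub>R A x b) has_derivative (\<lambda>u. \<Sum>b\<in>B. coord b w *\<^sub>R DA b x u)) (at x within U)"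
      by (intro has_derivative_sum has_derivative_scaleR_right DA[OF x])
    then have "((\<lambda>x. A x w) has_derivative (\<lambda>u. \<Sum>b\<in>B. coord b w *\<^sub>R DA b x u)) (at x within U)"
      by (rule has_derivative_transform[OF x, rotated]) (rule linear_expand[OF lin])
    then have "DA w x = (\<lambda>u. \<Sum>b\<in>B. coord b w *\<^sub>R DA b x u)"
      by (rule calculus_domain_has_derivative_unique[OF open_imp_calculus_domain[OF \<open>open U\<close>] x DA[OF x]])
    then show ?thesis by simp
  qed
  show ?thesis
  proof (induction k arbitrary: h)
    case 0
    then show ?case using cont by simp
  next
    case (Suc k)
    have "Cn_on k U (\<lambda>x. - K x (DA (K x h) x u))" for u
    proof (rule Cn_on_cong)
      show "Cn_on k U (\<lambda>x. - (\<Sum>b\<in>B. coord b (\<Sum>b\<in>B. coord b (K x h) *\<^sub>R DA b x u) *\<^sub>R K x b))"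
        by (intro Cn_on_minus Cn_on_sum Cn_on_scaleR Suc DAk Cn_on_bounded_linear_comp[OF bounded_linear_coord])
      show "- (\<Sum>b\<in>B. coord b (\<Sum>b\<in>B. coord b (K x h) *\<^sub>R DA b x u) *\<^sub>R K x b) = - K x (DA (K x h) x u)"
        if x: "x \<in> U" for x
        by (simp only: linear_expand[OF linK[OF x], symmetric] DAlin[OF x, symmetric])
    qed
    with der show ?case by (rule Cn_on_SucI)
  qed
qed

text \<open>
  Let \<open>T'\<close> be the inverse of the derivative at \<open>p\<close>.  Near \<open>p\<close> the map \<open>H x = x - T' (F x)\<close> has Lipschitz
  constant \<open>1/2\<close>.  So \<open>F\<close> is injective there, and \<open>F u = z\<close> is solved by the fixed point of the contraction
  \<open>u \<mapsto> H u + T' z\<close>, which makes \<open>F\<close> open.  The derivative of the local inverse is the inverse of the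
  derivative, composed with the local inverse itself, so its order improves by induction.
\<close>

lemma inverse_function_theorem:
  fixes F :: "'e \<Rightarrow> 'e"
  assumes O': "open O'" and p: "p \<in> O'" and F: "Cinf_on O' F"
    and T: "(F has_derivative T) (at p)" "inj T"
  obtains W G where "open W" "p \<in> W" "W \<subseteq> O'" "inj_on F W"
    "\<And>S. open S \<Longrightarrow> S \<subseteq> W \<Longrightarrow> open (F ` S)" "Cinf_on (F ` W) G" "\<And>x. x \<in> W \<Longrightarrow> G (F x) = x"
proof -
  obtain D where D: "\<And>x. x \<in> O' \<Longrightarrow> (F has_derivative D x) (at x)" and Dk: "\<And>k h. Cn_on k O' (\<lambda>x. D x h)"
  proof -
    have "\<exists>D. (\<forall>x\<in>O'. (F has_derivative D x) (at x within O')) \<and> (\<forall>h. Cn_on k O' (\<lambda>x. D x h))" for k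
      using F unfolding Cinf_on_def by (metis Cn_on.simps(2))
    then obtain D where D: "\<And>k x. x \<in> O' \<Longrightarrow> (F has_derivative D k x) (at x within O')"
      "\<And>k h. Cn_on k O' (\<lambda>x. D k x h)" by metis
    have eq: "D k x = D 0 x" if "x \<in> O'" for k x
      by (rule calculus_domain_has_derivative_unique[OF open_imp_calculus_domain[OF O'] that D(1)[OF that] D(1)[OF that]])
    show ?thesis
    proof (rule that)
      show "(F has_derivative D 0 x) (at x)" if "x \<in> O'" for x
        using D(1)[OF that, of 0] unfolding at_within_open[OF that O'] .
      show "Cn_on k O' (\<lambda>x. D 0 x h)" for k h
        by (rule Cn_on_cong[OF D(2)[of k h]]) (simp only: eq[of _ k])
    qed
  qed
  have linD: "linear (D x)" if "x \<in> O'" for x using D[OF that] by (rule has_derivative_linear)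
  have DT: "D p = T" using D[OF p] T(1) has_derivative_unique by blast
  obtain T' where T': "bounded_linear T'" "T' \<circ> T = id" "T \<circ> T' = id"
    using inj_linear_inverse[OF _ T(2)] T(1) has_derivative_linear by metis
  have T'T: "T' (T x) = x" "T (T' x) = x" for x using T'(2,3) by (metis comp_apply id_apply)+
  interpret T': bounded_linear T' by (rule T'(1))
  obtain m where m: "m > 0" "\<And>x. norm (T' x) \<le> norm x * m" using T'.pos_bounded by blast
  define H where "H = (\<lambda>x. x - T' (F x))"
  define DH where "DH = (\<lambda>x h. h - T' (D x h))"
  have H: "(H has_derivative DH x) (at x)" if "x \<in> O'" for x
    unfolding H_def DH_def by (intro has_derivative_diff has_derivative_ident T'.has_derivative D[OF that])
  obtain \<delta> where \<delta>: "\<delta> > 0" "cball p \<delta> \<subseteq> O'"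
    "\<And>x h. x \<in> cball p \<delta> \<Longrightarrow> norm (DH x h) \<le> (1/2) * norm h"
  proof -
    obtain q where q: "q > 0" "\<And>x. (\<Sum>b\<in>B. \<bar>coord b x\<bar>) \<le> q * norm x" using coord_bound by blast
    have "continuous_on O' (\<lambda>x. \<Sum>b\<in>B. norm (DH x b))" unfolding DH_def
      using Cn_on_imp_continuous_on[OF Dk[of 0]]
      by (intro continuous_intros T'.continuous_on) auto
    then have "open (O' \<inter> (\<lambda>x. \<Sum>b\<in>B. norm (DH x b)) -` {..<1 / (2 * q)})"
      using continuous_open_preimage O' open_lessThan by blast
    moreover have "p \<in> O' \<inter> (\<lambda>x. \<Sum>b\<in>B. norm (DH x b)) -` {..<1 / (2 * q)}"
      using p q by (simp add: DH_def DT T'T)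
    ultimately obtain \<delta> where \<delta>: "\<delta> > 0" "cball p \<delta> \<subseteq> O' \<inter> (\<lambda>x. \<Sum>b\<in>B. norm (DH x b)) -` {..<1 / (2 * q)}"
      using open_contains_cball by metis
    have "norm (DH x h) \<le> (1/2) * norm h" if x: "x \<in> cball p \<delta>" for x h
    proof -
      have xO: "x \<in> O'" using \<delta>(2) x by blast
      have "linear (DH x)" using H[OF xO] by (rule has_derivative_linear)
      then have "DH x h = (\<Sum>b\<in>B. coord b h *\<^sub>R DH x b)" by (rule linear_expand)
      also have "norm \<dots> \<le> (\<Sum>b\<in>B. (q * norm h) * norm (DH x b))"
      proof (rule order.trans[OF norm_sum sum_mono])
        fix b assume b: "b \<in> B"
        have "\<bar>coord b h\<bar> \<le> (\<Sum>b\<in>B. \<bar>coord b h\<bar>)" using b finite_B by (intro member_le_sum) auto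
        then have "\<bar>coord b h\<bar> \<le> q * norm h" using q(2)[of h] by linarith
        then show "norm (coord b h *\<^sub>R DH x b) \<le> (q * norm h) * norm (DH x b)" by (simp add: mult_right_mono)
      qed
      also have "\<dots> = (q * norm h) * (\<Sum>b\<in>B. norm (DH x b))" by (simp add: sum_distrib_left)
      also have "\<dots> \<le> (q * norm h) * (1 / (2 * q))"
        using \<delta>(2) x q(1) by (intro mult_left_mono) auto
      finally show ?thesis using q(1) by simp
    qed
    with \<delta> that show ?thesis by blast
  qed
  have Hlip: "norm (H x - H y) \<le> (1/2) * norm (x - y)" if "x \<in> cball p \<delta>" "y \<in> cball p \<delta>" for x y
  proof (rule differentiable_bound[where f = H and f' = DH and B = "1/2", OF convex_cball _ _ that])
    show "(H has_derivative DH x) (at x within cball p \<delta>)" if "x \<in> cball p \<delta>" for x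
      by (rule has_derivative_at_withinI[OF H]) (use \<delta>(2) that in blast)
    show "onorm (DH x) \<le> 1/2" if "x \<in> cball p \<delta>" for x
      by (rule onorm_bound[OF _ \<delta>(3)[OF that]]) simp
  qed
  have Fdiff: "norm (x - y) \<le> 2 * m * norm (F x - F y)" if "x \<in> cball p \<delta>" "y \<in> cball p \<delta>" for x y
  proof -
    have "x - y = (H x - H y) + T' (F x - F y)" by (simp add: H_def T'.diff)
    then have "norm (x - y) \<le> norm (H x - H y) + norm (T' (F x - F y))" by (metis norm_triangle_ineq)
    also have "\<dots> \<le> (1/2) * norm (x - y) + norm (F x - F y) * m" using Hlip[OF that] m(2) by (intro add_mono)
    finally show ?thesis by (simp add: mult.commute)
  qed
  define W where "W = ball p \<delta>"
  have Wsub: "W \<subseteq> cball p \<delta>" "W \<subseteq> O'" using \<delta>(2) by (auto simp: W_def)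
  have inj: "inj_on F W"
  proof (rule inj_onI)
    fix x y assume "x \<in> W" "y \<in> W" "F x = F y"
    then show "x = y" using Fdiff[of x y] subsetD[OF Wsub(1)] by simp
  qed
  have openim: "open (F ` S)" if S: "open S" "S \<subseteq> W" for S
    unfolding open_contains_ball
  proof (intro ballI)
    fix y assume "y \<in> F ` S"
    then obtain x where x: "x \<in> S" "y = F x" by blast
    obtain s where s: "s > 0" "cball x s \<subseteq> S" using S(1) x(1) open_contains_cball by blast
    have "z \<in> F ` S" if z: "z \<in> ball y (s / (2 * m))" for z
    proof -
      define f where "f = (\<lambda>u. H u + T' z)"
      have sub: "cball x s \<subseteq> cball p \<delta>" using s(2) S(2) Wsub by blast
      have "f ` cball x s \<subseteq> cball x s"
      proof (rule image_subsetI)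
        fix u assume u: "u \<in> cball x s"
        have "f u - x = (H u - H x) + T' (z - y)" by (simp add: f_def H_def x(2) T'.diff)
        then have "norm (f u - x) \<le> norm (H u - H x) + norm (T' (z - y))" by (metis norm_triangle_ineq)
        also have "\<dots> \<le> (1/2) * norm (u - x) + norm (z - y) * m"
          using Hlip[OF subsetD[OF sub u] subsetD[OF sub, of x]] m(2) s(1) by (intro add_mono) auto
        also have "\<dots> \<le> (1/2) * s + (s / (2 * m)) * m"
          using u z m(1) by (intro add_mono mult_right_mono) (auto simp: dist_norm norm_minus_commute)
        also have "\<dots> = s" using m(1) by simp
        finally show "f u \<in> cball x s" by (simp add: dist_norm norm_minus_commute)
      qed
      moreover have "dist (f u) (f v) \<le> (1/2) * dist u v" if "u \<in> cball x s" "v \<in> cball x s" for u v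
        using Hlip[OF subsetD[OF sub that(1)] subsetD[OF sub that(2)]] by (simp add: f_def dist_norm)
      moreover have "complete (cball x s)" using compact_cball_fd by (rule compact_imp_complete)
      ultimately obtain u where u: "u \<in> cball x s" "f u = u"
        using Banach_fix[of "cball x s" "1/2" f] s(1) by auto
      then have "T' (F u) = T' z" by (simp add: f_def H_def)
      then have "F u = z" using T'T by metis
      then show ?thesis using u s by blast
    qed
    then show "\<exists>e>0. ball y e \<subseteq> F ` S" using s(1) m(1) by (intro exI[of _ "s / (2 * m)"]) auto
  qed
  define G where "G = inv_into W F"
  have GF: "G (F x) = x" if "x \<in> W" for x using inj that by (simp add: G_def)
  have openFW: "open (F ` W)" by (rule openim) (auto simp: W_def)
  have contG: "continuous_on (F ` W) G"
    unfolding continuous_on_open_vimage[OF openFW]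
  proof (intro allI impI)
    fix S :: "'e set" assume "open S"
    have "G -` S \<inter> F ` W = F ` (S \<inter> W)" using GF by force
    then show "open (G -` S \<inter> F ` W)" using openim[of "S \<inter> W"] \<open>open S\<close> by (simp add: W_def open_Int)
  qed
  have Dlow: "norm h \<le> 2 * m * norm (D x h)" if x: "x \<in> W" for x h
  proof -
    have "h = DH x h + T' (D x h)" by (simp add: DH_def)
    then have "norm h \<le> norm (DH x h) + norm (T' (D x h))" by (metis norm_triangle_ineq)
    also have "\<dots> \<le> (1/2) * norm h + norm (D x h) * m" using \<delta>(3)[of x h] x Wsub m(2) by (intro add_mono) auto
    finally show ?thesis by (simp add: algebra_simps)
  qed
  have "\<exists>K. bounded_linear K \<and> K \<circ> D x = id \<and> D x \<circ> K = id" if x: "x \<in> W" for x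
  proof -
    have lin: "linear (D x)" using linD x Wsub by blast
    have "inj (D x)"
    proof (rule injI)
      fix u v assume "D x u = D x v"
      then show "u = v" using Dlow[OF x, of "u - v"] linear_diff[OF lin] by simp
    qed
    then show ?thesis using inj_linear_inverse[OF lin] by metis
  qed
  then obtain K where K: "\<And>x. x \<in> W \<Longrightarrow> bounded_linear (K x)" "\<And>x. x \<in> W \<Longrightarrow> K x \<circ> D x = id"
    "\<And>x. x \<in> W \<Longrightarrow> D x \<circ> K x = id" by metis
  have DK: "D x (K x h) = h" "K x (D x h) = h" if "x \<in> W" for x h
    using K(2,3)[OF that] by (metis comp_apply id_apply)+
  have Kk: "Cn_on k W (\<lambda>x. K x h)" for k h
  proof (rule Cn_on_inverse_family[of W D])
    show "Cn_on k W (\<lambda>x. D x h)" for k h by (rule Cn_on_subset[OF Dk Wsub(2)])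
    show "norm (K x h) \<le> 2 * m * norm h" if "x \<in> W" for x h
      using Dlow[OF that, of "K x h"] DK(1)[OF that] by simp
  qed (use linD Wsub DK m in \<open>auto simp: W_def\<close>)
  have derG: "(G has_derivative K (G y)) (at y within F ` W)" if y: "y \<in> F ` W" for y
  proof -
    have Gy: "G y \<in> W" "F (G y) = y" using y GF by auto
    have "(G has_derivative K (G y)) (at y)"
    proof (rule has_derivative_inverse_basic[OF _ K(1)[OF Gy(1)] K(2)[OF Gy(1)] _ openFW y])
      show "(F has_derivative D (G y)) (at (G y))" using D Gy(1) Wsub by blast
      show "continuous (at y) G" using contG openFW y continuous_on_eq_continuous_at by blast
      show "F (G z) = z" if "z \<in> F ` W" for z using that GF by auto
    qed
    then show ?thesis by (rule has_derivative_at_withinI)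
  qed
  have "Cn_on k (F ` W) G" for k
  proof (induction k)
    case 0
    then show ?case using contG by simp
  next
    case (Suc k)
    have "Cn_on k (F ` W) (\<lambda>y. K (G y) h)" for h
      by (rule Cn_on_compose[OF Kk Suc]) (use GF in auto)
    with derG show ?case by (rule Cn_on_SucI)
  qed
  then have "Cinf_on (F ` W) G" by (simp add: Cinf_on_def)
  then show ?thesis
    using that[of W G] Wsub inj openim GF \<delta>(1) by (simp add: W_def)
qed

end

section \<open>Transition maps\<close>

text \<open>
  On \<open>S\<close>, the map \<open>\<phi>\<close> is a smooth function of \<open>\<psi>\<close>.  This expresses smoothness of transition maps
  without inverting charts and makes composition and restriction of transitions immediate.
\<close>

definition smooth_along :: "'m set \<Rightarrow> ('m \<Rightarrow> 'e::real_normed_vector) \<Rightarrow> ('m \<Rightarrow> 'f::real_normed_vector) \<Rightarrow> bool" where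
  "smooth_along S \<psi> \<phi> \<longleftrightarrow> (\<exists>F. Cinf_on (\<psi> ` S) F \<and> (\<forall>x\<in>S. F (\<psi> x) = \<phi> x))"

lemma smooth_along_subset: "smooth_along S \<psi> \<phi> \<Longrightarrow> T \<subseteq> S \<Longrightarrow> smooth_along T \<psi> \<phi>"
  unfolding smooth_along_def by (meson Cinf_on_subset image_mono subsetD)

lemma smooth_along_cong:
  assumes "smooth_along S \<psi> \<phi>" "\<And>x. x \<in> S \<Longrightarrow> \<psi> x = \<psi>' x" "\<And>x. x \<in> S \<Longrightarrow> \<phi> x = \<phi>' x"
  shows "smooth_along S \<psi>' \<phi>'"
proof -
  have "\<psi> ` S = \<psi>' ` S" using assms(2) by (rule image_cong[OF refl])
  then show ?thesis using assms unfolding smooth_along_def by metis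
qed

lemma smooth_along_comp:
  assumes "smooth_along T \<psi> \<phi>" "f ` S \<subseteq> T"
  shows "smooth_along S (\<psi> \<circ> f) (\<phi> \<circ> f)"
proof -
  obtain F where F: "Cinf_on (\<psi> ` T) F" "\<forall>x\<in>T. F (\<psi> x) = \<phi> x" using assms(1) by (auto simp: smooth_along_def)
  have "(\<psi> \<circ> f) ` S \<subseteq> \<psi> ` T" using assms(2) by auto
  then show ?thesis unfolding smooth_along_def using Cinf_on_subset[OF F(1)] F(2) assms(2)
    by (intro exI[of _ F]) auto
qed

lemma (in finite_basis) smooth_along_trans:
  assumes "smooth_along S \<psi> (\<eta> :: 'm \<Rightarrow> 'e)" "smooth_along S \<eta> \<phi>" shows "smooth_along S \<psi> \<phi>"
proof -
  obtain F where F: "Cinf_on (\<psi> ` S) F" "\<And>x. x \<in> S \<Longrightarrow> F (\<psi> x) = \<eta> x" using assms(1) by (auto simp: smooth_along_def)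
  obtain G where G: "Cinf_on (\<eta> ` S) G" "\<And>x. x \<in> S \<Longrightarrow> G (\<eta> x) = \<phi> x" using assms(2) by (auto simp: smooth_along_def)
  have "Cinf_on (\<psi> ` S) (\<lambda>y. G (F y))" by (rule Cinf_on_compose[OF G(1) F(1)]) (use F(2) in auto)
  then show ?thesis unfolding smooth_along_def using F(2) G(2) by (intro exI[of _ "\<lambda>y. G (F y)"]) auto
qed

lemma smooth_along_iff:
  assumes "inj_on \<psi> S"
  shows "smooth_along S \<psi> \<phi> \<longleftrightarrow> Cinf_on (\<psi> ` S) (\<phi> \<circ> inv_into S \<psi>)"
proof
  assume "smooth_along S \<psi> \<phi>"
  then obtain F where F: "Cinf_on (\<psi> ` S) F" "\<And>x. x \<in> S \<Longrightarrow> F (\<psi> x) = \<phi> x" by (auto simp: smooth_along_def)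
  show "Cinf_on (\<psi> ` S) (\<phi> \<circ> inv_into S \<psi>)"
    by (rule Cinf_on_cong[OF F(1)]) (use F(2) assms in auto)
qed (use assms in \<open>auto simp: smooth_along_def intro!: exI[of _ "\<phi> \<circ> inv_into S \<psi>"]\<close>)

lemma smooth_along_local:
  assumes conv: "calculus_domain (\<psi> ` S)" and inj: "inj_on \<psi> S"
    and loc: "\<And>x. x \<in> S \<Longrightarrow> \<exists>T\<subseteq>S. x \<in> T \<and> openin (top_of_set (\<psi> ` S)) (\<psi> ` T) \<and> smooth_along T \<psi> \<phi>"
  shows "smooth_along S \<psi> \<phi>"
  unfolding smooth_along_iff[OF inj] Cinf_on_def
proof (intro allI Cn_on_local[OF conv])
  fix k y assume "y \<in> \<psi> ` S"
  then obtain x where x: "x \<in> S" "y = \<psi> x" by blast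
  then obtain T where T: "T \<subseteq> S" "x \<in> T" "openin (top_of_set (\<psi> ` S)) (\<psi> ` T)" "smooth_along T \<psi> \<phi>"
    using loc by blast
  obtain G where G: "open G" "\<psi> ` T = \<psi> ` S \<inter> G" using T(3) unfolding openin_open by blast
  have "Cinf_on (\<psi> ` T) (\<phi> \<circ> inv_into T \<psi>)"
    using T(4) smooth_along_iff[OF inj_on_subset[OF inj T(1)]] by blast
  then have "Cinf_on (\<psi> ` T) (\<phi> \<circ> inv_into S \<psi>)"
    by (rule Cinf_on_cong) (use T(1) inj inj_on_subset[OF inj T(1)] in auto)
  then show "\<exists>G. open G \<and> y \<in> G \<and> Cn_on k (\<psi> ` S \<inter> G) (\<phi> \<circ> inv_into S \<psi>)"
    using G x T(2) unfolding Cinf_on_def by (metis IntD2 image_eqI)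
qed

section \<open>Charts and maximal atlases\<close>

lemma is_chartD:
  assumes "is_chart Q X (U, \<phi>)"
  shows "openin X U" "U \<subseteq> topspace X" "Q (\<phi> ` U)" "inj_on \<phi> U"
    "homeomorphic_map (subtopology X U) (top_of_set (\<phi> ` U)) \<phi>"
    "topspace (subtopology X U) = U"
proof -
  show *: "openin X U" "Q (\<phi> ` U)" "homeomorphic_map (subtopology X U) (top_of_set (\<phi> ` U)) \<phi>"
    using assms by (auto simp: is_chart_def)
  show U: "U \<subseteq> topspace X" using *(1) by (rule openin_subset)
  then show t: "topspace (subtopology X U) = U" by auto
  show "inj_on \<phi> U" using homeomorphic_imp_injective_map[OF *(3)] t by simp
qed

lemma is_chart_subset: "is_chart Q X c \<Longrightarrow> fst c \<subseteq> topspace X"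
  using is_chartD(2)[of Q X "fst c" "snd c"] by simp

lemma is_chart_image_open:
  assumes c: "is_chart Q X (U, \<phi>)" and W: "W \<subseteq> U"
  shows "openin (top_of_set (\<phi> ` U)) (\<phi> ` W) \<longleftrightarrow> openin X W"
  using homeomorphic_map_openness[OF is_chartD(5)[OF c], of W] W is_chartD(1,2,6)[OF c]
  by (simp add: openin_open_subtopology)

lemma is_chart_preimage_open:
  assumes c: "is_chart Q X (U, \<phi>)" and T: "openin (top_of_set (\<phi> ` U)) T"
  shows "openin X {x \<in> U. \<phi> x \<in> T}"
proof -
  have "T \<subseteq> \<phi> ` U" using openin_imp_subset[OF T] .
  then have "\<phi> ` {x \<in> U. \<phi> x \<in> T} = T" by auto
  then show ?thesis using is_chart_image_open[OF c, of "{x \<in> U. \<phi> x \<in> T}"] T by auto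
qed

lemma is_chart_restrict:
  assumes c: "is_chart Q X (U, \<phi>)" and W: "openin X W" "W \<subseteq> U" and Q: "Q' (\<phi> ` W)"
  shows "is_chart Q' X (W, \<phi>)"
proof -
  have "homeomorphic_map (subtopology (subtopology X U) W) (subtopology (top_of_set (\<phi> ` U)) (\<phi> ` W)) \<phi>"
    by (rule homeomorphic_map_subtopologies[OF is_chartD(5)[OF c]])
      (use W is_chartD[OF c] in auto)
  then have "homeomorphic_map (subtopology X W) (top_of_set (\<phi> ` W)) \<phi>"
    using W(2) by (simp add: subtopology_subtopology Int_absorb1 image_mono)
  then show ?thesis using W Q by (simp add: is_chart_def)
qed

lemma is_chart_subspace:
  assumes c: "is_chart Q X (U, \<phi>)" and Q: "Q' (\<phi> ` (U \<inter> N))"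
  shows "is_chart Q' (subtopology X N) (U \<inter> N, \<phi>)"
proof -
  have "homeomorphic_map (subtopology (subtopology X U) (U \<inter> N)) (subtopology (top_of_set (\<phi> ` U)) (\<phi> ` (U \<inter> N))) \<phi>"
    by (rule homeomorphic_map_subtopologies[OF is_chartD(5)[OF c]])
      (use is_chartD[OF c] in auto)
  then have "homeomorphic_map (subtopology X (U \<inter> N)) (top_of_set (\<phi> ` (U \<inter> N))) \<phi>"
    by (simp add: subtopology_subtopology Int_absorb1 image_mono)
  moreover have "openin (subtopology X N) (U \<inter> N)"
    using is_chartD(1)[OF c] by (auto simp: openin_subtopology)
  ultimately show ?thesis using Q by (simp add: is_chart_def subtopology_subtopology Int_absorb1 Int_left_absorb Int_commute)
qed

lemma is_chart_pullback:
  assumes c: "is_chart Q X (U, \<phi>)" and g: "homeomorphic_map Y X \<gamma>"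
  shows "is_chart Q Y (\<gamma> -` U \<inter> topspace Y, \<phi> \<circ> \<gamma>)" "(\<phi> \<circ> \<gamma>) ` (\<gamma> -` U \<inter> topspace Y) = \<phi> ` U"
proof -
  let ?U = "\<gamma> -` U \<inter> topspace Y"
  have surj: "\<gamma> ` topspace Y = topspace X" using g by (rule homeomorphic_imp_surjective_map)
  have "\<gamma> ` ?U = U \<inter> \<gamma> ` topspace Y" by auto
  then have im: "\<gamma> ` ?U = U" unfolding surj using is_chartD(2)[OF c] by (simp add: Int_absorb2)
  show im2: "(\<phi> \<circ> \<gamma>) ` ?U = \<phi> ` U" using im by (metis image_comp)
  have h: "homeomorphic_map (subtopology Y ?U) (subtopology X U) \<gamma>"
  proof (rule homeomorphic_map_subtopologies[OF g])
    have "topspace Y \<inter> ?U = ?U" "topspace X \<inter> U = U" using is_chartD(2)[OF c] by auto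
    then show "\<gamma> ` (topspace Y \<inter> ?U) = topspace X \<inter> U" using im by (simp only:)
  qed
  have "homeomorphic_map (subtopology Y ?U) (top_of_set (\<phi> ` U)) (\<phi> \<circ> \<gamma>)"
    by (rule homeomorphic_map_compose[OF h is_chartD(5)[OF c]])
  moreover have "openin Y ?U"
    using homeomorphic_map_openness[OF g, of ?U] im is_chartD(1)[OF c] by simp
  ultimately show "is_chart Q Y (?U, \<phi> \<circ> \<gamma>)"
    using is_chartD(3)[OF c] im2 by (simp add: is_chart_def)
qed

text \<open>
  The two conditions shared by the kinds of chart images in question, open sets and open subsets of
  polytopes, under which every atlas is contained in a maximal one.
\<close>

definition admissible :: "('e::real_normed_vector set \<Rightarrow> bool) \<Rightarrow> bool" where
  "admissible Q \<longleftrightarrow> (\<forall>S. Q S \<longrightarrow> calculus_domain S) \<and> (\<forall>S T. Q S \<longrightarrow> openin (top_of_set S) T \<longrightarrow> Q T)"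

lemma admissible_open: "admissible open"
  unfolding admissible_def using open_imp_calculus_domain openin_open_trans by blast

lemma admissible_open_in_polytope: "admissible open_in_polytope"
  unfolding admissible_def
proof (intro conjI allI impI open_in_polytope_calculus_domain)
  fix S T :: "'a set" assume "open_in_polytope S" "openin (top_of_set S) T"
  then show "open_in_polytope T" unfolding open_in_polytope_def using openin_trans by blast
qed

lemma chart_overlap_calculus_domain:
  assumes Q: "admissible Q" and c: "is_chart Q X (V, \<psi>)" and W: "openin X W" "W \<subseteq> V"
  shows "calculus_domain (\<psi> ` W)" "Q (\<psi> ` W)"
  using Q is_chartD(3)[OF c] is_chart_image_open[OF c W(2)] W(1) unfolding admissible_def by blast+

context finite_basis begin

lemma smooth_transition_iff:
  fixes \<phi> \<psi> :: "'m \<Rightarrow> 'e"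
  assumes "inj_on \<psi> V" "calculus_domain (\<psi> ` (U \<inter> V))"
  shows "smooth_transition (U, \<phi>) (V, \<psi>) \<longleftrightarrow> smooth_along (U \<inter> V) \<psi> \<phi>"
proof -
  have inj: "inj_on \<psi> (U \<inter> V)" using assms(1) by (rule inj_on_subset) simp
  have eq: "(\<phi> \<circ> inv_into V \<psi>) y = (\<phi> \<circ> inv_into (U \<inter> V) \<psi>) y" if y: "y \<in> \<psi> ` (U \<inter> V)" for y
    using y assms(1) inj by auto
  have "smooth_transition (U, \<phi>) (V, \<psi>) \<longleftrightarrow> Cinf_on (\<psi> ` (U \<inter> V)) (\<phi> \<circ> inv_into V \<psi>)"
    unfolding smooth_transition_def using smooth_on_iff_Cinf_on[OF assms(2)] by simp
  also have "\<dots> \<longleftrightarrow> Cinf_on (\<psi> ` (U \<inter> V)) (\<phi> \<circ> inv_into (U \<inter> V) \<psi>)"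
    using eq Cinf_on_cong by metis
  finally show ?thesis by (simp add: smooth_along_iff[OF inj])
qed

lemma chart_smooth_transition_iff:
  fixes \<phi> \<psi> :: "'m \<Rightarrow> 'e"
  assumes "admissible Q" "is_chart Q X (V, \<psi>)" "openin X U"
  shows "smooth_transition (U, \<phi>) (V, \<psi>) \<longleftrightarrow> smooth_along (U \<inter> V) \<psi> \<phi>"
  using smooth_transition_iff[OF is_chartD(4)[OF assms(2)]]
    chart_overlap_calculus_domain(1)[OF assms(1,2), of "U \<inter> V"] is_chartD(1)[OF assms(2)] assms(3) by blast

definition compatible :: "('m, 'e) chart \<Rightarrow> ('m, 'e) chart \<Rightarrow> bool" where
  "compatible c d \<longleftrightarrow> smooth_along (fst c \<inter> fst d) (snd c) (snd d) \<and> smooth_along (fst c \<inter> fst d) (snd d) (snd c)"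

lemma compatible_iff:
  assumes "admissible Q" "is_chart Q X c" "is_chart Q X d"
  shows "compatible c d \<longleftrightarrow> smooth_transition c d \<and> smooth_transition d c"
proof -
  obtain U \<phi> V \<psi> where cd: "c = (U, \<phi>)" "d = (V, \<psi>)" by (cases c, cases d)
  note ch = assms(2,3)[unfolded cd]
  show ?thesis
    unfolding cd compatible_def fst_conv snd_conv
      chart_smooth_transition_iff[OF assms(1) ch(2) is_chartD(1)[OF ch(1)]]
      chart_smooth_transition_iff[OF assms(1) ch(1) is_chartD(1)[OF ch(2)]] Int_commute[of V U]
    by blast
qed

lemma is_atlas_iff:
  assumes "admissible Q"
  shows "is_atlas Q X A \<longleftrightarrow> (\<forall>c\<in>A. is_chart Q X c) \<and> \<Union> (fst ` A) = topspace X \<and> (\<forall>c\<in>A. \<forall>d\<in>A. compatible c d)"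
proof -
  have "(\<forall>c\<in>A. \<forall>d\<in>A. smooth_transition c d) \<longleftrightarrow> (\<forall>c\<in>A. \<forall>d\<in>A. compatible c d)"
    if ch: "\<forall>c\<in>A. is_chart Q X c"
  proof -
    have "compatible c d \<longleftrightarrow> smooth_transition c d \<and> smooth_transition d c" if "c \<in> A" "d \<in> A" for c d
      by (rule compatible_iff[OF assms bspec[OF ch that(1)] bspec[OF ch that(2)]])
    then show ?thesis by blast
  qed
  then show ?thesis unfolding is_atlas_def by blast
qed

text \<open>
  Near each point, the transition factors through a chart of the atlas.
\<close>

lemma compatible_via_atlas:
  assumes Q: "admissible Q" and A: "\<And>d. d \<in> A \<Longrightarrow> is_chart Q X d" "topspace X \<subseteq> \<Union> (fst ` A)"
    and c: "is_chart Q X c" "\<And>d. d \<in> A \<Longrightarrow> compatible c d"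
    and e: "is_chart Q X e" "\<And>d. d \<in> A \<Longrightarrow> compatible e d"
  shows "compatible c e"
proof -
  have half: "smooth_along (U \<inter> V) \<psi> \<phi>"
    if c: "is_chart Q X (U, \<phi>)" "\<And>d. d \<in> A \<Longrightarrow> compatible (U, \<phi>) d"
      and e: "is_chart Q X (V, \<psi>)" "\<And>d. d \<in> A \<Longrightarrow> compatible (V, \<psi>) d" for U V \<phi> \<psi>
  proof (rule smooth_along_local)
    have UV: "openin X (U \<inter> V)" using is_chartD(1)[OF c(1)] is_chartD(1)[OF e(1)] by blast
    show "calculus_domain (\<psi> ` (U \<inter> V))" using chart_overlap_calculus_domain(1)[OF Q e(1) UV] by simp
    show "inj_on \<psi> (U \<inter> V)" by (rule inj_on_subset[OF is_chartD(4)[OF e(1)]]) simp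
    fix x assume x: "x \<in> U \<inter> V"
    then have "x \<in> topspace X" using is_chartD(2)[OF c(1)] by auto
    then obtain W \<eta> where d: "(W, \<eta>) \<in> A" "x \<in> W" using A(2) by fastforce
    have W: "openin X W" using is_chartD(1)[OF A(1)[OF d(1)]] .
    have "openin (top_of_set (\<psi> ` V)) (\<psi> ` (U \<inter> V \<inter> W))"
      using is_chart_image_open[OF e(1), of "U \<inter> V \<inter> W"] UV W by auto
    then have "openin (top_of_set (\<psi> ` (U \<inter> V))) (\<psi> ` (U \<inter> V \<inter> W))"
      by (rule openin_subset_trans) auto
    moreover have "smooth_along (U \<inter> V \<inter> W) \<psi> \<eta>" "smooth_along (U \<inter> V \<inter> W) \<eta> \<phi>"
      using c(2)[OF d(1)] e(2)[OF d(1)] unfolding compatible_def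
      by (auto intro: smooth_along_subset)
    then have "smooth_along (U \<inter> V \<inter> W) \<psi> \<phi>" by (rule smooth_along_trans)
    ultimately show "\<exists>T\<subseteq>U \<inter> V. x \<in> T \<and> openin (top_of_set (\<psi> ` (U \<inter> V))) (\<psi> ` T) \<and> smooth_along T \<psi> \<phi>"
      using x d(2) by (intro exI[of _ "U \<inter> V \<inter> W"]) auto
  qed
  obtain U \<phi> V \<psi> where cd: "c = (U, \<phi>)" "e = (V, \<psi>)" by (cases c, cases e)
  show ?thesis using half[of U \<phi> V \<psi>] half[of V \<psi> U \<phi>] c e unfolding cd compatible_def by (simp add: Int_commute)
qed

definition generated_atlas :: "('e set \<Rightarrow> bool) \<Rightarrow> 'm topology \<Rightarrow> ('m, 'e) chart set \<Rightarrow> ('m, 'e) chart set" where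
  "generated_atlas Q X A = {c. is_chart Q X c \<and> (\<forall>d\<in>A. compatible c d)}"

lemma generated_atlas_maximal:
  assumes Q: "admissible Q" and A: "is_atlas Q X A"
  shows "is_maximal_atlas Q X (generated_atlas Q X A)" "A \<subseteq> generated_atlas Q X A"
proof -
  have chA: "is_chart Q X c" if "c \<in> A" for c using A that unfolding is_atlas_iff[OF Q] by blast
  have covA: "\<Union> (fst ` A) = topspace X" using A unfolding is_atlas_iff[OF Q] by blast
  have cmpA: "compatible c d" if "c \<in> A" "d \<in> A" for c d using A that unfolding is_atlas_iff[OF Q] by blast
  have gen: "is_chart Q X c" "d \<in> A \<Longrightarrow> compatible c d" if "c \<in> generated_atlas Q X A" for c d
    using that by (simp_all add: generated_atlas_def)
  show sub: "A \<subseteq> generated_atlas Q X A" using chA cmpA by (auto simp: generated_atlas_def)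
  have "\<Union> (fst ` generated_atlas Q X A) = topspace X"
  proof
    show "\<Union> (fst ` generated_atlas Q X A) \<subseteq> topspace X"
      by (rule UN_least) (rule is_chart_subset[OF gen(1)])
    show "topspace X \<subseteq> \<Union> (fst ` generated_atlas Q X A)"
      unfolding covA[symmetric] using sub by (intro Union_mono image_mono)
  qed
  moreover have "compatible c d" if "c \<in> generated_atlas Q X A" "d \<in> generated_atlas Q X A" for c d
    by (rule compatible_via_atlas[OF Q chA _ gen(1)[OF that(1)] gen(2)[OF that(1)] gen(1)[OF that(2)] gen(2)[OF that(2)]])
      (simp_all add: covA)
  ultimately have at: "is_atlas Q X (generated_atlas Q X A)"
    unfolding is_atlas_iff[OF Q] using gen(1) by blast
  have "C \<subseteq> generated_atlas Q X A" if "is_atlas Q X C" "generated_atlas Q X A \<subseteq> C" for C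
  proof
    fix c assume c: "c \<in> C"
    have "is_chart Q X c" "\<And>d. d \<in> C \<Longrightarrow> compatible c d"
      using that(1) c unfolding is_atlas_iff[OF Q] by blast+
    then show "c \<in> generated_atlas Q X A"
      using sub that(2) unfolding generated_atlas_def by blast
  qed
  with at show "is_maximal_atlas Q X (generated_atlas Q X A)" unfolding is_maximal_atlas_def by blast
qed

text \<open>
  Every subfamily of a maximal atlas which still covers the space generates the same maximal atlas.
\<close>

lemma maximal_atlas_mem:
  assumes Q: "admissible Q" and A: "is_maximal_atlas Q X A"
    and A2: "A2 \<subseteq> A" "topspace X \<subseteq> \<Union> (fst ` A2)" and c: "is_chart Q X c" "\<And>d. d \<in> A2 \<Longrightarrow> compatible c d"
  shows "c \<in> A"
proof -
  have at: "is_atlas Q X A" using A by (simp add: is_maximal_atlas_def)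
  note A' = at[unfolded is_atlas_iff[OF Q]]
  have at2: "is_atlas Q X A2" unfolding is_atlas_iff[OF Q] using A' A2 by blast
  have "A \<subseteq> generated_atlas Q X A2" using A' A2 by (auto simp: generated_atlas_def)
  then have "generated_atlas Q X A2 = A"
    using A generated_atlas_maximal(1)[OF Q at2] unfolding is_maximal_atlas_def by blast
  moreover have "c \<in> generated_atlas Q X A2" using c by (simp add: generated_atlas_def)
  ultimately show ?thesis by simp
qed

lemma maximal_atlas_restrict:
  fixes A :: "('m, 'e) chart set"
  assumes Q: "admissible Q" and A: "is_maximal_atlas Q X A" and c: "(U, \<phi>) \<in> A"
    and W: "openin X W" "W \<subseteq> U" and eq: "\<And>x. x \<in> W \<Longrightarrow> \<phi>' x = \<phi> x"
  shows "(W, \<phi>') \<in> A"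
proof (rule maximal_atlas_mem[OF Q A subset_refl])
  have A': "is_atlas Q X A" using A by (simp add: is_maximal_atlas_def)
  note A' = this[unfolded is_atlas_iff[OF Q]]
  show "topspace X \<subseteq> \<Union> (fst ` A)" using A' by simp
  have ch: "is_chart Q X (U, \<phi>)" using A' c by blast
  have r: "is_chart Q X (W, \<phi>)"
    by (rule is_chart_restrict[where Q' = Q, OF ch W]) (rule chart_overlap_calculus_domain(2)[OF Q ch W])
  have im: "\<phi>' ` W = \<phi> ` W" using eq by (intro image_cong) auto
  have "homeomorphic_map (subtopology X W) (top_of_set (\<phi> ` W)) \<phi>'"
    using homeomorphic_map_eq[OF is_chartD(5)[OF r], of \<phi>'] eq by auto
  then show "is_chart Q X (W, \<phi>')" using r im by (simp add: is_chart_def)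
  fix d assume d: "d \<in> A"
  have *: "compatible (U, \<phi>) d" using A' c d by blast
  have **: "smooth_along (W \<inter> fst d) \<phi> (snd d)" "smooth_along (W \<inter> fst d) (snd d) \<phi>"
    using * W(2) unfolding compatible_def by (auto intro: smooth_along_subset)
  show "compatible (W, \<phi>') d" unfolding compatible_def fst_conv snd_conv
    using smooth_along_cong[OF **(1), of \<phi>' "snd d"] smooth_along_cong[OF **(2), of "snd d" \<phi>'] eq by simp
qed

definition pullback_chart :: "'n topology \<Rightarrow> ('n \<Rightarrow> 'm) \<Rightarrow> ('m, 'e) chart \<Rightarrow> ('n, 'e) chart" where
  "pullback_chart Y \<gamma> c = (\<gamma> -` fst c \<inter> topspace Y, snd c \<circ> \<gamma>)"

lemma compatible_pullback: "compatible c d \<Longrightarrow> compatible (pullback_chart Y \<gamma> c) (pullback_chart Y \<gamma> d)"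
  unfolding compatible_def pullback_chart_def by (auto elim!: smooth_along_comp)

lemma is_atlas_pullback:
  assumes Q: "admissible Q" and A: "is_atlas Q X A" and g: "homeomorphic_map Y X \<gamma>"
  shows "is_atlas Q Y (pullback_chart Y \<gamma> ` A)"
proof -
  note A' = A[unfolded is_atlas_iff[OF Q]]
  have "is_chart Q Y (pullback_chart Y \<gamma> c)" if "c \<in> A" for c
    using is_chart_pullback(1)[OF _ g, of Q "fst c" "snd c"] A' that by (simp add: pullback_chart_def)
  moreover have "\<Union> (fst ` pullback_chart Y \<gamma> ` A) = topspace Y"
  proof -
    have "\<Union> (fst ` pullback_chart Y \<gamma> ` A) = \<gamma> -` \<Union> (fst ` A) \<inter> topspace Y"
      by (auto simp: pullback_chart_def)
    then show ?thesis using A' homeomorphic_imp_surjective_map[OF g] by auto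
  qed
  moreover have "compatible (pullback_chart Y \<gamma> c) (pullback_chart Y \<gamma> d)" if "c \<in> A" "d \<in> A" for c d
    by (rule compatible_pullback) (use A' that in blast)
  ultimately show ?thesis unfolding is_atlas_iff[OF Q] by blast
qed

end

section \<open>Pushing a compact manifold into its interior\<close>

context finite_basis begin

text \<open>
  Let \<open>c\<close> be an interior point of the polytope.  Points \<open>x\<close> near \<open>p\<close> move into the interior along
  \<open>v = c - p\<close>, because \<open>x + v = c + (x - p)\<close> is close to \<open>c\<close> and hence interior.  So \<open>F x = x + \<epsilon> \<rho> x v\<close> with
  a bump function \<open>\<rho>\<close> pushes a neighbourhood of \<open>p\<close> into the interior, and for small \<open>\<epsilon>\<close> it is a
  \<open>1/2\<close>-Lipschitz perturbation of the identity, hence injective with injective derivatives.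
\<close>

lemma local_push:
  assumes V: "open_in_polytope (V :: 'e set)" and p: "p \<in> V"
  obtains F :: "'e \<Rightarrow> 'e" and K N where "Cinf_on UNIV F" "inj F"
    "\<And>x. \<exists>D. (F has_derivative D) (at x) \<and> inj D" "F ` V \<subseteq> V"
    "compact K" "K \<subseteq> V" "\<And>x. x \<in> V - K \<Longrightarrow> F x = x"
    "open N" "p \<in> N" "\<And>x. x \<in> V \<inter> N \<Longrightarrow> F x \<in> interior V"
    "\<And>x. x \<in> V \<Longrightarrow> F x = x \<or> F x \<in> interior V"
proof -
  obtain P where P: "polytope_with_interior P" "openin (top_of_set P) V"
    using V unfolding open_in_polytope_def by blast
  obtain W where W: "open W" "V = P \<inter> W" using P(2) unfolding openin_open by blast
  have polyP: "polytope P" using P(1) by (simp add: polytope_with_interior_def)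
  have convP: "convex P" using polyP by (rule polytope_imp_convex)
  have compP: "compact P" using polyP by (rule polytope_imp_compact)
  obtain c where c: "c \<in> interior P" using P(1) by (auto simp: polytope_with_interior_def)
  obtain e where e: "e > 0" "ball c e \<subseteq> interior P"
    using openE[OF open_interior c] by blast
  obtain s where s: "s > 0" "ball p s \<subseteq> W" using W p openE by blast
  define r where "r = min e (s / 2)"
  have r: "r > 0" "r \<le> e" "2 * r \<le> s" using e s by (auto simp: r_def)
  define v where "v = c - p"
  obtain \<rho> where \<rho>: "Cinf_on UNIV \<rho>" "\<rho> p > 0" "\<And>x. \<rho> x \<ge> (0::real)" "\<And>x. x \<notin> ball p r \<Longrightarrow> \<rho> x = 0"
    using bump_function[OF r(1), of p] by blast
  have bd: "bCn_on k UNIV \<rho>" for k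
    by (rule Cn_on_compact_support_bounded[where p = p and s = r])
      (use \<rho>(1,4) in \<open>auto simp: Cinf_on_def open_imp_calculus_domain\<close>)
  obtain D where D: "\<And>x. (\<rho> has_derivative D x) (at x)" "\<And>h. bCn_on 0 UNIV (\<lambda>x. D x h)"
    using bd[of "Suc 0"] unfolding bCn_on.simps(2) by blast
  obtain L where L: "L \<ge> 0" "\<And>x h. \<bar>D x h\<bar> \<le> L * norm h"
    using bounded_derivative_uniform[of UNIV D] has_derivative_linear[OF D(1)] bCn_on_bounded[OF D(2)] by blast
  obtain R where R: "\<And>x. \<rho> x \<le> R" "R > 0"
  proof -
    obtain R where "\<And>x. \<bar>\<rho> x\<bar> \<le> R" using bCn_on_bounded[OF bd[of 0]] by (auto simp: bounded_image_iff)
    then have "\<rho> x \<le> \<bar>R\<bar> + 1" for x by (smt (verit))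
    then show ?thesis using that[of "\<bar>R\<bar> + 1"] by auto
  qed
  define n m where "n = norm v + 1" and "m = L + 1"
  have nm: "n > 0" "norm v \<le> n" "m > 0" "L \<le> m" using L(1) by (auto simp: n_def m_def add_nonneg_pos)
  \<comment> \<open>the three bounds keep the step a convex combination, the displacement below \<open>r\<close>, and the
    Lipschitz constant at most \<open>1/2\<close>\<close>
  define \<epsilon> where "\<epsilon> = min (1 / R) (min (r / (2 * R * n)) (1 / (2 * m * n)))"
  have \<epsilon>: "\<epsilon> > 0" using R r nm by (simp add: \<epsilon>_def)
  have \<epsilon>1: "\<epsilon> * R \<le> 1"
    using mult_right_mono[of \<epsilon> "1 / R" R] R by (simp add: \<epsilon>_def)
  have \<epsilon>2: "\<epsilon> * R * norm v < r"
  proof -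
    have "\<epsilon> * R * norm v \<le> (r / (2 * R * n)) * R * n"
      using R r nm \<epsilon> by (intro mult_mono) (auto simp: \<epsilon>_def)
    also have "\<dots> = r / 2" using R nm by (simp add: field_simps)
    finally show ?thesis using r by simp
  qed
  have \<epsilon>3: "\<epsilon> * L * norm v \<le> 1 / 2"
  proof -
    have "\<epsilon> * L * norm v \<le> (1 / (2 * m * n)) * m * n"
      using L nm \<epsilon> by (intro mult_mono) (auto simp: \<epsilon>_def)
    also have "\<dots> = 1 / 2" using nm by (simp add: field_simps)
    finally show ?thesis .
  qed
  define F where "F = (\<lambda>x. x + (\<epsilon> * \<rho> x) *\<^sub>R v)"
  have F_Cinf: "Cinf_on UNIV F" unfolding Cinf_on_def F_def
    using \<rho>(1) by (auto simp: Cinf_on_def intro!: Cn_on_add Cn_on_id Cn_on_scaleR Cn_on_mult Cn_on_const)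
  have lip: "\<bar>\<rho> x - \<rho> y\<bar> \<le> L * norm (x - y)" for x y
  proof -
    have "norm (\<rho> x - \<rho> y) \<le> L * norm (x - y)"
      by (rule differentiable_bound[where f = \<rho> and f' = D and S = UNIV])
        (use D(1) L in \<open>auto intro!: onorm_bound\<close>)
    then show ?thesis by simp
  qed
  have "inj F"
  proof (rule injI)
    fix x y assume "F x = F y"
    then have "x - y = (\<epsilon> * (\<rho> y - \<rho> x)) *\<^sub>R v" by (simp add: F_def algebra_simps)
    then have "norm (x - y) = \<epsilon> * \<bar>\<rho> y - \<rho> x\<bar> * norm v" using \<epsilon> by (simp add: abs_mult)
    also have "\<dots> \<le> \<epsilon> * (L * norm (x - y)) * norm v"
      using lip[of y x] \<epsilon> by (intro mult_right_mono mult_left_mono) (auto simp: norm_minus_commute)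
    also have "\<dots> = (\<epsilon> * L * norm v) * norm (x - y)" by simp
    also have "\<dots> \<le> (1/2) * norm (x - y)" using \<epsilon>3 by (rule mult_right_mono) simp
    finally show "x = y" by simp
  qed
  moreover have "\<exists>D. (F has_derivative D) (at x) \<and> inj D" for x
  proof (intro exI conjI)
    show "(F has_derivative (\<lambda>h. h + (\<epsilon> * D x h) *\<^sub>R v)) (at x)"
      unfolding F_def by (intro has_derivative_add has_derivative_ident has_derivative_scaleR_left
          has_derivative_mult_right D(1))
    show "inj (\<lambda>h. h + (\<epsilon> * D x h) *\<^sub>R v)"
    proof (rule injI)
      fix a b assume "a + (\<epsilon> * D x a) *\<^sub>R v = b + (\<epsilon> * D x b) *\<^sub>R v"
      then have "a - b = (\<epsilon> * (D x b - D x a)) *\<^sub>R v" by (simp add: algebra_simps)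
      also have "D x b - D x a = D x (b - a)" using has_derivative_linear[OF D(1)] by (simp add: linear_diff)
      finally have "norm (a - b) = \<epsilon> * \<bar>D x (b - a)\<bar> * norm v" using \<epsilon> by (simp add: abs_mult)
      also have "\<dots> \<le> \<epsilon> * (L * norm (a - b)) * norm v"
        using L(2)[of x "b - a"] \<epsilon> by (intro mult_right_mono mult_left_mono) (auto simp: norm_minus_commute)
      also have "\<dots> = (\<epsilon> * L * norm v) * norm (a - b)" by simp
      also have "\<dots> \<le> (1/2) * norm (a - b)" using \<epsilon>3 by (rule mult_right_mono) simp
      finally show "a = b" by simp
    qed
  qed
  moreover have pushed: "F x \<in> interior V" if x: "x \<in> V" "\<rho> x > 0" for x
  proof -
    have xb: "x \<in> ball p r" using \<rho>(4)[of x] x(2) by force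
    define t where "t = \<epsilon> * \<rho> x"
    have tR: "t \<le> \<epsilon> * R" unfolding t_def using R(1) \<epsilon> by (intro mult_left_mono) auto
    have t: "0 < t" "t \<le> 1" using \<epsilon> x(2) order.trans[OF tR \<epsilon>1] by (simp_all add: t_def)
    have "c + (x - p) \<in> ball c e" using xb r by (auto simp: dist_norm norm_minus_commute)
    then have "x + t *\<^sub>R ((c + (x - p)) - x) \<in> interior P"
      using convex_shrink_interior[OF convP _ _ t] e(2) x(1) W(2) by blast
    then have FP: "F x \<in> interior P" by (simp add: F_def t_def v_def)
    have "dist p (F x) \<le> dist p x + t * norm v"
      using dist_triangle[of p "F x" x] t by (simp add: F_def t_def dist_norm)
    also have "t * norm v \<le> \<epsilon> * R * norm v" using tR by (rule mult_right_mono) simp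
    finally have "dist p (F x) < 2 * r" using xb \<epsilon>2 by simp
    then have FW: "F x \<in> ball p s" using r(3) by simp
    have "open (interior P \<inter> ball p s)" by (intro open_Int open_interior open_ball)
    moreover have "interior P \<inter> ball p s \<subseteq> V" using s(2) interior_subset[of P] W(2) by blast
    ultimately show ?thesis using FP FW by (meson IntI interiorI)
  qed
  moreover have F0: "F x = x" if "\<not> \<rho> x > 0" for x
    using \<rho>(3)[of x] that by (simp add: F_def)
  moreover have FV: "F ` V \<subseteq> V"
  proof (rule image_subsetI)
    fix x assume "x \<in> V"
    then show "F x \<in> V" using pushed[of x] F0[of x] interior_subset[of V] by (cases "\<rho> x > 0") auto
  qed
  moreover have "compact (P \<inter> cball p r)" using compP by (rule compact_Int_closed) simp
  moreover have "P \<inter> cball p r \<subseteq> V"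
  proof -
    have "cball p r \<subseteq> ball p s" using r by auto
    then show ?thesis using s(2) W(2) by blast
  qed
  moreover have "F x = x" if "x \<in> V - (P \<inter> cball p r)" for x
  proof -
    have "x \<notin> ball p r" using that W(2) by auto
    then show ?thesis using \<rho>(4) by (simp add: F_def)
  qed
  moreover have "open {x. \<rho> x > 0}"
    using Cinf_on_continuous[OF \<rho>(1)] by (intro open_Collect_less continuous_on_const)
  ultimately show ?thesis
    using that[of F "P \<inter> cball p r" "{x. \<rho> x > 0}"] F_Cinf \<rho>(2) by blast
qed

end

text \<open>
  In addition to smoothness the derivative is injective; this is what the inverse function theorem
  needs later on.
\<close>

definition immersed_along :: "'m set \<Rightarrow> ('m \<Rightarrow> 'e::real_normed_vector) \<Rightarrow> ('m \<Rightarrow> 'e) \<Rightarrow> bool" where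
  "immersed_along S \<psi> \<phi> \<longleftrightarrow> (\<exists>F. Cinf_on (\<psi> ` S) F \<and> (\<forall>x\<in>S. F (\<psi> x) = \<phi> x) \<and>
     (\<forall>x\<in>S. \<exists>D. (F has_derivative D) (at (\<psi> x) within \<psi> ` S) \<and> inj D))"

lemma immersed_along_comp:
  assumes "immersed_along T \<psi> \<phi>" "f ` S \<subseteq> T"
  shows "immersed_along S (\<psi> \<circ> f) (\<phi> \<circ> f)"
proof -
  obtain F where F: "Cinf_on (\<psi> ` T) F" "\<And>x. x \<in> T \<Longrightarrow> F (\<psi> x) = \<phi> x"
    "\<And>x. x \<in> T \<Longrightarrow> \<exists>D. (F has_derivative D) (at (\<psi> x) within \<psi> ` T) \<and> inj D"
    using assms(1) by (auto simp: immersed_along_def)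
  have sub: "(\<psi> \<circ> f) ` S \<subseteq> \<psi> ` T" using assms(2) by auto
  show ?thesis unfolding immersed_along_def
  proof (rule exI[of _ F], intro conjI ballI)
    show "Cinf_on ((\<psi> \<circ> f) ` S) F" using F(1) sub by (rule Cinf_on_subset)
    fix x assume "x \<in> S"
    then have fx: "f x \<in> T" using assms(2) by blast
    show "F ((\<psi> \<circ> f) x) = (\<phi> \<circ> f) x" using F(2)[OF fx] by simp
    show "\<exists>D. (F has_derivative D) (at ((\<psi> \<circ> f) x) within (\<psi> \<circ> f) ` S) \<and> inj D"
      using F(3)[OF fx] has_derivative_subset[OF _ sub] by fastforce
  qed
qed

lemma immersed_along_subset: "immersed_along S \<psi> \<phi> \<Longrightarrow> T \<subseteq> S \<Longrightarrow> immersed_along T \<psi> \<phi>"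
  using immersed_along_comp[of S \<psi> \<phi> "\<lambda>x. x" T] by (simp add: o_def)

lemma (in finite_basis) immersed_along_trans:
  assumes "immersed_along S \<psi> (\<eta> :: 'm \<Rightarrow> 'e)" "immersed_along S \<eta> \<phi>"
  shows "immersed_along S \<psi> \<phi>"
proof -
  obtain F where F: "Cinf_on (\<psi> ` S) F" "\<And>x. x \<in> S \<Longrightarrow> F (\<psi> x) = \<eta> x"
    "\<And>x. x \<in> S \<Longrightarrow> \<exists>D. (F has_derivative D) (at (\<psi> x) within \<psi> ` S) \<and> inj D"
    using assms(1) by (auto simp: immersed_along_def)
  obtain G where G: "Cinf_on (\<eta> ` S) G" "\<And>x. x \<in> S \<Longrightarrow> G (\<eta> x) = \<phi> x"
    "\<And>x. x \<in> S \<Longrightarrow> \<exists>D. (G has_derivative D) (at (\<eta> x) within \<eta> ` S) \<and> inj D"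
    using assms(2) by (auto simp: immersed_along_def)
  have im: "F ` \<psi> ` S = \<eta> ` S" using F(2) by force
  show ?thesis unfolding immersed_along_def
  proof (rule exI[of _ "\<lambda>y. G (F y)"], intro conjI ballI)
    show "Cinf_on (\<psi> ` S) (\<lambda>y. G (F y))" by (rule Cinf_on_compose[OF G(1) F(1)]) (simp add: im)
    fix x assume x: "x \<in> S"
    show "G (F (\<psi> x)) = \<phi> x" using F(2) G(2) x by simp
    obtain D where D: "(F has_derivative D) (at (\<psi> x) within \<psi> ` S)" "inj D" using F(3)[OF x] by blast
    obtain E where E: "(G has_derivative E) (at (\<eta> x) within \<eta> ` S)" "inj E" using G(3)[OF x] by blast
    have "(G has_derivative E) (at (F (\<psi> x)) within F ` \<psi> ` S)" using E(1) F(2)[OF x] im by simp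
    from has_derivative_in_compose[OF D(1) this]
    have "((\<lambda>y. G (F y)) has_derivative (\<lambda>h. E (D h))) (at (\<psi> x) within \<psi> ` S)" .
    moreover have "inj (\<lambda>h. E (D h))" using inj_compose[OF E(2) D(2)] by (simp add: o_def)
    ultimately show "\<exists>D. ((\<lambda>y. G (F y)) has_derivative D) (at (\<psi> x) within \<psi> ` S) \<and> inj D" by blast
  qed
qed

text \<open>
  By the chain rule, the derivatives of both transitions are inverse to each other; here the
  derivative of the identity within the domain must be unique.
\<close>

lemma smooth_along_imp_immersed:
  assumes "smooth_along S \<psi> \<phi>" "smooth_along S \<phi> \<psi>" "calculus_domain (\<psi> ` S)"
  shows "immersed_along S \<psi> \<phi>"
proof -
  obtain F where F: "Cinf_on (\<psi> ` S) F" "\<And>x. x \<in> S \<Longrightarrow> F (\<psi> x) = \<phi> x" using assms(1) by (auto simp: smooth_along_def)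
  obtain G where G: "Cinf_on (\<phi> ` S) G" "\<And>x. x \<in> S \<Longrightarrow> G (\<phi> x) = \<psi> x" using assms(2) by (auto simp: smooth_along_def)
  have im: "F ` \<psi> ` S = \<phi> ` S" using F(2) by force
  show ?thesis unfolding immersed_along_def
  proof (rule exI[of _ F], intro conjI ballI F)
    fix x assume x: "x \<in> S"
    obtain D where D: "\<And>y. y \<in> \<psi> ` S \<Longrightarrow> (F has_derivative D y) (at y within \<psi> ` S)"
      using F(1) unfolding Cinf_on_def by (metis Cn_on.simps(2))
    obtain E where E: "\<And>y. y \<in> \<phi> ` S \<Longrightarrow> (G has_derivative E y) (at y within \<phi> ` S)"
      using G(1) unfolding Cinf_on_def by (metis Cn_on.simps(2))
    have px: "\<psi> x \<in> \<psi> ` S" using x by blast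
    have "(G has_derivative E (\<phi> x)) (at (F (\<psi> x)) within F ` \<psi> ` S)"
      unfolding im F(2)[OF x] using E x by blast
    from has_derivative_in_compose[OF D[OF px] this]
    have "((\<lambda>y. G (F y)) has_derivative (\<lambda>h. E (\<phi> x) (D (\<psi> x) h))) (at (\<psi> x) within \<psi> ` S)" .
    then have "((\<lambda>y. y) has_derivative (\<lambda>h. E (\<phi> x) (D (\<psi> x) h))) (at (\<psi> x) within \<psi> ` S)"
      by (rule has_derivative_transform[OF px, rotated]) (use F(2) G(2) in auto)
    from calculus_domain_has_derivative_unique[OF assms(3) px this has_derivative_ident]
    have "E (\<phi> x) (D (\<psi> x) h) = h" for h by metis
    then have "inj (D (\<psi> x))" by (metis injI)
    then show "\<exists>D. (F has_derivative D) (at (\<psi> x) within \<psi> ` S) \<and> inj D" using D[OF px] by blast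
  qed
qed

locale compact_polyhedral = finite_basis B for B :: "'e::real_normed_vector set" +
  fixes M :: "'m topology" and A :: "('m, 'e) chart set"
  assumes Hausdorff: "Hausdorff_space M" and maximal: "is_maximal_atlas open_in_polytope M A"
    and compact: "compact_space M"
begin

lemma chart: "c \<in> A \<Longrightarrow> is_chart open_in_polytope M c"
  and cover: "\<Union> (fst ` A) = topspace M"
  and compat: "c \<in> A \<Longrightarrow> d \<in> A \<Longrightarrow> compatible c d"
  using maximal unfolding is_maximal_atlas_def is_atlas_iff[OF admissible_open_in_polytope] by blast+

lemma transition_immersed:
  assumes "(U, \<phi>) \<in> A" "(V, \<psi>) \<in> A" "openin M S" "S \<subseteq> U \<inter> V"
  shows "immersed_along S \<phi> \<psi>"
proof (rule smooth_along_imp_immersed)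
  show "smooth_along S \<phi> \<psi>" "smooth_along S \<psi> \<phi>"
    using compat[OF assms(1,2)] assms(4) by (auto simp: compatible_def intro: smooth_along_subset)
  show "calculus_domain (\<phi> ` S)"
    using chart_overlap_calculus_domain(1)[OF admissible_open_in_polytope chart[OF assms(1)] assms(3)] assms(4) by blast
qed

text \<open>
  Smooth injective immersions of \<open>M\<close> into itself; they may take boundary points to interior points.
\<close>

definition smooth_injection :: "('m \<Rightarrow> 'm) \<Rightarrow> bool" where
  "smooth_injection \<Phi> \<longleftrightarrow> continuous_map M M \<Phi> \<and> inj_on \<Phi> (topspace M) \<and>
     (\<forall>x\<in>topspace M. \<forall>U \<phi> V \<psi>. (U, \<phi>) \<in> A \<longrightarrow> (V, \<psi>) \<in> A \<longrightarrow> x \<in> U \<longrightarrow> \<Phi> x \<in> V \<longrightarrow>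
       (\<exists>S. openin M S \<and> x \<in> S \<and> S \<subseteq> U \<and> \<Phi> ` S \<subseteq> V \<and> immersed_along S \<phi> (\<psi> \<circ> \<Phi>)))"

lemma smooth_injection_id: "smooth_injection (\<lambda>x. x)"
  unfolding smooth_injection_def
proof (intro conjI ballI allI impI)
  fix x U \<phi> V \<psi> assume *: "(U, \<phi>) \<in> A" "(V, \<psi>) \<in> A" "x \<in> U" "x \<in> V"
  have o: "openin M (U \<inter> V)" using is_chartD(1)[OF chart[OF *(1)]] is_chartD(1)[OF chart[OF *(2)]] by blast
  have "immersed_along (U \<inter> V) \<phi> \<psi>" by (rule transition_immersed[OF *(1,2) o]) simp
  then show "\<exists>S. openin M S \<and> x \<in> S \<and> S \<subseteq> U \<and> (\<lambda>x. x) ` S \<subseteq> V \<and> immersed_along S \<phi> (\<psi> \<circ> (\<lambda>x. x))"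
    using o * by (intro exI[of _ "U \<inter> V"]) (auto simp: o_def)
qed auto

lemma smooth_injection_comp:
  assumes "smooth_injection \<Phi>" "smooth_injection \<Psi>"
  shows "smooth_injection (\<lambda>x. \<Phi> (\<Psi> x))"
  unfolding smooth_injection_def
proof (intro conjI ballI allI impI)
  have c: "continuous_map M M \<Psi>" "continuous_map M M \<Phi>" and i: "inj_on \<Psi> (topspace M)" "inj_on \<Phi> (topspace M)"
    using assms by (auto simp: smooth_injection_def)
  show "continuous_map M M (\<lambda>x. \<Phi> (\<Psi> x))" using continuous_map_compose[OF c] by (simp add: o_def)
  have sub: "\<Psi> ` topspace M \<subseteq> topspace M" using continuous_map_image_subset_topspace[OF c(1)] .
  show "inj_on (\<lambda>x. \<Phi> (\<Psi> x)) (topspace M)"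
    using comp_inj_on[OF i(1) inj_on_subset[OF i(2) sub]] by (simp add: o_def)
  fix x U \<phi> V \<psi> assume *: "x \<in> topspace M" "(U, \<phi>) \<in> A" "(V, \<psi>) \<in> A" "x \<in> U" "\<Phi> (\<Psi> x) \<in> V"
  have px: "\<Psi> x \<in> topspace M" using sub *(1) by blast
  then obtain W \<eta> where W: "(W, \<eta>) \<in> A" "\<Psi> x \<in> W" using cover by fastforce
  obtain S1 where S1: "openin M S1" "x \<in> S1" "S1 \<subseteq> U" "\<Psi> ` S1 \<subseteq> W" "immersed_along S1 \<phi> (\<eta> \<circ> \<Psi>)"
    using assms(2) *(1,2,4) W unfolding smooth_injection_def by blast
  obtain S2 where S2: "openin M S2" "\<Psi> x \<in> S2" "S2 \<subseteq> W" "\<Phi> ` S2 \<subseteq> V" "immersed_along S2 \<eta> (\<psi> \<circ> \<Phi>)"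
    using assms(1) px *(3,5) W unfolding smooth_injection_def by blast
  define S where "S = S1 \<inter> {x \<in> topspace M. \<Psi> x \<in> S2}"
  have "openin M S" unfolding S_def by (intro openin_Int S1(1) openin_continuous_map_preimage[OF c(1) S2(1)])
  moreover have "x \<in> S" using S1(2) S2(2) *(1) by (simp add: S_def)
  moreover have "immersed_along S \<phi> (\<psi> \<circ> (\<lambda>x. \<Phi> (\<Psi> x)))"
  proof (rule immersed_along_trans)
    show "immersed_along S \<phi> (\<eta> \<circ> \<Psi>)" using S1(5) by (rule immersed_along_subset) (simp add: S_def)
    have "immersed_along S (\<eta> \<circ> \<Psi>) ((\<psi> \<circ> \<Phi>) \<circ> \<Psi>)"
      using S2(5) by (rule immersed_along_comp) (auto simp: S_def)
    then show "immersed_along S (\<eta> \<circ> \<Psi>) (\<psi> \<circ> (\<lambda>x. \<Phi> (\<Psi> x)))" by (simp add: o_def)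
  qed
  moreover have "S \<subseteq> U" "(\<lambda>x. \<Phi> (\<Psi> x)) ` S \<subseteq> V" using S1(3) S2(4) by (auto simp: S_def)
  ultimately show "\<exists>S. openin M S \<and> x \<in> S \<and> S \<subseteq> U \<and> (\<lambda>x. \<Phi> (\<Psi> x)) ` S \<subseteq> V \<and>
      immersed_along S \<phi> (\<psi> \<circ> (\<lambda>x. \<Phi> (\<Psi> x)))" by blast
qed

definition inner_part :: "('m, 'e) chart \<Rightarrow> 'm set" where
  "inner_part c = {x \<in> fst c. snd c x \<in> interior (snd c ` fst c)}"

text \<open>
  The local push has compact support in the chart domain and therefore extends by the identity to
  all of \<open>M\<close>; the support is closed as \<open>M\<close> is Hausdorff.
\<close>

lemma chart_push:
  assumes c: "c \<in> A" and p: "p \<in> fst c"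
  shows "\<exists>\<Psi> N. smooth_injection \<Psi> \<and> openin M N \<and> p \<in> N \<and> N \<subseteq> fst c \<and> (\<forall>x\<in>N. \<Psi> x \<in> inner_part c) \<and>
    (\<forall>x\<in>topspace M. \<Psi> x = x \<or> \<Psi> x \<in> inner_part c)"
proof -
  obtain U \<phi> where U: "c = (U, \<phi>)" by (cases c)
  have UA: "(U, \<phi>) \<in> A" and pU: "p \<in> U" using c p U by auto
  note ch = chart[OF UA]
  note inj = is_chartD(4)[OF ch]
  obtain F K N where F: "Cinf_on UNIV F" "inj F" "\<And>x. \<exists>D. (F has_derivative D) (at x) \<and> inj D"
    "F ` (\<phi> ` U) \<subseteq> \<phi> ` U" and K: "compact K" "K \<subseteq> \<phi> ` U" "\<And>x. x \<in> \<phi> ` U - K \<Longrightarrow> F x = x"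
    and N: "open N" "\<phi> p \<in> N" "\<And>x. x \<in> \<phi> ` U \<inter> N \<Longrightarrow> F x \<in> interior (\<phi> ` U)"
    and FI: "\<And>x. x \<in> \<phi> ` U \<Longrightarrow> F x = x \<or> F x \<in> interior (\<phi> ` U)"
    by (rule local_push[OF is_chartD(3)[OF ch] imageI[OF pU]]) (rule that; assumption)
  define \<Psi> where "\<Psi> = (\<lambda>x. if x \<in> U then inv_into U \<phi> (F (\<phi> x)) else x)"
  have PsiU: "\<Psi> x \<in> U" "\<phi> (\<Psi> x) = F (\<phi> x)" if "x \<in> U" for x
  proof -
    have *: "F (\<phi> x) \<in> \<phi> ` U" using F(4) that by blast
    show "\<Psi> x \<in> U" "\<phi> (\<Psi> x) = F (\<phi> x)"
      using that inv_into_into[OF *] f_inv_into_f[OF *] by (simp_all add: \<Psi>_def)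
  qed
  define K' where "K' = {x \<in> U. \<phi> x \<in> K}"
  have "compactin (subtopology M U) K'"
  proof -
    have "\<phi> ` K' = K" using K(2) by (auto simp: K'_def)
    moreover have "compactin (top_of_set (\<phi> ` U)) K" using K(1,2) by (simp add: compactin_subtopology)
    moreover have "K' \<subseteq> topspace (subtopology M U)" using is_chartD(6)[OF ch] by (auto simp: K'_def)
    ultimately show ?thesis using homeomorphic_map_compactness[OF is_chartD(5)[OF ch]] by metis
  qed
  then have "compactin M K'" by (simp add: compactin_subtopology)
  then have "closedin M K'" by (rule compactin_imp_closedin[OF Hausdorff])
  then have openK: "openin M (topspace M - K')" by blast
  have fixed: "\<Psi> x = x" if "x \<in> topspace M - K'" for x
  proof (cases "x \<in> U")
    case True
    then have "F (\<phi> x) = \<phi> x" using K(3) that by (auto simp: K'_def)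
    then show ?thesis using True inj by (simp add: \<Psi>_def)
  qed (simp add: \<Psi>_def)
  have contF: "continuous_on (\<phi> ` U) F" using Cinf_on_continuous[OF F(1)] continuous_on_subset by blast
  have cont: "continuous_map M M \<Psi>" unfolding continuous_map_def
  proof (intro conjI allI impI)
    have "\<Psi> x \<in> topspace M" if "x \<in> topspace M" for x
      using PsiU(1)[of x] is_chartD(2)[OF ch] that by (cases "x \<in> U") (blast, simp add: \<Psi>_def)
    then show "\<Psi> \<in> topspace M \<rightarrow> topspace M" by blast
    fix G assume G: "openin M G"
    have "openin (top_of_set (\<phi> ` U)) (\<phi> ` (G \<inter> U))"
      using is_chart_image_open[OF ch, of "G \<inter> U"] G is_chartD(1)[OF ch] by auto
    then have "openin (top_of_set (\<phi> ` U)) (\<phi> ` U \<inter> F -` (\<phi> ` (G \<inter> U)))"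
      by (rule continuous_openin_preimage[OF contF, rotated]) (use F(4) in auto)
    from is_chart_preimage_open[OF ch this]
    have o: "openin M {x \<in> U. \<phi> x \<in> \<phi> ` U \<inter> F -` (\<phi> ` (G \<inter> U))}" .
    have "{x \<in> topspace M. \<Psi> x \<in> G} = {x \<in> U. \<phi> x \<in> \<phi> ` U \<inter> F -` (\<phi> ` (G \<inter> U))} \<union> ((topspace M - K') \<inter> G)"
    proof (intro set_eqI iffI)
      fix x assume x: "x \<in> {x \<in> topspace M. \<Psi> x \<in> G}"
      show "x \<in> {x \<in> U. \<phi> x \<in> \<phi> ` U \<inter> F -` (\<phi> ` (G \<inter> U))} \<union> ((topspace M - K') \<inter> G)"
      proof (cases "x \<in> U")
        case True
        have "F (\<phi> x) \<in> \<phi> ` (G \<inter> U)" using PsiU[OF True] x by (metis IntI image_eqI mem_Collect_eq)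
        then show ?thesis using True by simp
      next
        case False
        then show ?thesis using x by (auto simp: K'_def \<Psi>_def)
      qed
    next
      fix x assume "x \<in> {x \<in> U. \<phi> x \<in> \<phi> ` U \<inter> F -` (\<phi> ` (G \<inter> U))} \<union> ((topspace M - K') \<inter> G)"
      then show "x \<in> {x \<in> topspace M. \<Psi> x \<in> G}"
      proof
        assume x: "x \<in> {x \<in> U. \<phi> x \<in> \<phi> ` U \<inter> F -` (\<phi> ` (G \<inter> U))}"
        then obtain y where y: "y \<in> G \<inter> U" "F (\<phi> x) = \<phi> y" by auto
        have "\<Psi> x = y" using PsiU[of x] x y inj by (auto dest: inj_onD)
        then show ?thesis using x y is_chartD(2)[OF ch] by auto
      next
        assume "x \<in> (topspace M - K') \<inter> G"
        then show ?thesis using fixed[of x] by auto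
      qed
    qed
    then show "openin M {x \<in> topspace M. \<Psi> x \<in> G}" using o openK G by auto
  qed
  have injPsi: "inj_on \<Psi> (topspace M)"
  proof (rule inj_onI)
    fix x y assume "\<Psi> x = \<Psi> y"
    then show "x = y"
      using PsiU[of x] PsiU[of y] injD[OF F(2), of "\<phi> x" "\<phi> y"] inj_onD[OF inj, of x y]
      by (cases "x \<in> U"; cases "y \<in> U") (auto simp: \<Psi>_def split: if_splits)
  qed
  have pushU: "immersed_along S \<phi> (\<phi> \<circ> \<Psi>)" if "S \<subseteq> U" for S
    unfolding immersed_along_def
  proof (rule exI[of _ F], intro conjI ballI)
    show "Cinf_on (\<phi> ` S) F" by (rule Cinf_on_subset[OF F(1)]) simp
    fix x assume "x \<in> S"
    then show "F (\<phi> x) = (\<phi> \<circ> \<Psi>) x" using PsiU(2) that by auto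
    show "\<exists>D. (F has_derivative D) (at (\<phi> x) within \<phi> ` S) \<and> inj D"
      using F(3)[of "\<phi> x"] has_derivative_at_withinI by blast
  qed
  have "smooth_injection \<Psi>" unfolding smooth_injection_def
  proof (intro conjI cont injPsi ballI allI impI)
    fix x U1 \<phi>1 V \<psi> assume *: "x \<in> topspace M" "(U1, \<phi>1) \<in> A" "(V, \<psi>) \<in> A" "x \<in> U1" "\<Psi> x \<in> V"
    note op = is_chartD(1)[OF chart[OF *(2)]] is_chartD(1)[OF chart[OF *(3)]] is_chartD(1)[OF ch]
    show "\<exists>S. openin M S \<and> x \<in> S \<and> S \<subseteq> U1 \<and> \<Psi> ` S \<subseteq> V \<and> immersed_along S \<phi>1 (\<psi> \<circ> \<Psi>)"
    proof (cases "x \<in> U")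
      case True
      define S where "S = U1 \<inter> U \<inter> {x \<in> topspace M. \<Psi> x \<in> V}"
      have S: "openin M S" unfolding S_def
        by (intro openin_Int op openin_continuous_map_preimage[OF cont op(2)])
      have "immersed_along S \<phi>1 \<phi>" by (rule transition_immersed[OF *(2) UA S]) (auto simp: S_def)
      moreover have "immersed_along S \<phi> (\<phi> \<circ> \<Psi>)" by (rule pushU) (auto simp: S_def)
      moreover have "immersed_along S (\<phi> \<circ> \<Psi>) (\<psi> \<circ> \<Psi>)"
      proof (rule immersed_along_comp)
        show "immersed_along (U \<inter> V) \<phi> \<psi>" by (rule transition_immersed[OF UA *(3)]) (use op in auto)
        show "\<Psi> ` S \<subseteq> U \<inter> V" using PsiU(1) by (auto simp: S_def)
      qed
      ultimately have "immersed_along S \<phi>1 (\<psi> \<circ> \<Psi>)" using immersed_along_trans by blast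
      then show ?thesis using S True * by (intro exI[of _ S]) (auto simp: S_def)
    next
      case False
      define S where "S = U1 \<inter> V \<inter> (topspace M - K')"
      have S: "openin M S" unfolding S_def by (intro openin_Int op openK)
      have fx: "\<Psi> y = y" if "y \<in> S" for y using fixed that by (simp add: S_def)
      have "x \<in> V" using False *(5) by (simp add: \<Psi>_def)
      then have xS: "x \<in> S" using False * by (auto simp: S_def K'_def)
      have "immersed_along S \<phi>1 \<psi>" by (rule transition_immersed[OF *(2,3) S]) (auto simp: S_def)
      moreover have "\<psi> x = (\<psi> \<circ> \<Psi>) x" if "x \<in> S" for x using fx[OF that] by simp
      ultimately have "immersed_along S \<phi>1 (\<psi> \<circ> \<Psi>)" unfolding immersed_along_def by metis
      then show ?thesis using S xS fx by (intro exI[of _ S]) (auto simp: S_def)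
    qed
  qed
  moreover have inner: "\<Psi> x \<in> inner_part c" if "x \<in> U" "F (\<phi> x) \<in> interior (\<phi> ` U)" for x
    using PsiU[OF that(1)] that(2) by (simp add: inner_part_def U)
  have "openin M {x \<in> U. \<phi> x \<in> \<phi> ` U \<inter> N}"
    by (rule is_chart_preimage_open[OF ch openin_open_Int[OF N(1)]])
  moreover have "p \<in> {x \<in> U. \<phi> x \<in> \<phi> ` U \<inter> N}" using pU N(2) by auto
  moreover have "\<Psi> x \<in> inner_part c" if "x \<in> {x \<in> U. \<phi> x \<in> \<phi> ` U \<inter> N}" for x
    using inner[of x] N(3) that by blast
  moreover have "\<Psi> x = x \<or> \<Psi> x \<in> inner_part c" if "x \<in> topspace M" for x
  proof (cases "x \<in> U")
    case True
    then show ?thesis using FI[of "\<phi> x"] inner[OF True] inj by (auto simp: \<Psi>_def)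
  qed (simp add: \<Psi>_def)
  ultimately show ?thesis
    by (intro exI[of _ \<Psi>] exI[of _ "{x \<in> U. \<phi> x \<in> \<phi> ` U \<inter> N}"]) (auto simp: U)
qed

text \<open>
  A composition of pushes moves a point into \<open>I\<close> as soon as one of them does so: before the first one
  that moves the point it is fixed, and afterwards it never leaves \<open>I\<close> again.
\<close>

lemma combine_pushes:
  assumes "finite T" "\<And>\<Psi> N. (\<Psi>, N) \<in> T \<Longrightarrow> smooth_injection \<Psi> \<and> N \<subseteq> topspace M \<and>
      (\<forall>x\<in>N. \<Psi> x \<in> I) \<and> (\<forall>x\<in>topspace M. \<Psi> x = x \<or> \<Psi> x \<in> I)"
  shows "\<exists>\<Phi>. smooth_injection \<Phi> \<and> (\<forall>x\<in>topspace M. \<Phi> x = x \<or> \<Phi> x \<in> I) \<and> (\<forall>(\<Psi>, N)\<in>T. \<forall>x\<in>N. \<Phi> x \<in> I)"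
  using assms
proof (induction T rule: finite_induct)
  case empty
  then show ?case using smooth_injection_id by (intro exI[of _ "\<lambda>x. x"]) auto
next
  case (insert q T)
  obtain \<Psi> N where q: "q = (\<Psi>, N)" by (cases q)
  have P: "smooth_injection \<Psi>" "N \<subseteq> topspace M" "\<And>x. x \<in> N \<Longrightarrow> \<Psi> x \<in> I"
    "\<And>x. x \<in> topspace M \<Longrightarrow> \<Psi> x = x \<or> \<Psi> x \<in> I"
    using insert.prems[of \<Psi> N] by (simp_all add: q)
  have "\<exists>\<Phi>. smooth_injection \<Phi> \<and> (\<forall>x\<in>topspace M. \<Phi> x = x \<or> \<Phi> x \<in> I) \<and> (\<forall>(\<Psi>, N)\<in>T. \<forall>x\<in>N. \<Phi> x \<in> I)"
    by (rule insert.IH) (rule insert.prems, simp)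
  then obtain \<Phi> where Phi: "smooth_injection \<Phi>" "\<forall>x\<in>topspace M. \<Phi> x = x \<or> \<Phi> x \<in> I"
    "\<forall>(\<Psi>, N)\<in>T. \<forall>x\<in>N. \<Phi> x \<in> I"
    by (elim exE conjE)
  have Ptop: "\<Psi> x \<in> topspace M" if "x \<in> topspace M" for x
    using P(1) that continuous_map_image_subset_topspace unfolding smooth_injection_def by blast
  have I: "\<Phi> (\<Psi> x) \<in> I" if "x \<in> topspace M" "\<Psi> x \<in> I" for x
    using bspec[OF Phi(2) Ptop[OF that(1)]] that(2) by metis
  have "\<Phi> (\<Psi> x) = x \<or> \<Phi> (\<Psi> x) \<in> I" if "x \<in> topspace M" for x
    using P(4)[OF that] bspec[OF Phi(2) that] I[OF that] by metis
  moreover have "\<Phi> (\<Psi> x) \<in> I" if "(\<Psi>', N') \<in> insert q T" "x \<in> N'" for \<Psi>' N' x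
  proof -
    have x: "x \<in> topspace M" using insert.prems[OF that(1)] that(2) by blast
    from that(1) consider "N' = N" | "(\<Psi>', N') \<in> T" by (auto simp: q)
    then show ?thesis
    proof cases
      case 1 then show ?thesis using I[OF x] P(3) that(2) by blast
    next
      case 2
      then have "\<Phi> x \<in> I" using Phi(3) that(2) by blast
      then show ?thesis using P(4)[OF x] I[OF x] by metis
    qed
  qed
  ultimately show ?case using smooth_injection_comp[OF Phi(1) P(1)]
    by (intro exI[of _ "\<lambda>x. \<Phi> (\<Psi> x)"]) (auto split: prod.splits)
qed

lemma push_into_interior:
  obtains C \<Phi> where "finite C" "C \<subseteq> A" "topspace M \<subseteq> \<Union> (fst ` C)" "smooth_injection \<Phi>"
    "\<And>x. x \<in> topspace M \<Longrightarrow> \<Phi> x \<in> \<Union> (inner_part ` C)"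
proof -
  have "\<exists>c \<Psi> N. c \<in> A \<and> smooth_injection \<Psi> \<and> openin M N \<and> p \<in> N \<and> N \<subseteq> fst c \<and> (\<forall>x\<in>N. \<Psi> x \<in> inner_part c) \<and>
    (\<forall>x\<in>topspace M. \<Psi> x = x \<or> \<Psi> x \<in> inner_part c)" if p: "p \<in> topspace M" for p
  proof -
    obtain c where "c \<in> A" "p \<in> fst c" using p cover by blast
    then show ?thesis using chart_push[of c p] by blast
  qed
  then obtain c \<Psi> N where *: "\<And>p. p \<in> topspace M \<Longrightarrow> c p \<in> A \<and> smooth_injection (\<Psi> p) \<and> openin M (N p) \<and> p \<in> N p \<and>
      N p \<subseteq> fst (c p) \<and> (\<forall>x\<in>N p. \<Psi> p x \<in> inner_part (c p)) \<and>
      (\<forall>x\<in>topspace M. \<Psi> p x = x \<or> \<Psi> p x \<in> inner_part (c p))" by metis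
  have cov: "topspace M \<subseteq> \<Union> (N ` topspace M)" using * by blast
  have "\<exists>\<F>. finite \<F> \<and> \<F> \<subseteq> N ` topspace M \<and> topspace M \<subseteq> \<Union> \<F>"
    using compact * cov unfolding compact_space_alt by (metis (no_types, lifting) imageE)
  then obtain \<F> where F: "finite \<F>" "\<F> \<subseteq> N ` topspace M" "topspace M \<subseteq> \<Union> \<F>" by blast
  obtain P where P: "P \<subseteq> topspace M" "finite P" "\<F> = N ` P"
    using finite_subset_image[OF F(1,2)] by blast
  define C where "C = c ` P"
  define I where "I = \<Union> (inner_part ` C)"
  have "\<exists>\<Phi>. smooth_injection \<Phi> \<and> (\<forall>x\<in>topspace M. \<Phi> x = x \<or> \<Phi> x \<in> I) \<and>
      (\<forall>(\<Psi>, N)\<in>(\<lambda>p. (\<Psi> p, N p)) ` P. \<forall>x\<in>N. \<Phi> x \<in> I)"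
  proof (rule combine_pushes)
    fix \<Psi>' N' assume "(\<Psi>', N') \<in> (\<lambda>p. (\<Psi> p, N p)) ` P"
    then obtain p where p: "p \<in> P" "\<Psi>' = \<Psi> p" "N' = N p" by blast
    have "inner_part (c p) \<subseteq> I" using p(1) by (auto simp: I_def C_def)
    moreover have "N p \<subseteq> topspace M" using * P(1) p(1) openin_subset by blast
    ultimately show "smooth_injection \<Psi>' \<and> N' \<subseteq> topspace M \<and> (\<forall>x\<in>N'. \<Psi>' x \<in> I) \<and>
        (\<forall>x\<in>topspace M. \<Psi>' x = x \<or> \<Psi>' x \<in> I)"
      using *[of p] P(1) p by blast
  qed (use P in simp)
  then obtain \<Phi> where Phi: "smooth_injection \<Phi>" "\<forall>p\<in>P. \<forall>x\<in>N p. \<Phi> x \<in> I" by auto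
  have "\<Phi> x \<in> I" if "x \<in> topspace M" for x
    using that F(3) P(3) Phi(2) by blast
  moreover have "topspace M \<subseteq> \<Union> (fst ` C)"
  proof
    fix x assume "x \<in> topspace M"
    then obtain p where p: "p \<in> P" "x \<in> N p" using F(3) P(3) by blast
    then have "x \<in> fst (c p)" using *[of p] P(1) by blast
    then show "x \<in> \<Union> (fst ` C)" using p(1) by (auto simp: C_def)
  qed
  moreover have "finite C" "C \<subseteq> A" using P * by (auto simp: C_def)
  ultimately show ?thesis using that Phi(1) by (simp add: I_def)
qed

end

section \<open>The open manifold and its adapted charts\<close>

context compact_polyhedral begin

lemma inner_part:
  assumes "c \<in> A"
  shows "openin M (inner_part c)" "snd c ` inner_part c = interior (snd c ` fst c)" "inner_part c \<subseteq> fst c"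
proof -
  have ch: "is_chart open_in_polytope M (fst c, snd c)" using chart[OF assms] by simp
  show im: "snd c ` inner_part c = interior (snd c ` fst c)"
    using interior_subset[of "snd c ` fst c"] by (auto simp: inner_part_def)
  show sub: "inner_part c \<subseteq> fst c" by (auto simp: inner_part_def)
  have "openin (top_of_set (snd c ` fst c)) (snd c ` inner_part c)"
    unfolding im by (rule open_subset[OF interior_subset open_interior])
  then show "openin M (inner_part c)" using is_chart_image_open[OF ch sub] by blast
qed

definition inner_charts :: "('m, 'e) chart set \<Rightarrow> ('m, 'e) chart set" where
  "inner_charts C = (\<lambda>c. (inner_part c, snd c)) ` C"

lemma inner_charts_atlas:
  assumes C: "C \<subseteq> A"
  shows "is_atlas open (subtopology M (\<Union> (inner_part ` C))) (inner_charts C)"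
proof -
  let ?I = "\<Union> (inner_part ` C)"
  have "is_chart open (subtopology M ?I) (inner_part c, snd c)" if c: "c \<in> C" for c
  proof -
    have cA: "c \<in> A" using c C by blast
    have op: "open (snd c ` inner_part c)" unfolding inner_part(2)[OF cA] by (rule open_interior)
    have ch: "is_chart open_in_polytope M (fst c, snd c)" using chart[OF cA] by simp
    have "is_chart open M (inner_part c, snd c)"
      by (rule is_chart_restrict[where Q' = "open", OF ch inner_part(1,3)[OF cA] op])
    moreover have int: "inner_part c \<inter> ?I = inner_part c" using c by blast
    ultimately show ?thesis using is_chart_subspace[of "open" M "inner_part c" "snd c" "open" ?I] op by simp
  qed
  moreover have "\<Union> (fst ` inner_charts C) = topspace (subtopology M ?I)"
  proof -
    have "?I \<subseteq> topspace M" using inner_part(1) C openin_subset by blast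
    then show ?thesis by (auto simp: inner_charts_def)
  qed
  moreover have "compatible (inner_part c, snd c) (inner_part d, snd d)" if "c \<in> C" "d \<in> C" for c d
  proof -
    have "compatible c d" "inner_part c \<subseteq> fst c" "inner_part d \<subseteq> fst d"
      using compat inner_part(3) that C by blast+
    then show ?thesis unfolding compatible_def fst_conv snd_conv by (blast intro: smooth_along_subset)
  qed
  ultimately show ?thesis unfolding is_atlas_iff[OF admissible_open] inner_charts_def by blast
qed

text \<open>
  In charts, \<open>\<Phi>\<close> is a smooth map with injective derivative, from an open subset of a polytope to an open
  set.  Seeley's theorem extends it to a neighbourhood, and the inverse function theorem makes the
  extension invertible.  Its inverse, composed with the chart of the open manifold, is a chart in
  which \<open>\<Phi>\<close> becomes the given chart \<open>\<phi>\<close> of \<open>M\<close>.  Compactness of \<open>M\<close> is used to exclude that points far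
  from \<open>x\<close> are mapped near \<open>\<Phi> x\<close>.
\<close>

lemma adapted_chart:
  assumes Phi: "smooth_injection \<Phi>" and C: "C \<subseteq> A"
    and into: "\<And>x. x \<in> topspace M \<Longrightarrow> \<Phi> x \<in> \<Union> (inner_part ` C)" and x: "x \<in> topspace M"
  shows "\<exists>W \<theta>. (W, \<theta>) \<in> generated_atlas open (subtopology M (\<Union> (inner_part ` C))) (inner_charts C) \<and>
    \<Phi> x \<in> W \<and> ({y \<in> topspace M. \<Phi> y \<in> W}, \<theta> \<circ> \<Phi>) \<in> A"
proof -
  let ?I = "\<Union> (inner_part ` C)"
  have cont: "continuous_map M M \<Phi>" and inj: "inj_on \<Phi> (topspace M)"
    using Phi by (auto simp: smooth_injection_def)
  obtain c where c: "c \<in> C" "\<Phi> x \<in> inner_part c" using into[OF x] by blast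
  have cA: "c \<in> A" using c C by blast
  obtain U\<^sub>0 \<psi> where U0: "c = (U\<^sub>0, \<psi>)" by (cases c)
  define Ui where "Ui = inner_part c"
  have Ui: "openin M Ui" "\<psi> ` Ui = interior (\<psi> ` U\<^sub>0)" "Ui \<subseteq> U\<^sub>0" "\<Phi> x \<in> Ui" "Ui \<subseteq> ?I"
    using inner_part[OF cA] c U0 by (auto simp: Ui_def)
  have cA': "(U\<^sub>0, \<psi>) \<in> A" using cA U0 by simp
  note ch0 = chart[OF cA']
  have chi: "is_chart open M (Ui, \<psi>)"
    by (rule is_chart_restrict[where Q' = "open", OF ch0 Ui(1,3)]) (simp add: Ui(2))
  obtain U \<phi> where U: "(U, \<phi>) \<in> A" "x \<in> U" using x cover by fastforce
  note ch = chart[OF U(1)]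
  obtain S where S: "openin M S" "x \<in> S" "S \<subseteq> U" "immersed_along S \<phi> (\<psi> \<circ> \<Phi>)"
    using Phi x U cA' Ui(3,4) unfolding smooth_injection_def by blast
  obtain F where F: "Cinf_on (\<phi> ` S) F" "\<And>y. y \<in> S \<Longrightarrow> F (\<phi> y) = \<psi> (\<Phi> y)"
    "\<And>y. y \<in> S \<Longrightarrow> \<exists>D. (F has_derivative D) (at (\<phi> y) within \<phi> ` S) \<and> inj D"
    using S(4) unfolding immersed_along_def by auto
  have V: "open_in_polytope (\<phi> ` S)" "calculus_domain (\<phi> ` S)"
    using chart_overlap_calculus_domain[OF admissible_open_in_polytope ch S(1,3)] by auto
  have px: "\<phi> x \<in> \<phi> ` S" using S(2) by blast
  obtain O' Fe where Fe: "open O'" "\<phi> x \<in> O'" "Cinf_on O' Fe" "\<And>y. y \<in> O' \<inter> \<phi> ` S \<Longrightarrow> Fe y = F y"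
    by (rule Cinf_on_extend[OF V(1) F(1) px]) (rule that; assumption)
  \<comment> \<open>the derivative of the extension at \<open>\<phi> x\<close> is determined by the polytope side, hence injective\<close>
  obtain T where T: "(Fe has_derivative T) (at (\<phi> x))" "inj T"
  proof -
    obtain T where "(Fe has_derivative T) (at (\<phi> x) within O')"
      using Fe(2,3) unfolding Cinf_on_def by (metis Cn_on.simps(2))
    then have T: "(Fe has_derivative T) (at (\<phi> x))" unfolding at_within_open[OF Fe(2,1)] .
    obtain D where D: "(F has_derivative D) (at (\<phi> x) within \<phi> ` S)" "inj D" using F(3)[OF S(2)] by blast
    have pxO: "\<phi> x \<in> \<phi> ` S \<inter> O'" using px Fe(2) by blast
    have "(F has_derivative D) (at (\<phi> x) within \<phi> ` S \<inter> O')" by (rule has_derivative_subset[OF D(1)]) simp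
    moreover have "(F has_derivative T) (at (\<phi> x) within \<phi> ` S \<inter> O')"
      by (rule has_derivative_transform[OF pxO _ has_derivative_at_withinI[OF T]]) (use Fe(4) in auto)
    moreover have "calculus_domain (\<phi> ` S \<inter> O')"
      using calculus_domain_openin[OF V(2) openin_open_Int[OF Fe(1)]] .
    ultimately have "D = T" using calculus_domain_has_derivative_unique pxO by blast
    then show ?thesis using that T D(2) by blast
  qed
  obtain W0 G where W0: "open W0" "\<phi> x \<in> W0" "W0 \<subseteq> O'" "inj_on Fe W0"
    "\<And>S. open S \<Longrightarrow> S \<subseteq> W0 \<Longrightarrow> open (Fe ` S)" "Cinf_on (Fe ` W0) G" "\<And>y. y \<in> W0 \<Longrightarrow> G (Fe y) = y"
    by (rule inverse_function_theorem[OF Fe(1,2,3) T]) (rule that; assumption)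
  define S' where "S' = {y \<in> U. \<phi> y \<in> \<phi> ` U \<inter> W0} \<inter> S"
  have S': "openin M S'" "x \<in> S'" "S' \<subseteq> S" "\<And>y. y \<in> S' \<Longrightarrow> \<phi> y \<in> W0"
    using is_chart_preimage_open[OF ch openin_open_Int[OF W0(1)]] S U(2) W0(2) by (auto simp: S'_def)
  \<comment> \<open>an open set in which the image of \<open>\<Phi>\<close> comes only from points near \<open>x\<close>\<close>
  define Gm where "Gm = topspace M - \<Phi> ` (topspace M - S')"
  have "compactin M (topspace M - S')"
    using S'(1) compact by (intro closedin_compact_space) auto
  then have "compactin M (\<Phi> ` (topspace M - S'))" by (rule image_compactin[OF _ cont])
  then have "closedin M (\<Phi> ` (topspace M - S'))" by (rule compactin_imp_closedin[OF Hausdorff])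
  then have Gm: "openin M Gm" unfolding Gm_def by blast
  have PhiTop: "\<Phi> y \<in> topspace M" if "y \<in> topspace M" for y
    using continuous_map_image_subset_topspace[OF cont] that by blast
  have GmS: "y \<in> S'" if "y \<in> topspace M" "\<Phi> y \<in> Gm" for y using that by (auto simp: Gm_def)
  have xGm: "\<Phi> x \<in> Gm" using S'(2) x PhiTop inj by (auto simp: Gm_def dest: inj_onD)
  define W1 where "W1 = W0 \<inter> Fe -` (\<psi> ` (Ui \<inter> Gm))"
  have openUG: "open (\<psi> ` (Ui \<inter> Gm))"
  proof -
    have "openin (top_of_set (\<psi> ` Ui)) (\<psi> ` (Ui \<inter> Gm))"
      using is_chart_image_open[OF chi, of "Ui \<inter> Gm"] Ui(1) Gm by auto
    then show ?thesis by (rule openin_open_trans) (simp add: Ui(2))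
  qed
  have contFe: "continuous_on W0 Fe" using Cinf_on_continuous[OF Fe(3)] W0(3) by (rule continuous_on_subset)
  have W1: "open W1" unfolding W1_def by (rule continuous_open_preimage[OF contFe W0(1) openUG])
  define W where "W = {z \<in> Ui \<inter> Gm. \<psi> z \<in> Fe ` W1}"
  define \<theta> where "\<theta> = G \<circ> \<psi>"
  have psiW: "\<psi> ` W = Fe ` W1"
  proof
    show "\<psi> ` W \<subseteq> Fe ` W1" by (auto simp: W_def)
    show "Fe ` W1 \<subseteq> \<psi> ` W"
    proof (rule image_subsetI)
      fix w assume w: "w \<in> W1"
      then obtain z where z: "z \<in> Ui \<inter> Gm" "Fe w = \<psi> z" by (auto simp: W1_def)
      have "\<psi> z \<in> Fe ` W1" using w by (simp flip: z(2))
      then have "z \<in> W" using z(1) by (simp add: W_def)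
      then show "Fe w \<in> \<psi> ` W" using z(2) by blast
    qed
  qed
  have openFW1: "open (Fe ` W1)" using W0(5)[OF W1] by (simp add: W1_def)
  have Wopen: "openin M W"
  proof -
    have "openin M {z \<in> Ui. \<psi> z \<in> \<psi> ` Ui \<inter> Fe ` W1}"
      by (rule is_chart_preimage_open[OF chi openin_open_Int[OF openFW1]])
    moreover have "W = {z \<in> Ui. \<psi> z \<in> \<psi> ` Ui \<inter> Fe ` W1} \<inter> Gm" by (auto simp: W_def)
    ultimately show ?thesis using Gm by auto
  qed
  have GFe: "G (Fe y) = y" if "y \<in> W1" for y using W0(7) that by (simp add: W1_def)
  have thetaW: "\<theta> ` W = W1"
  proof -
    have "\<theta> ` W = G ` \<psi> ` W" by (auto simp: \<theta>_def)
    also have "\<dots> = W1" unfolding psiW using GFe by force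
    finally show ?thesis .
  qed
  have Fetheta: "Fe (\<theta> z) = \<psi> z" if "z \<in> W" for z
    using that GFe by (auto simp: W_def \<theta>_def)
  have contG: "continuous_on (Fe ` W1) G"
    using Cinf_on_continuous[OF W0(6)] by (rule continuous_on_subset) (auto simp: W1_def)
  have hG: "homeomorphic_map (top_of_set (Fe ` W1)) (top_of_set W1) G"
  proof (rule homeomorphic_maps_map[THEN iffD1, THEN conjunct1])
    show "homeomorphic_maps (top_of_set (Fe ` W1)) (top_of_set W1) G Fe"
    proof -
      have "continuous_on W1 Fe" by (rule continuous_on_subset[OF contFe]) (simp add: W1_def)
      then show ?thesis unfolding homeomorphic_maps_def using contG GFe by auto
    qed
  qed
  have WU: "W \<subseteq> Ui" by (auto simp: W_def)
  have chW: "is_chart open M (W, \<psi>)"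
    by (rule is_chart_restrict[where Q' = "open", OF chi Wopen WU]) (simp add: psiW openFW1)
  have "homeomorphic_map (subtopology M W) (top_of_set (\<theta> ` W)) \<theta>"
    unfolding thetaW unfolding \<theta>_def
    by (rule homeomorphic_map_compose[OF is_chartD(5)[OF chW, unfolded psiW] hG])
  then have "is_chart open M (W, \<theta>)" using Wopen W1 by (simp add: is_chart_def thetaW)
  moreover have WI: "W \<inter> ?I = W" using WU Ui(5) by blast
  ultimately have chI: "is_chart open (subtopology M ?I) (W, \<theta>)"
    using is_chart_subspace[of "open" M W \<theta> "open" ?I] W1 by (simp add: thetaW)
  have sm: "smooth_along W \<psi> \<theta>" "smooth_along W \<theta> \<psi>"
  proof -
    have "Cinf_on (\<psi> ` W) G" unfolding psiW by (rule Cinf_on_subset[OF W0(6)]) (auto simp: W1_def)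
    then show "smooth_along W \<psi> \<theta>" unfolding smooth_along_def by (intro exI[of _ G]) (simp add: \<theta>_def)
    have "Cinf_on (\<theta> ` W) Fe" unfolding thetaW
      by (rule Cinf_on_subset[OF Fe(3)]) (use W0(3) in \<open>auto simp: W1_def\<close>)
    then show "smooth_along W \<theta> \<psi>" unfolding smooth_along_def using Fetheta by blast
  qed
  have "compatible (W, \<theta>) (inner_part d, snd d)" if d: "d \<in> C" for d
  proof -
    have "compatible (U\<^sub>0, \<psi>) d" using compat cA' d C by blast
    moreover have "inner_part d \<subseteq> fst d" using inner_part(3) d C by blast
    ultimately have "smooth_along (W \<inter> inner_part d) \<psi> (snd d)" "smooth_along (W \<inter> inner_part d) (snd d) \<psi>"
      using WU Ui(3) by (auto simp: compatible_def intro: smooth_along_subset)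
    moreover have "smooth_along (W \<inter> inner_part d) \<psi> \<theta>" "smooth_along (W \<inter> inner_part d) \<theta> \<psi>"
      using sm by (auto intro: smooth_along_subset)
    ultimately show ?thesis unfolding compatible_def fst_conv snd_conv using smooth_along_trans by blast
  qed
  then have "(W, \<theta>) \<in> generated_atlas open (subtopology M ?I) (inner_charts C)"
    using chI by (auto simp: generated_atlas_def inner_charts_def)
  moreover have "\<Phi> x \<in> W"
  proof -
    have "Fe (\<phi> x) = \<psi> (\<Phi> x)" using Fe(4) F(2) S(2) Fe(2) px by auto
    then have "\<phi> x \<in> W1" using W0(2) Ui(4) xGm by (auto simp: W1_def)
    then show ?thesis using \<open>Fe (\<phi> x) = \<psi> (\<Phi> x)\<close> Ui(4) xGm by (force simp: W_def)
  qed
  moreover have "({y \<in> topspace M. \<Phi> y \<in> W}, \<theta> \<circ> \<Phi>) \<in> A"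
  proof (rule maximal_atlas_restrict[OF admissible_open_in_polytope maximal U(1)])
    show "openin M {y \<in> topspace M. \<Phi> y \<in> W}" by (rule openin_continuous_map_preimage[OF cont Wopen])
    fix y assume y: "y \<in> {y \<in> topspace M. \<Phi> y \<in> W}"
    then have yS: "y \<in> S'" using GmS by (auto simp: W_def)
    then have "\<phi> y \<in> O' \<inter> \<phi> ` S" using S'(3,4) W0(3) by blast
    then have "Fe (\<phi> y) = \<psi> (\<Phi> y)" using Fe(4) F(2) S'(3) yS by auto
    then show "(\<theta> \<circ> \<Phi>) y = \<phi> y" using W0(7)[OF S'(4)[OF yS]] by (simp add: \<theta>_def)
  next
    show "{y \<in> topspace M. \<Phi> y \<in> W} \<subseteq> U" using GmS S'(3) S(3) by (auto simp: W_def)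
  qed
  ultimately show ?thesis by blast
qed

text \<open>
  The set \<open>K i\<close> consists of the points of norm at most \<open>i\<close> whose distance from the complement of \<open>S\<close> is
  at least \<open>1 / (i + 1)\<close>.
\<close>

lemma open_sigma_compact:
  assumes "open (S :: 'e set)"
  obtains K :: "nat \<Rightarrow> 'e set" where "\<And>i. compact (K i)" "S = (\<Union>i. K i)"
proof -
  define K where "K = (\<lambda>i. cball 0 (real i) \<inter> - (\<Union>y\<in>-S. ball y (1 / real (Suc i))))"
  have "compact (K i)" for i
  proof -
    have "closed (- (\<Union>y\<in>-S. ball y (1 / real (Suc i))))" by (intro closed_Compl open_UN) auto
    then show ?thesis unfolding K_def using compact_cball_fd compact_Int_closed by blast
  qed
  moreover have "S = (\<Union>i. K i)"
  proof (intro set_eqI iffI)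
    fix x assume "x \<in> S"
    then obtain e where e: "e > 0" "ball x e \<subseteq> S" using assms openE by blast
    obtain i1 where i1: "norm x \<le> real i1" using real_arch_simple by blast
    obtain i2 where i2: "inverse (real (Suc i2)) < e" using reals_Archimedean[OF e(1)] by blast
    define i where "i = max i1 i2"
    have "1 / real (Suc i) \<le> inverse (real (Suc i2))" by (simp add: i_def divide_inverse le_imp_inverse_le)
    then have "1 / real (Suc i) < e" using i2 by linarith
    then have "x \<notin> ball y (1 / real (Suc i))" if "y \<in> - S" for y
      using e(2) that by (auto simp: dist_commute subset_iff)
    moreover have "norm x \<le> real i" using i1 by (simp add: i_def)
    ultimately show "x \<in> (\<Union>i. K i)" by (auto simp: K_def)
  next
    fix x assume "x \<in> (\<Union>i. K i)"
    then obtain i where "x \<in> K i" by blast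
    moreover have "x \<in> ball x (1 / real (Suc i))" by simp
    ultimately show "x \<in> S" unfolding K_def by blast
  qed
  ultimately show ?thesis using that by blast
qed

lemma interior_sigma_compact:
  assumes C: "finite C" "C \<subseteq> A"
  shows "sigma_compact_space (subtopology M (\<Union> (inner_part ` C)))"
proof -
  let ?I = "\<Union> (inner_part ` C)"
  have "\<exists>K. (\<forall>i. compactin M (K i)) \<and> inner_part c = (\<Union>i::nat. K i)" if c: "c \<in> A" for c
  proof -
    have ch: "is_chart open_in_polytope M (fst c, snd c)" using chart[OF c] by simp
    obtain K :: "nat \<Rightarrow> 'e set" where K: "\<And>i. compact (K i)" "interior (snd c ` fst c) = (\<Union>i. K i)"
      using open_sigma_compact[OF open_interior] by metis
    define K' where "K' = (\<lambda>i. {x \<in> fst c. snd c x \<in> K i})"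
    have "compactin M (K' i)" for i
    proof -
      have sub: "K i \<subseteq> snd c ` fst c" using K(2) interior_subset by blast
      have "snd c ` K' i = K i" using sub by (auto simp: K'_def)
      moreover have "compactin (top_of_set (snd c ` fst c)) (K i)" using K(1) sub by (simp add: compactin_subtopology)
      moreover have "K' i \<subseteq> topspace (subtopology M (fst c))" using is_chartD(6)[OF ch] by (auto simp: K'_def)
      ultimately have "compactin (subtopology M (fst c)) (K' i)"
        using homeomorphic_map_compactness[OF is_chartD(5)[OF ch]] by metis
      then show ?thesis by (simp add: compactin_subtopology)
    qed
    moreover have "inner_part c = (\<Union>i. K' i)" using K(2) by (auto simp: inner_part_def K'_def)
    ultimately show ?thesis by blast
  qed
  then obtain K where K: "\<And>c i. c \<in> A \<Longrightarrow> compactin M (K c i)" "\<And>c. c \<in> A \<Longrightarrow> inner_part c = (\<Union>i::nat. K c i)"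
    by metis
  define L where "L = (\<lambda>i. \<Union>c\<in>C. K c i)"
  have "inner_part c = (\<Union>i. K c i)" if "c \<in> C" for c using K(2) C(2) that by blast
  then have "?I = (\<Union>c\<in>C. \<Union>i. K c i)" by (intro SUP_cong) auto
  then have LI: "(\<Union>i. L i) = ?I" unfolding L_def by blast
  have "compactin M (L i)" for i unfolding L_def
    by (rule compactin_Union) (use C K(1) in auto)
  then have "compactin (subtopology M ?I) (L i)" for i
    using LI by (auto simp: compactin_subtopology)
  moreover have "topspace (subtopology M ?I) = (\<Union>i. L i)"
  proof -
    have "?I \<subseteq> topspace M" using inner_part(1) C openin_subset by blast
    then show ?thesis unfolding LI by auto
  qed
  ultimately show ?thesis unfolding sigma_compact_space_def by blast
qed

text \<open>
  Finitely many chart domains cover \<open>M\<close>, and each of them injects into \<open>E\<close>.  If \<open>E\<close> is infinite, so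
  does their union.  If \<open>E\<close> is finite, so is \<open>M\<close>, and the injection \<open>\<Phi>\<close> is onto.
\<close>

lemma complement_embeds:
  includes cardinal_syntax
  assumes inj: "inj_on \<Phi> (topspace M)" "\<Phi> ` topspace M \<subseteq> I" and I: "I \<subseteq> topspace M"
    and C: "finite C" "C \<subseteq> A" "topspace M \<subseteq> \<Union> (fst ` C)"
  shows "\<exists>\<iota> :: 'm \<Rightarrow> 'e. inj_on \<iota> (I - \<Phi> ` topspace M)"
proof (cases "finite (UNIV :: 'e set)")
  case True
  have "finite (fst c)" if "c \<in> C" for c
  proof -
    have "c \<in> A" using that C(2) by blast
    then have "is_chart open_in_polytope M (fst c, snd c)" using chart[of c] by simp
    then show ?thesis using is_chartD(4) finite_imageD finite_subset[OF subset_UNIV True] by metis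
  qed
  then have "finite (topspace M)" using C(1,3) finite_subset by blast
  then have "\<Phi> ` topspace M = topspace M" using inj I by (intro endo_inj_surj) auto
  then have "I - \<Phi> ` topspace M = {}" using I by blast
  then show ?thesis by (simp only: inj_on_empty simp_thms)
next
  case False
  have "|\<Union>c\<in>C. fst c| \<le>o |UNIV :: 'e set|"
  proof (rule card_of_UNION_ordLeq_infinite[OF False])
    show "|C| \<le>o |UNIV :: 'e set|" using C(1) False by (metis card_of_ordLeq_finite card_of_Well_order ordLeq_total)
    show "\<forall>c\<in>C. |fst c| \<le>o |UNIV :: 'e set|"
    proof
      fix c assume "c \<in> C"
      then have "c \<in> A" using C(2) by blast
      then have "is_chart open_in_polytope M (fst c, snd c)" using chart[of c] by simp
      then have "inj_on (snd c) (fst c)" by (rule is_chartD(4))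
      then show "|fst c| \<le>o |UNIV :: 'e set|" using card_of_ordLeq by blast
    qed
  qed
  then obtain \<iota> :: "'m \<Rightarrow> 'e" where "inj_on \<iota> (\<Union>c\<in>C. fst c)" unfolding card_of_ordLeq[symmetric] by blast
  moreover have "I - \<Phi> ` topspace M \<subseteq> (\<Union>c\<in>C. fst c)" using I C(3) by blast
  ultimately show ?thesis using inj_on_subset by blast
qed

end

section \<open>Assembling the extension\<close>

lemma homeomorphic_map_pullback:
  assumes b: "bij_betw \<gamma> Z (topspace X)"
  shows "homeomorphic_map (pullback_topology Z \<gamma> X) X \<gamma>" "topspace (pullback_topology Z \<gamma> X) = Z"
proof -
  have im: "\<gamma> ` Z = topspace X" and inj: "inj_on \<gamma> Z" using b by (auto simp: bij_betw_def)
  show t: "topspace (pullback_topology Z \<gamma> X) = Z"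
    unfolding topspace_pullback_topology using im by auto
  have "continuous_map (pullback_topology Z \<gamma> X) X \<gamma>"
    using continuous_map_pullback[OF continuous_map_id, of Z \<gamma> X] by simp
  moreover have "open_map (pullback_topology Z \<gamma> X) X \<gamma>" unfolding open_map_def
  proof (intro allI impI)
    fix S assume "openin (pullback_topology Z \<gamma> X) S"
    then obtain U where U: "openin X U" "S = \<gamma> -` U \<inter> Z" unfolding openin_pullback_topology by blast
    have "\<gamma> ` S = U \<inter> \<gamma> ` Z" unfolding U(2) by auto
    then have "\<gamma> ` S = U" unfolding im using openin_subset[OF U(1)] by blast
    then show "openin X (\<gamma> ` S)" using U(1) by simp
  qed
  ultimately show "homeomorphic_map (pullback_topology Z \<gamma> X) X \<gamma>"
    using im inj t by (intro bijective_open_imp_homeomorphic_map) auto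
qed

lemma sigma_compact_space_homeomorphic:
  assumes h: "homeomorphic_map Y X \<gamma>" and X: "sigma_compact_space X"
  shows "sigma_compact_space Y"
proof -
  obtain K where K: "\<And>i. compactin X (K i)" "topspace X = (\<Union>i::nat. K i)"
    using X unfolding sigma_compact_space_def by blast
  have surj: "\<gamma> ` topspace Y = topspace X" using h by (rule homeomorphic_imp_surjective_map)
  have "compactin Y (\<gamma> -` K i \<inter> topspace Y)" for i
  proof -
    have "K i \<subseteq> \<gamma> ` topspace Y" unfolding surj using compactin_subset_topspace[OF K(1)] .
    then have "\<gamma> ` (\<gamma> -` K i \<inter> topspace Y) = K i" by auto
    then show ?thesis using homeomorphic_map_compactness[OF h, of "\<gamma> -` K i \<inter> topspace Y"] K(1) by auto
  qed
  moreover have "topspace Y = (\<Union>i. \<gamma> -` K i \<inter> topspace Y)" using surj unfolding K(2) by blast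
  ultimately show ?thesis unfolding sigma_compact_space_def
    by (intro exI[of _ "\<lambda>i. \<gamma> -` K i \<inter> topspace Y"]) (rule conjI, rule allI)
qed

lemma (in finite_basis) smooth_on_chart_image:
  fixes \<psi> \<eta> :: "'m \<Rightarrow> 'e"
  assumes "admissible Q" "is_chart Q X (V, \<psi>)" "openin X S" "S \<subseteq> V" "smooth_along S \<psi> \<eta>"
    and "\<And>x. x \<in> S \<Longrightarrow> G (\<psi> x) = \<eta> x"
  shows "smooth_on (\<psi> ` S) G"
proof -
  obtain F where F: "Cinf_on (\<psi> ` S) F" "\<forall>x\<in>S. F (\<psi> x) = \<eta> x" using assms(5) by (auto simp: smooth_along_def)
  have "Cinf_on (\<psi> ` S) G" by (rule Cinf_on_cong[OF F(1)]) (use F(2) assms(6) in auto)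
  then show ?thesis
    using smooth_on_iff_Cinf_on chart_overlap_calculus_domain(1)[OF assms(1-4)] by blast
qed

text \<open>
  The manifold \<open>M'\<close> is the open manifold \<open>I\<close>, renamed in such a way that \<open>\<Phi> x\<close> is called \<open>Inl x\<close>.  Then \<open>Inl\<close>
  plays the role of \<open>\<Phi>\<close>, and the adapted charts restrict to charts of \<open>M\<close> on its image.  Since all charts
  of \<open>M'\<close> are compatible with these, so are the restrictions of arbitrary adapted charts.
\<close>

lemma (in compact_polyhedral) polyhedral_embedding:
  "\<exists>(M' :: ('m + 'e) topology) (A' :: ('m + 'e, 'e) chart set).
     smooth_manifold M' A' \<and> sigma_compact_space M' \<and> full_submanifold M' A' (Inl ` topspace M) \<and>
     (\<exists>B. induced_atlas M' A' (Inl ` topspace M) B \<and>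
          smooth_diffeomorphism M A (subtopology M' (Inl ` topspace M)) B Inl)"
proof -
  obtain C \<Phi> where C: "finite C" "C \<subseteq> A" "topspace M \<subseteq> \<Union> (fst ` C)" and Phi: "smooth_injection \<Phi>"
    and into: "\<And>x. x \<in> topspace M \<Longrightarrow> \<Phi> x \<in> \<Union> (inner_part ` C)"
    by (rule push_into_interior) (rule that; assumption)
  define I where "I = \<Union> (inner_part ` C)"
  define X where "X = subtopology M I"
  define A0 where "A0 = generated_atlas open X (inner_charts C)"
  have cont: "continuous_map M M \<Phi>" and inj: "inj_on \<Phi> (topspace M)"
    using Phi by (auto simp: smooth_injection_def)
  have IM: "I \<subseteq> topspace M" unfolding I_def using inner_part(1) C(2) openin_subset by blast
  have topX: "topspace X = I" using IM by (auto simp: X_def)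
  have A0: "is_atlas open X A0"
    using generated_atlas_maximal(1)[OF admissible_open inner_charts_atlas[OF C(2)]]
    unfolding A0_def X_def I_def is_maximal_atlas_def by blast
  have PhiI: "\<Phi> ` topspace M \<subseteq> I" using into by (auto simp: I_def)
  define R where "R = I - \<Phi> ` topspace M"
  obtain \<iota> :: "'m \<Rightarrow> 'e" where iota: "inj_on \<iota> R"
    using complement_embeds[OF inj PhiI IM C] unfolding R_def by blast
  define N where "N = (Inl ` topspace M :: ('m + 'e) set)"
  define Z where "Z = N \<union> Inr ` \<iota> ` R"
  \<comment> \<open>the renaming, from new names to points of \<open>I\<close>\<close>
  define \<gamma> where "\<gamma> = case_sum \<Phi> (inv_into R \<iota>)"
  have gInl: "\<gamma> (Inl x) = \<Phi> x" for x by (simp add: \<gamma>_def)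
  have gInr: "\<gamma> (Inr (\<iota> y)) = y" if "y \<in> R" for y using that iota by (simp add: \<gamma>_def)
  have bij: "bij_betw \<gamma> Z (topspace X)" unfolding bij_betw_def topX
  proof
    have RR: "R \<inter> \<Phi> ` topspace M = {}" by (auto simp: R_def)
    show "inj_on \<gamma> Z"
    proof (rule inj_onI)
      fix u v assume uv: "u \<in> Z" "v \<in> Z" "\<gamma> u = \<gamma> v"
      show "u = v"
        using uv inj RR by (auto simp: Z_def N_def gInl gInr dest: inj_onD)
    qed
    have "\<gamma> ` Z = \<Phi> ` topspace M \<union> R"
      unfolding Z_def N_def image_Un image_image gInl using gInr by auto
    then show "\<gamma> ` Z = I" using PhiI by (auto simp: R_def)
  qed
  define M' where "M' = pullback_topology Z \<gamma> X"
  have hg: "homeomorphic_map M' X \<gamma>" and topM': "topspace M' = Z"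
    using homeomorphic_map_pullback[OF bij] by (auto simp: M'_def)
  define A1 where "A1 = pullback_chart M' \<gamma> ` A0"
  define A' where "A' = generated_atlas open M' A1"
  have A1: "is_atlas open M' A1" unfolding A1_def by (rule is_atlas_pullback[OF admissible_open A0 hg])
  have maxA': "is_maximal_atlas open M' A'" and A1A': "A1 \<subseteq> A'"
    using generated_atlas_maximal[OF admissible_open A1] by (auto simp: A'_def)
  have A': "is_atlas open M' A'" using maxA' by (simp add: is_maximal_atlas_def)
  note A'D = A'[unfolded is_atlas_iff[OF admissible_open]]
  have HX: "Hausdorff_space X" unfolding X_def by (rule Hausdorff_space_subtopology[OF Hausdorff])
  have HM': "Hausdorff_space M'"
    using homeomorphic_Hausdorff_space[OF homeomorphic_map_imp_homeomorphic_space[OF hg]] HX by blast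
  have manifold: "smooth_manifold M' A'" using HM' maxA' by (simp add: smooth_manifold_def)
  have sigma: "sigma_compact_space M'"
    using sigma_compact_space_homeomorphic[OF hg] interior_sigma_compact[OF C(1,2)] by (simp add: X_def I_def)
  have NZ: "N \<subseteq> topspace M'" by (auto simp: topM' Z_def)
  have special: "\<exists>W \<theta>. (W, \<theta>) \<in> A0 \<and> \<Phi> x \<in> W \<and> ({y \<in> topspace M. \<Phi> y \<in> W}, \<theta> \<circ> \<Phi>) \<in> A"
    if "x \<in> topspace M" for x
    using adapted_chart[OF Phi C(2) into that] by (simp add: A0_def X_def I_def)
  have preN: "\<gamma> -` W \<inter> topspace M' \<inter> N = Inl ` {y \<in> topspace M. \<Phi> y \<in> W}" for W
    using NZ by (auto simp: N_def gInl)
  have full: "full_submanifold M' A' N" unfolding full_submanifold_def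
  proof (intro conjI NZ ballI)
    fix z assume "z \<in> N"
    then obtain x where x: "x \<in> topspace M" "z = Inl x" by (auto simp: N_def)
    obtain W \<theta> where W: "(W, \<theta>) \<in> A0" "\<Phi> x \<in> W" "({y \<in> topspace M. \<Phi> y \<in> W}, \<theta> \<circ> \<Phi>) \<in> A"
      using special[OF x(1)] by blast
    have "pullback_chart M' \<gamma> (W, \<theta>) \<in> A'" using W(1) A1A' by (auto simp: A1_def)
    moreover have "(\<theta> \<circ> \<gamma>) ` (\<gamma> -` W \<inter> topspace M' \<inter> N) = (\<theta> \<circ> \<Phi>) ` {y \<in> topspace M. \<Phi> y \<in> W}"
      unfolding preN by (simp add: image_image gInl)
    then have "open_in_polytope ((\<theta> \<circ> \<gamma>) ` (\<gamma> -` W \<inter> topspace M' \<inter> N))"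
      using is_chartD(3)[OF chart[OF W(3)]] by simp
    moreover have "z \<in> \<gamma> -` W \<inter> topspace M'" using W(2) x NZ by (auto simp: gInl N_def)
    ultimately show "\<exists>(U, \<phi>)\<in>adapted_charts A' N. z \<in> U"
      by (intro bexI[of _ "pullback_chart M' \<gamma> (W, \<theta>)"])
        (simp_all add: adapted_charts_def pullback_chart_def)
  qed
  define Y where "Y = subtopology M' N"
  have topY: "topspace Y = N" using NZ by (auto simp: Y_def)
  have contInl: "continuous_map M Y Inl"
  proof -
    have "continuous_map M X \<Phi>" unfolding X_def using cont PhiI by (auto simp: continuous_map_in_subtopology)
    then have "continuous_map M X (\<gamma> \<circ> Inl)" by (simp add: o_def gInl)
    then have "continuous_map M M' Inl" unfolding M'_def
      by (rule continuous_map_pullback') (auto simp: Z_def N_def)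
    then show ?thesis unfolding Y_def by (auto simp: continuous_map_in_subtopology N_def)
  qed
  have hInl: "homeomorphic_map M Y Inl"
    by (rule continuous_imp_homeomorphic_map[OF contInl compact])
      (use HM' in \<open>auto simp: topY N_def Y_def topM' Z_def intro: Hausdorff_space_subtopology\<close>)
  have hproj: "homeomorphic_map Y M projl"
  proof -
    obtain g where g: "homeomorphic_maps M Y Inl g" using hInl unfolding homeomorphic_map_maps by blast
    then have "homeomorphic_map Y M g" "\<And>x. x \<in> topspace M \<Longrightarrow> g (Inl x) = x"
      by (auto simp: homeomorphic_maps_map)
    then show ?thesis by (elim homeomorphic_map_eq) (auto simp: topY N_def)
  qed
  have atM: "is_atlas open_in_polytope M A" using maximal by (simp add: is_maximal_atlas_def)
  define B0 where "B0 = pullback_chart Y projl ` A"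
  define B' where "B' = generated_atlas open_in_polytope Y B0"
  have B0: "is_atlas open_in_polytope Y B0"
    unfolding B0_def by (rule is_atlas_pullback[OF admissible_open_in_polytope atM hproj])
  have maxB: "is_maximal_atlas open_in_polytope Y B'" and B0B: "B0 \<subseteq> B'"
    using generated_atlas_maximal[OF admissible_open_in_polytope B0] by (auto simp: B'_def)
  have induced: "induced_atlas M' A' N B'" unfolding induced_atlas_def Y_def[symmetric]
  proof (intro conjI maxB ballI, clarify)
    fix U \<phi> assume "(U, \<phi>) \<in> adapted_charts A' N"
    then have UA: "(U, \<phi>) \<in> A'" and Q: "open_in_polytope (\<phi> ` (U \<inter> N))" by (auto simp: adapted_charts_def)
    define B2 where "B2 = pullback_chart Y projl ` {c \<in> A. \<exists>W \<theta>. (W, \<theta>) \<in> A0 \<and> c = ({y \<in> topspace M. \<Phi> y \<in> W}, \<theta> \<circ> \<Phi>)}"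
    show "(U \<inter> N, \<phi>) \<in> B'"
    proof (rule maximal_atlas_mem[OF admissible_open_in_polytope maxB, of B2])
      show "B2 \<subseteq> B'" using B0B by (auto simp: B2_def B0_def)
      show "topspace Y \<subseteq> \<Union> (fst ` B2)"
      proof
        fix z assume "z \<in> topspace Y"
        then obtain x where x: "x \<in> topspace M" "z = Inl x" by (auto simp: topY N_def)
        obtain W \<theta> where W: "(W, \<theta>) \<in> A0" "\<Phi> x \<in> W" "({y \<in> topspace M. \<Phi> y \<in> W}, \<theta> \<circ> \<Phi>) \<in> A"
          using special[OF x(1)] by blast
        have "pullback_chart Y projl ({y \<in> topspace M. \<Phi> y \<in> W}, \<theta> \<circ> \<Phi>) \<in> B2" using W by (auto simp: B2_def)
        moreover have "z \<in> fst (pullback_chart Y projl ({y \<in> topspace M. \<Phi> y \<in> W}, \<theta> \<circ> \<Phi>))"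
          using x W(2) by (simp add: pullback_chart_def topY N_def)
        ultimately show "z \<in> \<Union> (fst ` B2)" by blast
      qed
      show "is_chart open_in_polytope Y (U \<inter> N, \<phi>)"
        unfolding Y_def by (rule is_chart_subspace[of "open"]) (use A'D UA Q in auto)
      fix d assume "d \<in> B2"
      then obtain W \<theta> where W: "(W, \<theta>) \<in> A0" "d = pullback_chart Y projl ({y \<in> topspace M. \<Phi> y \<in> W}, \<theta> \<circ> \<Phi>)"
        unfolding B2_def by blast
      have "compatible (U, \<phi>) (pullback_chart M' \<gamma> (W, \<theta>))"
        using A'D UA A1A' W(1) by (auto simp: A1_def)
      then have c: "smooth_along (U \<inter> (\<gamma> -` W \<inter> topspace M')) \<phi> (\<theta> \<circ> \<gamma>)"
        "smooth_along (U \<inter> (\<gamma> -` W \<inter> topspace M')) (\<theta> \<circ> \<gamma>) \<phi>"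
        by (auto simp: compatible_def pullback_chart_def)
      have d: "fst d = \<gamma> -` W \<inter> topspace M' \<inter> N" "snd d = \<theta> \<circ> \<Phi> \<circ> projl"
        unfolding preN W(2) by (auto simp: pullback_chart_def topY N_def)
      have eq: "(\<theta> \<circ> \<gamma>) z = (\<theta> \<circ> \<Phi> \<circ> projl) z" if "z \<in> N" for z
        using that by (auto simp: N_def gInl)
      let ?S = "U \<inter> N \<inter> fst d"
      have sub: "?S \<subseteq> U \<inter> (\<gamma> -` W \<inter> topspace M')" using d(1) by blast
      show "compatible (U \<inter> N, \<phi>) d" unfolding compatible_def fst_conv snd_conv d(2)
        using smooth_along_cong[OF smooth_along_subset[OF c(1) sub], of \<phi> "\<theta> \<circ> \<Phi> \<circ> projl"]
          smooth_along_cong[OF smooth_along_subset[OF c(2) sub], of "\<theta> \<circ> \<Phi> \<circ> projl" \<phi>] eq by auto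
    qed
  qed
  have chB: "is_chart open_in_polytope Y (V, \<psi>)" if "(V, \<psi>) \<in> B'" for V \<psi>
    using that by (simp add: B'_def generated_atlas_def)
  have smB: "smooth_along (V \<inter> (projl -` U \<inter> N)) \<psi> (\<phi> \<circ> projl)" "smooth_along (V \<inter> (projl -` U \<inter> N)) (\<phi> \<circ> projl) \<psi>"
    if "(U, \<phi>) \<in> A" "(V, \<psi>) \<in> B'" for U \<phi> V \<psi>
    using that by (auto simp: B'_def generated_atlas_def B0_def compatible_def pullback_chart_def topY)
  have invInl: "inv_into (topspace M) Inl z = projl z" if "z \<in> N" for z
    using that by (auto simp: N_def)
  have "smooth_diffeomorphism M A Y B' Inl" unfolding smooth_diffeomorphism_def smooth_map_def
  proof (intro conjI ballI; (clarify)?)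
    show "bij_betw Inl (topspace M) (topspace Y)" by (auto simp: bij_betw_def topY N_def)
    show "continuous_map M Y Inl" by (rule contInl)
    show "continuous_map Y M (inv_into (topspace M) Inl)"
      by (rule continuous_map_eq[OF homeomorphic_imp_continuous_map[OF hproj]]) (simp add: topY invInl)
  next
    fix U \<phi> V \<psi> assume UV: "(U, \<phi>) \<in> A" "(V, \<psi>) \<in> B'"
    note chU = chart[OF UV(1)] and chV = chB[OF UV(2)]
    let ?S = "{x \<in> U. Inl x \<in> V}"
    have S: "openin M ?S"
    proof -
      have "?S = U \<inter> {x \<in> topspace M. Inl x \<in> V}" using is_chartD(2)[OF chU] by auto
      then show ?thesis
        using openin_Int[OF is_chartD(1)[OF chU] openin_continuous_map_preimage[OF contInl is_chartD(1)[OF chV]]]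
        by (simp only:)
    qed
    have "Inl ` ?S \<subseteq> V \<inter> (projl -` U \<inter> N)" using is_chartD(2)[OF chU] by (auto simp: N_def)
    from smooth_along_comp[OF smB(2)[OF UV] this] have "smooth_along ?S \<phi> (\<psi> \<circ> Inl)" by (simp add: o_def)
    then show "smooth_on (\<phi> ` ?S) (\<psi> \<circ> Inl \<circ> inv_into U \<phi>)"
      by (rule smooth_on_chart_image[OF admissible_open_in_polytope chU S, rotated])
        (use is_chartD(4)[OF chU] in auto)
  next
    fix V \<psi> U \<phi> assume UV: "(V, \<psi>) \<in> B'" "(U, \<phi>) \<in> A"
    note chU = chart[OF UV(2)] and chV = chB[OF UV(1)]
    have VN: "V \<subseteq> N" using is_chartD(2)[OF chV] by (simp add: topY)
    let ?S = "{z \<in> V. inv_into (topspace M) Inl z \<in> U}"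
    have Seq: "?S = V \<inter> (projl -` U \<inter> N)" using VN invInl by auto
    have "openin Y (projl -` U \<inter> topspace Y)" using is_chartD(1)[OF is_chart_pullback(1)[OF chU hproj]] .
    then have S: "openin Y ?S" unfolding Seq using is_chartD(1)[OF chV] by (auto simp: topY)
    have "smooth_along ?S \<psi> (\<phi> \<circ> projl)" unfolding Seq by (rule smB(1)[OF UV(2,1)])
    then show "smooth_on (\<psi> ` ?S) (\<phi> \<circ> inv_into (topspace M) Inl \<circ> inv_into V \<psi>)"
      by (rule smooth_on_chart_image[OF admissible_open_in_polytope chV S, rotated])
        (use is_chartD(4)[OF chV] VN invInl in auto)
  qed
  then show ?thesis using manifold sigma full induced unfolding Y_def N_def by blast
qed

theorem proposition1p3:
  fixes M :: "'m topology" and A :: "('m, 'e::real_normed_vector) chart set" and n :: nat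
  assumes "has_dimension TYPE('e) n"
    and "locally_polyhedral_manifold M A"
    and "compact_space M"
  shows "\<exists>(M' :: ('m + 'e) topology) (A' :: ('m + 'e, 'e) chart set).
           smooth_manifold M' A' \<and>
           sigma_compact_space M' \<and>
           full_submanifold M' A' (Inl ` topspace M) \<and>
           (\<exists>B. induced_atlas M' A' (Inl ` topspace M) B \<and>
                smooth_diffeomorphism M A (subtopology M' (Inl ` topspace M)) B Inl)"
proof -
  obtain B :: "'e set" where B: "finite_basis B"
    using has_dimension_finite_basis[OF assms(1)] .
  have "compact_polyhedral B M A"
    using B assms(2,3)
    by (simp add: compact_polyhedral_def compact_polyhedral_axioms_def locally_polyhedral_manifold_def)
  then show ?thesis by (rule compact_polyhedral.polyhedral_embedding)
qed

end
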